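(* Let $d\in\mathbb{N}$ and let $w$ be a $\mathbb{C}^{d\times d}$-valued function on the unit circle $\mathbb{T}$ such that $w\in L_1^{d\times d}(\mathbb{T})$, $w(e^{i\theta})$ is a positive Hermitian matrix for $\sigma$-a.e. $\theta$, and $w^{-1}\in L_1^{d\times d}(\mathbb{T})$. Let $T_n(w)$, $\{a_k\}$, $\{\tilde a_k\}$, $\{b^k_{n,u,\ell}\}$, $\{\tilde b^k_{n,u,\ell}\}$ be the objects attached to $w$ as defined in the context. Then the following two assertions hold. (i) For $n\in\mathbb{N}$ and $s,t\in\{1,\dots,n\}$, $$\left(T_n(w)^{-1}\right)^{s,t}=\sum_{\ell=1}^{s\wedge t}\tilde a_{s-\ell}^*\tilde a_{t-\ell}+\sum_{u=1}^t\sum_{k=1}^\infty\left\{\sum_{\ell=0}^\infty\tilde b_{n,u,\ell}^{2k-1}a_{n+1-s+\ell}+\sum_{\ell=0}^\infty\tilde b_{n,u,\ell}^{2k}\tilde a_{s+\ell}\right\}^*\tilde a_{t-u}.$$ (ii) For $n\in\mathbb{N}$ and $s,t\in\{1,\dots,n\}$, $$\left(T_n(w)^{-1}\right)^{s,t}=\sum_{\ell=s\vee t}^{n}a_{\ell-s}^*a_{\ell-t}+\sum_{u=t}^n\sum_{k=1}^\infty\left\{\sum_{\ell=0}^\infty b_{n,u,\ell}^{2k-1}\tilde a_{s+\ell}+\sum_{\ell=0}^\infty b_{n,u,\ell}^{2k}a_{n+1-s+\ell}\right\}^*a_{u-t}.$$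
   Context: $\mathbb{T}=\{z\in\mathbb{C}:|z|=1\}$, $\mathbb{D}=\{z\in\mathbb{C}:|z|<1\}$, $\sigma=d\theta/(2\pi)$ on $[-\pi,\pi)$. $L_1^{d\times d}(\mathbb{T})$ is the space of $\mathbb{C}^{d\times d}$-valued functions with entries in $L_1(\mathbb{T},\sigma)$. $A^*$ is the conjugate transpose; $s\vee t=\max(s,t)$, $s\wedge t=\min(s,t)$. $\ell_{2+}^{d\times d}$ is the space of sequences $\{a_k\}_{k\ge 0}$ in $\mathbb{C}^{d\times d}$ with $\sum_k\|a_k\|^2<\infty$ ($\|\cdot\|$ the operator norm). Toeplitz matrix: $\gamma(k)=\int_{-\pi}^{\pi}e^{-ik\theta}w(e^{i\theta})\frac{d\theta}{2\pi}\in\mathbb{C}^{d\times d}$ for $k\in\mathbb{Z}$, and $T_n(w)\in\mathbb{C}^{dn\times dn}$ is the block matrix whose $(s,t)$ block is $\gamma(s-t)$, $1\le s,t\le n$. For $A\in\mathbb{C}^{dn\times dn}$, $A^{s,t}\in\mathbb{C}^{d\times d}$ denotes its $(s,t)$ block. Outer factors: $H_2^{d\times d}(\mathbb{T})$ is the space of $\mathbb{C}^{d\times d}$-valued functions with entries in the Hardy class $H_2$ (functions on $\mathbb{T}$ identified with their holomorphic extensions to $\mathbb{D}$). $h\in H_2^{d\times d}(\mathbb{T})$ is outer if $\det h$ is a scalar outer function, i.e. $\log|\det h(0)|=\int\log|\det h(e^{i\theta})|\,\sigma(d\theta)$. Under the assumptions on $w$ there are outer functions $h,h_\sharp\in H_2^{d\times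 d}(\mathbb{T})$, unique up to constant unitary factors and fixed throughout, with $w(e^{i\theta})=h(e^{i\theta})h(e^{i\theta})^*=h_\sharp(e^{i\theta})^*h_\sharp(e^{i\theta})$ $\sigma$-a.e. Put $\tilde h(z)=\{h_\sharp(\overline z)\}^*$. The functions $h^{-1},h_\sharp^{-1},\tilde h^{-1}$ also belong to $H_2^{d\times d}(\mathbb{T})$. Define $\{a_k\},\{\tilde a_k\}\in\ell_{2+}^{d\times d}$ by $$-h(z)^{-1}=\sum_{k=0}^\infty z^ka_k,\qquad -\tilde h(z)^{-1}=\sum_{k=0}^\infty z^k\tilde a_k,\qquad z\in\mathbb{D}.$$ Define for $k\in\mathbb{Z}$ $$\beta_k=-\int_{-\pi}^{\pi}e^{-ik\theta}h(e^{i\theta})^*h_\sharp(e^{i\theta})^{-1}\frac{d\theta}{2\pi}=-\int_{-\pi}^{\pi}e^{-ik\theta}h(e^{i\theta})^{-1}h_\sharp(e^{i\theta})^*\frac{d\theta}{2\pi}.$$ For $n\in\mathbb{N}$, $u\in\{1,\dots,n\}$, $k\in\mathbb{N}$, the sequences $\{b^k_{n,u,\ell}\}_{\ell\ge0},\{\tilde b^k_{n,u,\ell}\}_{\ell\ge0}\in\ell_{2+}^{d\times d}$ are defined by the (well-defined) recursions $$b^1_{n,u,\ell}=\beta_{u+\ell},\quad b^{2k}_{n,u,\ell}=\sum_{m=0}^\infty b^{2k-1}_{n,u,m}\beta^*_{n+1+m+\ell},\quad b^{2k+1}_{n,u,\ell}=\sum_{m=0}^\infty b^{2k}_{n,u,m}\beta_{n+1+m+\ell},$$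 $$\tilde b^1_{n,u,\ell}=\beta^*_{n+1-u+\ell},\quad \tilde b^{2k}_{n,u,\ell}=\sum_{m=0}^\infty \tilde b^{2k-1}_{n,u,m}\beta_{n+1+m+\ell},\quad \tilde b^{2k+1}_{n,u,\ell}=\sum_{m=0}^\infty \tilde b^{2k}_{n,u,m}\beta^*_{n+1+m+\ell}.$$ *)

theory Defs
  imports "HOL-Complex_Analysis.Complex_Analysis"
begin

text \<open>
  The size \<open>d\<close> is the cardinality of the index type \<open>'d\<close>.  A point of the unit circle is
  \<^term>\<open>cis \<theta>\<close>.
\<close>

definition adj :: "complex^'d^'d \<Rightarrow> complex^'d^'d" where
  "adj A = (\<chi> i j. cnj (A $ j $ i))"

definition pos_hermitian :: "complex^'d^'d \<Rightarrow> bool" where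
  "pos_hermitian A \<longleftrightarrow> adj A = A \<and>
     (\<forall>x. x \<noteq> 0 \<longrightarrow> Re (\<Sum>i\<in>UNIV. \<Sum>j\<in>UNIV. cnj (x $ i) * A $ i $ j * x $ j) > 0)"

text \<open>
  The measure is built from Lebesgue measure and not from \<^term>\<open>lborel\<close>: it is complete, so that
  functions which are only specified almost everywhere (boundary values) are still measurable.
\<close>

definition circ :: "real measure" where
  "circ = density (lebesgue_on {-pi..<pi}) (\<lambda>_. ennreal (1 / (2 * pi)))"

definition L1_mat :: "(complex \<Rightarrow> complex^'d^'d) \<Rightarrow> bool" where
  "L1_mat F \<longleftrightarrow> (\<forall>i j. integrable circ (\<lambda>\<theta>. F (cis \<theta>) $ i $ j))"

definition fourier_coeff :: "(complex \<Rightarrow> complex^'d^'d) \<Rightarrow> int \<Rightarrow> complex^'d^'d" where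
  "fourier_coeff F k = (\<chi> i j. LINT \<theta>|circ. cis (- (of_int k * \<theta>)) * F (cis \<theta>) $ i $ j)"


text \<open>
  A \<open>dn \<times> dn\<close> matrix is represented by its family of \<open>d \<times> d\<close> blocks, with block indices in
  \<open>{1..n}\<close>; entries outside this range are irrelevant.  As for \<^const>\<open>matrix_inv\<close>, the inverse is
  an arbitrary choice among the two-sided inverses; its blocks with indices in \<open>{1..n}\<close> are unique
  if an inverse exists.
\<close>

type_synonym 'd blocks = "nat \<Rightarrow> nat \<Rightarrow> complex^'d^'d"

definition is_block_inverse :: "nat \<Rightarrow> 'd::finite blocks \<Rightarrow> 'd blocks \<Rightarrow> bool" where
  "is_block_inverse n A B \<longleftrightarrow> (\<forall>s\<in>{1..n}. \<forall>t\<in>{1..n}.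
     (\<Sum>r=1..n. A s r ** B r t) = (if s = t then mat 1 else 0) \<and>
     (\<Sum>r=1..n. B s r ** A r t) = (if s = t then mat 1 else 0))"

definition block_invertible :: "nat \<Rightarrow> 'd::finite blocks \<Rightarrow> bool" where
  "block_invertible n A \<longleftrightarrow> (\<exists>B. is_block_inverse n A B)"

definition block_inv :: "nat \<Rightarrow> 'd::finite blocks \<Rightarrow> 'd blocks" where
  "block_inv n A = (SOME B. is_block_inverse n A B)"

text \<open>\<open>T\<^sub>n(w)\<close> consists of the blocks of \<open>toeplitz w\<close> with indices in \<open>{1..n}\<close>.\<close>

definition toeplitz :: "(complex \<Rightarrow> complex^'d^'d) \<Rightarrow> 'd::finite blocks" where
  "toeplitz w s t = fourier_coeff w (int s - int t)"


text \<open>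
  A function in the Hardy class is given on the closed unit disc: it is holomorphic inside, and its
  values on the circle are almost everywhere the radial limits.  This is the identification of a
  function on the circle with its holomorphic extension.
\<close>

definition hardy2 :: "(complex \<Rightarrow> complex) \<Rightarrow> bool" where
  "hardy2 f \<longleftrightarrow> f holomorphic_on ball 0 1 \<and>
     (\<exists>C. \<forall>r. 0 \<le> r \<and> r < 1 \<longrightarrow> (LINT \<theta>|circ. (cmod (f (of_real r * cis \<theta>)))\<^sup>2) \<le> C) \<and>
     (AE \<theta> in circ. ((\<lambda>r. f (of_real r * cis \<theta>)) \<longlongrightarrow> f (cis \<theta>)) (at_left 1))"

definition hardy2_mat :: "(complex \<Rightarrow> complex^'d^'d) \<Rightarrow> bool" where
  "hardy2_mat F \<longleftrightarrow> (\<forall>i j. hardy2 (\<lambda>z. F z $ i $ j))"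

text \<open>
  The conditions \<open>f 0 \<noteq> 0\<close> and integrability exclude the values \<open>-\<infinity>\<close> on either side, which
  \<^const>\<open>ln\<close> and the Bochner integral would replace by \<open>0\<close>.
\<close>

definition outer_scalar :: "(complex \<Rightarrow> complex) \<Rightarrow> bool" where
  "outer_scalar f \<longleftrightarrow> f 0 \<noteq> 0 \<and> integrable circ (\<lambda>\<theta>. ln (cmod (f (cis \<theta>)))) \<and>
     ln (cmod (f 0)) = (LINT \<theta>|circ. ln (cmod (f (cis \<theta>))))"

definition outer_mat :: "(complex \<Rightarrow> complex^'d^'d) \<Rightarrow> bool" where
  "outer_mat F \<longleftrightarrow> hardy2_mat F \<and> outer_scalar (\<lambda>z. det (F z))"

definition outer_factors ::
  "(complex \<Rightarrow> complex^'d^'d) \<Rightarrow> (complex \<Rightarrow> complex^'d^'d) \<Rightarrow> (complex \<Rightarrow> complex^'d^'d) \<Rightarrow> bool" where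
  "outer_factors w h hs \<longleftrightarrow> outer_mat h \<and> outer_mat hs \<and>
     (AE \<theta> in circ. w (cis \<theta>) = h (cis \<theta>) ** adj (h (cis \<theta>)) \<and>
                    w (cis \<theta>) = adj (hs (cis \<theta>)) ** hs (cis \<theta>))"


text \<open>
  In the following, \<open>h\<close> and \<open>hs\<close> stand for \<open>h\<close> and \<open>h\<^sub>\<sharp>\<close>, and a trailing \<open>t\<close> in a name stands for a
  tilde.
\<close>

definition tilde :: "(complex \<Rightarrow> complex^'d^'d) \<Rightarrow> complex \<Rightarrow> complex^'d^'d" where
  "tilde hs z = adj (hs (cnj z))"

text \<open>The power series coefficients at \<open>0\<close> of \<open>-F(z)\<^sup>-\<^sup>1\<close>.\<close>

definition neg_inv_coeff :: "(complex \<Rightarrow> complex^'d^'d) \<Rightarrow> nat \<Rightarrow> complex^'d^'d" where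
  "neg_inv_coeff F k =
     (\<chi> i j. fps_nth (fps_expansion (\<lambda>z. (- matrix_inv (F z)) $ i $ j) 0) k)"

definition a_seq :: "(complex \<Rightarrow> complex^'d^'d) \<Rightarrow> nat \<Rightarrow> complex^'d^'d" where
  "a_seq h = neg_inv_coeff h"

definition at_seq :: "(complex \<Rightarrow> complex^'d^'d) \<Rightarrow> nat \<Rightarrow> complex^'d^'d" where
  "at_seq hs = neg_inv_coeff (tilde hs)"

definition beta ::
  "(complex \<Rightarrow> complex^'d^'d) \<Rightarrow> (complex \<Rightarrow> complex^'d^'d) \<Rightarrow> int \<Rightarrow> complex^'d^'d" where
  "beta h hs k = - fourier_coeff (\<lambda>z. adj (h z) ** matrix_inv (hs z)) k"

text \<open>
  \<open>b_seq \<beta> n u k l\<close> and \<open>bt_seq \<beta> n u k l\<close> are defined for \<open>k \<ge> 1\<close>; the value at \<open>k = 0\<close> is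
  a dummy.
\<close>

fun b_seq :: "(int \<Rightarrow> complex^'d^'d) \<Rightarrow> nat \<Rightarrow> nat \<Rightarrow> nat \<Rightarrow> nat \<Rightarrow> complex^'d^'d" where
  "b_seq \<beta> n u 0 l = 0"
| "b_seq \<beta> n u (Suc 0) l = \<beta> (int (u + l))"
| "b_seq \<beta> n u (Suc (Suc k)) l =
     (\<Sum>m. b_seq \<beta> n u (Suc k) m **
        (if even k then adj (\<beta> (int (n + 1 + m + l))) else \<beta> (int (n + 1 + m + l))))"

fun bt_seq :: "(int \<Rightarrow> complex^'d^'d) \<Rightarrow> nat \<Rightarrow> nat \<Rightarrow> nat \<Rightarrow> nat \<Rightarrow> complex^'d^'d" where
  "bt_seq \<beta> n u 0 l = 0"
| "bt_seq \<beta> n u (Suc 0) l = adj (\<beta> (int (n + 1 - u + l)))"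
| "bt_seq \<beta> n u (Suc (Suc k)) l =
     (\<Sum>m. bt_seq \<beta> n u (Suc k) m **
        (if even k then \<beta> (int (n + 1 + m + l)) else adj (\<beta> (int (n + 1 + m + l)))))"

end

theory Submission
  imports Defs
begin

text \<open>
  Write \<open>g\<close> for \<open>h\<^sub>\<sharp>\<close> and \<open>V = h\<^sup>* g\<^sup>-\<^sup>1 = h\<^sup>-\<^sup>1 g\<^sup>*\<close>.  This function is unitary, because \<open>h h\<^sup>* = g\<^sup>* g\<close>,
  and \<open>-\<beta>\<^sub>k\<close> are its Fourier coefficients.

  Fix \<open>n\<close> and let \<open>N = {1, ..., n}\<close>.  A trigonometric polynomial \<open>p\<close> with frequencies in \<open>N\<close> satisfies
  \<open>T\<^sub>n(w) p = c\<close> if the Fourier coefficients of \<open>w p = g\<^sup>* (g p)\<close> in \<open>N\<close> are \<open>c\<close>.  The space of all \<open>g p\<close>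
  consists of the square integrable \<open>x\<close> such that \<open>x\<close> has no frequencies in \<open>I = {..0}\<close> and \<open>V x\<close> has
  none in \<open>J = {n + 1..}\<close>: then \<open>g\<^sup>-\<^sup>1 x = (h\<^sup>*)\<^sup>-\<^sup>1 (V x)\<close> is integrable with frequencies in \<open>N\<close> only, so
  it is a trigonometric polynomial (\<open>fc_eq_0_imp_AE_0\<close>).  Hence the orthogonal projection of
  \<open>e\<^sub>u = e\<^bsup>iu\<theta>\<^esup>\<close> to this intersection of two subspaces is \<open>g p\<close> for the solution \<open>p = p\<^sub>u\<close> of
  \<open>T\<^sub>n(w) p = (g\<^sup>* e\<^sub>u restricted to N)\<close>.  Since \<open>(g\<^sup>*)\<^sup>-\<^sup>1\<close> has coefficients \<open>-a'\<^sub>k\<close> at the frequencies \<open>-k\<close>,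
  the columns of the inverse are finite combinations of the \<open>p\<^sub>u\<close> (\<open>toeplitz_rinv\<close>); in particular the
  inverse exists.

  By von Neumann's theorem the projection is the limit of the alternating projections
  \<open>v\<^sub>0 = e\<^sub>u\<close>, \<open>v\<^sub>k\<^sub>+\<^sub>1 = v\<^sub>k - V\<^sup>* m\<^sub>k + n\<^sub>k\<close>, where \<open>m\<^sub>k\<close> is the part of \<open>V v\<^sub>k\<close> in \<open>J\<close> and \<open>n\<^sub>k\<close> the part of
  \<open>V\<^sup>* m\<^sub>k\<close> in \<open>I\<close>.  The series in the assertion are the telescoping sums of the coefficients of
  \<open>g\<^sup>-\<^sup>1 v\<^sub>k\<close>: the coefficients of \<open>m\<^sub>k\<close> and \<open>n\<^sub>k\<close> obey the recursion of the \<open>b'\<close> with odd and even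
  upper index (\<open>bt_seq_odd\<close>), and those of \<open>g\<^sup>-\<^sup>1 V\<^sup>* m\<^sub>k = (h\<^sup>*)\<^sup>-\<^sup>1 m\<^sub>k\<close> and \<open>g\<^sup>-\<^sup>1 n\<^sub>k\<close> are the inner sums,
  all up to signs and adjoints.
  The series of the \<open>m\<^sub>k\<close> themselves need not converge, since the sum of the orthogonal complements of
  the two subspaces need not be closed.
  The second expansion is the first one for \<open>h\<^sup>*\<close>, \<open>g\<^sup>*\<close>, \<open>V\<^sup>*\<close> in place of \<open>g\<close>, \<open>h\<close>, \<open>V\<close>, with \<open>I\<close> and \<open>J\<close>
  exchanged.

  All this uses that \<open>h\<^sup>-\<^sup>1\<close> and \<open>g\<^sup>-\<^sup>1\<close> are Hardy functions (\<open>hardy2_mat_inverse_outer\<close>).  For an outer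
  function \<open>h\<close> the quotient of \<open>det h\<close> by the analytic function whose modulus is the exponential of the
  Poisson integral of \<open>ln \<bar>det h\<bar>\<close> attains its maximal modulus at the origin, so
  \<open>ln \<bar>det h\<bar>\<close> equals this Poisson integral on the disc (\<open>cmod_det_outer\<close>).  By Cramer's rule the
  entries of \<open>h\<^sup>-\<^sup>1\<close> are then dominated by Poisson integrals of their boundary values.
\<close>

section \<open>The normalised measure on the circle\<close>

lemma space_circ [simp]: "space circ = {-pi..<pi}"
  by (simp add: circ_def)

lemma sets_circ [measurable_cong]: "sets circ = sets (lebesgue_on {-pi..<pi})"
  by (simp add: circ_def)

lemma measurable_circ_iff: "f \<in> borel_measurable circ \<longleftrightarrow> f \<in> borel_measurable (lebesgue_on {-pi..<pi})"
  using measurable_cong_sets[OF sets_circ refl, of borel] by blast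

lemma AE_circ_iff: "(AE x in circ. P x) \<longleftrightarrow> (AE x in lebesgue_on {-pi..<pi}. P x)"
  unfolding circ_def by (subst AE_density) auto

lemma AE_circ_iff_lebesgue: "(AE x in circ. P x) \<longleftrightarrow> (AE x in lebesgue. x \<in> {-pi..<pi} \<longrightarrow> P x)"
  unfolding AE_circ_iff by (subst AE_restrict_space_iff) auto

lemma emeasure_circ: "emeasure circ {-pi..<pi} = 1"
proof -
  have "emeasure circ {-pi..<pi} = ennreal (1 / (2 * pi)) * emeasure (lebesgue_on {-pi..<pi}) {-pi..<pi}"
    unfolding circ_def by (rule emeasure_density_const) (auto simp: sets_restrict_space)
  also have "\<dots> = ennreal (1 / (2 * pi)) * ennreal (2 * pi)"
    by (simp add: emeasure_restrict_space)
  also have "\<dots> = 1"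
    by (simp add: ennreal_mult' [symmetric])
  finally show ?thesis .
qed

interpretation circ: finite_measure circ
  by (rule finite_measureI) (simp add: emeasure_circ)

lemma measure_circ [simp]: "measure circ {-pi..<pi} = 1"
  by (simp add: measure_def emeasure_circ)

lemma borel_measurable_circ_continuous:
  fixes f :: "real \<Rightarrow> 'a::topological_space"
  assumes "continuous_on UNIV f"
  shows "f \<in> borel_measurable circ"
proof -
  have "f \<in> borel_measurable borel"
    using assms by (rule borel_measurable_continuous_onI)
  then have "f \<in> borel_measurable lebesgue"
    by (intro measurable_completion) (simp add: measurable_lborel1)
  then show ?thesis
    unfolding measurable_circ_iff by (rule measurable_restrict_space1)
qed

text \<open>This rests on the completeness of Lebesgue measure; it makes functions measurable that are only
  known as radial limits.\<close>

lemma borel_measurable_circ_AE_cong: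
  fixes f g :: "real \<Rightarrow> 'a::euclidean_space"
  assumes "f \<in> borel_measurable circ" and "AE x in circ. f x = g x"
  shows "g \<in> borel_measurable circ"
proof -
  have *: "(\<lambda>x. if x \<in> {-pi..<pi} then f x else 0) \<in> borel_measurable lebesgue"
    using assms(1) unfolding measurable_circ_iff by (subst borel_measurable_if) auto
  have "AE x in lebesgue. (if x \<in> {-pi..<pi} then f x else 0) = (if x \<in> {-pi..<pi} then g x else 0)"
    using assms(2) unfolding AE_circ_iff_lebesgue by eventually_elim auto
  then have "(\<lambda>x. if x \<in> {-pi..<pi} then g x else 0) \<in> borel_measurable lebesgue"
    using borel_measurable_AE[OF *] by simp
  then show ?thesis unfolding measurable_circ_iff by (subst (asm) borel_measurable_if) auto
qed

lemma integrable_circ_bounded: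
  fixes f :: "real \<Rightarrow> 'a::{banach, second_countable_topology}"
  assumes "f \<in> borel_measurable circ" "\<And>x. norm (f x) \<le> B"
  shows "integrable circ f"
  by (rule circ.integrable_const_bound[where B=B]) (use assms in auto)

section \<open>Square integrable functions\<close>

definition sqint :: "(real \<Rightarrow> 'a::euclidean_space) \<Rightarrow> bool" where
  "sqint f \<longleftrightarrow> f \<in> borel_measurable circ \<and> integrable circ (\<lambda>x. (norm (f x))\<^sup>2)"

lemma sqintD: "sqint f \<Longrightarrow> f \<in> borel_measurable circ" "sqint f \<Longrightarrow> integrable circ (\<lambda>x. (norm (f x))\<^sup>2)"
  by (auto simp: sqint_def)

lemma sqint_le:
  assumes "f \<in> borel_measurable circ" "integrable circ g" "AE x in circ. (norm (f x))\<^sup>2 \<le> g x"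
  shows "sqint f"
  unfolding sqint_def
proof
  show "integrable circ (\<lambda>x. (norm (f x))\<^sup>2)"
    by (rule Bochner_Integration.integrable_bound[OF assms(2)])
       (use assms in \<open>auto elim!: eventually_mono\<close>)
qed fact

lemma sqint_cong_AE:
  assumes "sqint f" "AE x in circ. f x = g x"
  shows "sqint g"
proof (rule sqint_le)
  show "g \<in> borel_measurable circ" using assms by (auto simp: sqint_def intro: borel_measurable_circ_AE_cong)
  show "integrable circ (\<lambda>x. (norm (f x))\<^sup>2)" using assms by (simp add: sqint_def)
  show "AE x in circ. (norm (g x))\<^sup>2 \<le> (norm (f x))\<^sup>2" using assms(2) by eventually_elim auto
qed

lemma sum_sq_bound: "(norm (x + y :: 'a::real_normed_vector))\<^sup>2 \<le> 2 * (norm x)\<^sup>2 + 2 * (norm y)\<^sup>2"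
proof -
  have "(norm (x + y))\<^sup>2 \<le> (norm x + norm y)\<^sup>2" by (simp add: norm_triangle_ineq power_mono)
  also have "\<dots> \<le> 2 * (norm x)\<^sup>2 + 2 * (norm y)\<^sup>2"
    using zero_le_power2[of "norm x - norm y"] unfolding power2_diff power2_sum by linarith
  finally show ?thesis .
qed

lemma sqint_add:
  assumes "sqint f" "sqint g" shows "sqint (\<lambda>x. f x + g x)"
  by (rule sqint_le[where g="\<lambda>x. 2 * (norm (f x))\<^sup>2 + 2 * (norm (g x))\<^sup>2"])
     (use assms in \<open>auto simp: sqint_def sum_sq_bound\<close>)



lemma sqint_uminus: "sqint f \<Longrightarrow> sqint (\<lambda>x. - f x)"
  by (auto simp: sqint_def)

lemma sqint_diff:
  assumes "sqint f" "sqint g" shows "sqint (\<lambda>x. f x - g x)"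
  using sqint_add[OF assms(1) sqint_uminus[OF assms(2)]] by simp

lemma sqint_zero [simp]: "sqint (\<lambda>x. 0)"
  by (simp add: sqint_def)

lemma sqint_sum: "(\<And>i. i \<in> A \<Longrightarrow> sqint (f i)) \<Longrightarrow> sqint (\<lambda>x. \<Sum>i\<in>A. f i x)"
  by (induction A rule: infinite_finite_induct) (auto intro: sqint_add)

lemma sqint_bounded:
  assumes "f \<in> borel_measurable circ" "\<And>x. norm (f x) \<le> B"
  shows "sqint f"
  by (rule sqint_le[where g="\<lambda>_. B\<^sup>2"]) (use assms in \<open>auto intro!: power_mono\<close>)

lemma sqint_norm: "sqint f \<Longrightarrow> sqint (\<lambda>x. norm (f x))"
  by (auto simp: sqint_def)

lemma integrable_mult_sqint:
  assumes "sqint f" "sqint g"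
  shows "integrable circ (\<lambda>x. norm (f x) * norm (g x))"
proof (rule Bochner_Integration.integrable_bound)
  show "integrable circ (\<lambda>x. (norm (f x))\<^sup>2 + (norm (g x))\<^sup>2)" using assms by (auto simp: sqint_def)
  show "(\<lambda>x. norm (f x) * norm (g x)) \<in> borel_measurable circ" using assms by (auto simp: sqint_def)
  have "x * y \<le> x\<^sup>2 + y\<^sup>2" if "0 \<le> x" "0 \<le> y" for x y :: real
  proof -
    have "0 \<le> (x - y)\<^sup>2" "0 \<le> x * y" using that by auto
    then show ?thesis unfolding power2_diff by linarith
  qed
  then show "AE x in circ. norm (norm (f x) * norm (g x)) \<le> norm ((norm (f x))\<^sup>2 + (norm (g x))\<^sup>2)"
    by auto
qed

lemma integrable_times_sqint:
  fixes f g :: "real \<Rightarrow> complex"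
  assumes "sqint f" "sqint g"
  shows "integrable circ (\<lambda>x. f x * g x)"
  by (rule Bochner_Integration.integrable_bound[OF integrable_mult_sqint[OF assms]])
     (use assms in \<open>auto simp: sqint_def norm_mult\<close>)

lemma integrable_sqint:
  fixes f :: "real \<Rightarrow> 'a::euclidean_space"
  assumes "sqint f" shows "integrable circ f"
proof (rule Bochner_Integration.integrable_bound)
  show "integrable circ (\<lambda>x. 1 + (norm (f x))\<^sup>2)" using assms by (auto simp: sqint_def)
  have "x \<le> 1 + x\<^sup>2" for x :: real
    using zero_le_power2[of "x - 1"] zero_le_power2[of x] unfolding power2_diff by (simp, linarith)
  then show "AE x in circ. norm (f x) \<le> norm (1 + (norm (f x))\<^sup>2)"
    by auto
qed (use assms in \<open>auto simp: sqint_def\<close>)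

lemma discriminant_bound:
  fixes a b c :: real
  assumes q: "\<And>s. 0 \<le> s\<^sup>2 * a - 2 * s * c + b" and "0 \<le> a"
  shows "c\<^sup>2 \<le> a * b"
proof (cases "a = 0")
  case True
  have "c = 0"
  proof (rule ccontr)
    assume "c \<noteq> 0"
    then show False using q[of "(b + 1) / (2 * c)"] True by simp
  qed
  then show ?thesis using True by simp
next
  case False
  then have "a > 0" using \<open>0 \<le> a\<close> by linarith
  then show ?thesis using q[of "c / a"] by (simp add: field_simps power2_eq_square)
qed

lemma Cauchy_Schwarz_circ:
  assumes "sqint f" "sqint g"
  shows "(LINT x|circ. norm (f x) * norm (g x))\<^sup>2 \<le>
    (LINT x|circ. (norm (f x))\<^sup>2) * (LINT x|circ. (norm (g x))\<^sup>2)"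
    (is "?I\<^sup>2 \<le> ?a * ?b")
proof -
  have q: "0 \<le> s\<^sup>2 * ?a - 2 * s * ?I + ?b" for s
  proof -
    have "0 \<le> (LINT x|circ. (s * norm (f x) - norm (g x))\<^sup>2)" by simp
    also have "\<dots> = (LINT x|circ. s\<^sup>2 * (norm (f x))\<^sup>2 - 2 * s * (norm (f x) * norm (g x)) + (norm (g x))\<^sup>2)"
      by (simp add: power2_diff power_mult_distrib algebra_simps)
    also have "\<dots> = s\<^sup>2 * ?a - 2 * s * ?I + ?b"
      using integrable_mult_sqint[OF assms] sqintD(2)[OF assms(1)] sqintD(2)[OF assms(2)] by simp
    finally show ?thesis .
  qed
  show ?thesis by (rule discriminant_bound[OF q]) simp
qed

text \<open>A Cauchy sequence has an almost everywhere convergent subsequence, and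
  by Fatou's lemma its limit is the limit in mean square.\<close>

lemma sqint_complete:
  fixes f :: "nat \<Rightarrow> real \<Rightarrow> 'a::euclidean_space"
  assumes sq: "\<And>n. sqint (f n)"
    and cauchy: "\<And>e. e > 0 \<Longrightarrow> \<exists>N. \<forall>m\<ge>N. \<forall>n\<ge>N. (LINT x|circ. (norm (f m x - f n x))\<^sup>2) < e"
  obtains g where "sqint g" "(\<lambda>n. LINT x|circ. (norm (f n x - g x))\<^sup>2) \<longlonglongrightarrow> 0"
proof -
  note [measurable] = sqintD(1)[OF sq]
  have L1: "\<exists>N. \<forall>m\<ge>N. \<forall>n\<ge>N. (LINT x|circ. norm (f m x - f n x)) < e" if "e > 0" for e
  proof -
    have "e\<^sup>2 > 0" using that by simp
    from cauchy[OF this] obtain N where N: "\<forall>m\<ge>N. \<forall>n\<ge>N. (LINT x|circ. (norm (f m x - f n x))\<^sup>2) < e\<^sup>2" ..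
    have "(LINT x|circ. norm (f m x - f n x)) < e" if "m \<ge> N" "n \<ge> N" for m n
    proof -
      have one: "sqint (\<lambda>_. 1::real)" by (rule sqint_bounded[where B=1]) auto
      have "(LINT x|circ. norm (f m x - f n x))\<^sup>2 \<le> (LINT x|circ. (norm (f m x - f n x))\<^sup>2)"
        using Cauchy_Schwarz_circ[OF sqint_diff[OF sq[of m] sq[of n]] one] by simp
      also have "\<dots> < e\<^sup>2" using N that by simp
      finally show ?thesis using \<open>e > 0\<close> by (simp add: power2_less_imp_less)
    qed
    then show ?thesis by blast
  qed
  obtain r where r: "strict_mono r" "AE x in circ. Cauchy (\<lambda>i. f (r i) x)"
    by (rule cauchy_L1_AE_cauchy_subseq[of circ f]) (use L1 integrable_sqint[OF sq] in auto)
  define g where "g = (\<lambda>x. lim (\<lambda>i. f (r i) x))"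
  have lim: "AE x in circ. (\<lambda>i. f (r i) x) \<longlonglongrightarrow> g x"
    using r(2) by eventually_elim (auto simp: g_def Cauchy_convergent_iff convergent_LIMSEQ_iff)
  have [measurable]: "g \<in> borel_measurable circ"
    unfolding g_def by (rule borel_measurable_lim_metric) simp
  have est: "(\<integral>\<^sup>+x. ennreal ((norm (f n x - g x))\<^sup>2) \<partial>circ) \<le> ennreal e"
    if N: "\<And>m. m \<ge> N \<Longrightarrow> (LINT x|circ. (norm (f n x - f m x))\<^sup>2) < e" for n N e
  proof -
    have "(\<integral>\<^sup>+x. ennreal ((norm (f n x - g x))\<^sup>2) \<partial>circ) =
       (\<integral>\<^sup>+x. liminf (\<lambda>i. ennreal ((norm (f n x - f (r i) x))\<^sup>2)) \<partial>circ)"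
    proof (rule nn_integral_cong_AE)
      show "AE x in circ. ennreal ((norm (f n x - g x))\<^sup>2) = liminf (\<lambda>i. ennreal ((norm (f n x - f (r i) x))\<^sup>2))"
        using lim
      proof eventually_elim
        case (elim x)
        have "(\<lambda>i. ennreal ((norm (f n x - f (r i) x))\<^sup>2)) \<longlonglongrightarrow> ennreal ((norm (f n x - g x))\<^sup>2)"
          by (intro tendsto_intros elim)
        from lim_imp_Liminf[OF sequentially_bot this] show ?case by (rule sym)
      qed
    qed
    also have "\<dots> \<le> liminf (\<lambda>i. \<integral>\<^sup>+x. ennreal ((norm (f n x - f (r i) x))\<^sup>2) \<partial>circ)"
      by (rule nn_integral_liminf) simp
    also have "\<dots> \<le> ennreal e"
    proof (rule Liminf_le)
      show "\<forall>\<^sub>F i in sequentially. (\<integral>\<^sup>+x. ennreal ((norm (f n x - f (r i) x))\<^sup>2) \<partial>circ) \<le> ennreal e"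
        using eventually_ge_at_top[of N]
      proof eventually_elim
        case (elim i)
        have "r i \<ge> N" using elim seq_suble[OF r(1), of i] by linarith
        then have "(LINT x|circ. (norm (f n x - f (r i) x))\<^sup>2) < e" by (rule N)
        then show ?case
          unfolding nn_integral_eq_integral[OF sqintD(2)[OF sqint_diff[OF sq[of n] sq[of "r i"]]] AE_I2[OF zero_le_power2]]
          by (intro ennreal_leI less_imp_le)
      qed
    qed simp
    finally show ?thesis .
  qed
  have sqd: "sqint (\<lambda>x. f n x - g x)" if "\<And>m. m \<ge> N \<Longrightarrow> (LINT x|circ. (norm (f n x - f m x))\<^sup>2) < e" for n N e
    unfolding sqint_def
  proof
    show "integrable circ (\<lambda>x. (norm (f n x - g x))\<^sup>2)"
    proof (rule integrableI_bounded)
      have "(\<integral>\<^sup>+x. ennreal (norm ((norm (f n x - g x))\<^sup>2)) \<partial>circ) \<le> ennreal e"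
        using est[OF that] by simp
      also have "\<dots> < \<infinity>" by simp
      finally show "(\<integral>\<^sup>+x. ennreal (norm ((norm (f n x - g x))\<^sup>2)) \<partial>circ) < \<infinity>" .
    qed measurable
  qed measurable
  from cauchy[OF zero_less_one] obtain N1
    where N1: "\<forall>m\<ge>N1. \<forall>n\<ge>N1. (LINT x|circ. (norm (f m x - f n x))\<^sup>2) < 1" ..
  have sqg: "sqint g"
    using sqint_diff[OF sq[of N1] sqd[of N1 N1 1]] N1 by simp
  have "(\<lambda>n. LINT x|circ. (norm (f n x - g x))\<^sup>2) \<longlonglongrightarrow> 0"
  proof (rule LIMSEQ_I)
    fix e :: real assume "e > 0"
    then have "e/2 > 0" by simp
    from cauchy[OF this] obtain N where N: "\<forall>m\<ge>N. \<forall>n\<ge>N. (LINT x|circ. (norm (f m x - f n x))\<^sup>2) < e/2" ..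
    have "norm ((LINT x|circ. (norm (f n x - g x))\<^sup>2) - 0) < e" if "n \<ge> N" for n
    proof -
      have "ennreal (LINT x|circ. (norm (f n x - g x))\<^sup>2) \<le> ennreal (e/2)"
        using est[of N n "e/2"] N that
        unfolding nn_integral_eq_integral[OF sqintD(2)[OF sqint_diff[OF sq[of n] sqg]] AE_I2[OF zero_le_power2]]
        by blast
      then have "(LINT x|circ. (norm (f n x - g x))\<^sup>2) \<le> e/2"
        using \<open>e > 0\<close> by (subst (asm) ennreal_le_iff) auto
      moreover have "(LINT x|circ. (norm (f n x - g x))\<^sup>2) \<ge> 0" by (rule integral_nonneg_AE) simp
      ultimately show ?thesis using \<open>e > 0\<close> by simp
    qed
    then show "\<exists>N. \<forall>n\<ge>N. norm ((LINT x|circ. (norm (f n x - g x))\<^sup>2) - 0) < e" by blast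
  qed
  then show ?thesis using that sqg by blast
qed



section \<open>Fourier coefficients\<close>

definition fc :: "(real \<Rightarrow> complex) \<Rightarrow> int \<Rightarrow> complex" where
  "fc f k = (LINT x|circ. cis (- (of_int k * x)) * f x)"

lemma measurable_cis [measurable]: "(\<lambda>x. cis (c * x)) \<in> borel_measurable circ"
  by (intro borel_measurable_circ_continuous continuous_intros)

lemma measurable_cis' [measurable]: "(\<lambda>x. cis (- (c * x))) \<in> borel_measurable circ"
  by (intro borel_measurable_circ_continuous continuous_intros)

lemma integrable_cis_times:
  assumes "integrable circ f"
  shows "integrable circ (\<lambda>x. cis (c * x) * f x)" "integrable circ (\<lambda>x. cis (- (c * x)) * f x)"
  by (rule Bochner_Integration.integrable_bound[OF assms];
      use assms in \<open>auto simp: norm_mult borel_measurable_integrable\<close>)+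

lemma fc_add: "integrable circ f \<Longrightarrow> integrable circ g \<Longrightarrow> fc (\<lambda>x. f x + g x) k = fc f k + fc g k"
  by (simp add: fc_def distrib_left integrable_cis_times)

lemma fc_diff: "integrable circ f \<Longrightarrow> integrable circ g \<Longrightarrow> fc (\<lambda>x. f x - g x) k = fc f k - fc g k"
  by (simp add: fc_def right_diff_distrib integrable_cis_times)

lemma fc_cmult: "fc (\<lambda>x. c * f x) k = c * fc f k"
  by (simp add: fc_def mult.left_commute)

lemma fc_zero [simp]: "fc (\<lambda>x. 0) k = 0"
  by (simp add: fc_def)

lemma fc_sum: "(\<And>i. i \<in> A \<Longrightarrow> integrable circ (f i)) \<Longrightarrow> fc (\<lambda>x. \<Sum>i\<in>A. f i x) k = (\<Sum>i\<in>A. fc (f i) k)"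
  by (induction A rule: infinite_finite_induct) (simp_all add: fc_add)

lemma fc_cong_AE: "f \<in> borel_measurable circ \<Longrightarrow> g \<in> borel_measurable circ \<Longrightarrow> AE x in circ. f x = g x \<Longrightarrow> fc f k = fc g k"
  unfolding fc_def by (rule integral_cong_AE) (auto elim: eventually_mono)

lemma fc_cnj: "fc (\<lambda>x. cnj (f x)) k = cnj (fc f (- k))"
  unfolding fc_def by (subst Bochner_Integration.integral_cnj [symmetric]) (simp add: cis_cnj del: Bochner_Integration.integral_cnj)

lemma fc_shift: "fc (\<lambda>x. cis (of_int m * x) * f x) k = fc f (k - m)"
  unfolding fc_def mult.assoc[symmetric] cis_mult by (simp add: algebra_simps)

lemma integral_circ_lebesgue:
  fixes f :: "real \<Rightarrow> 'a::euclidean_space"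
  assumes "f \<in> borel_measurable circ"
  shows "integral\<^sup>L circ f = (1 / (2 * pi)) *\<^sub>R (LINT x|lebesgue_on {-pi..<pi}. f x)"
  unfolding circ_def using assms
  by (subst integral_density) (auto simp: measurable_circ_iff)

lemma integral_cis: "(LINT x|circ. cis (of_int k * x)) = (if k = 0 then 1 else 0)"
proof (cases "k = 0")
  case False
  have *: "((\<lambda>x. cis (of_int k * x)) has_integral
     (cis (of_int k * pi) / (\<i> * of_int k) - cis (of_int k * (-pi)) / (\<i> * of_int k))) {-pi..pi}"
  proof (rule fundamental_theorem_of_calculus)
    fix x assume "x \<in> {-pi..pi}"
    show "((\<lambda>x. cis (of_int k * x) / (\<i> * of_int k)) has_vector_derivative cis (of_int k * x)) (at x within {-pi..pi})"
    proof -
      have "((\<lambda>z. exp (\<i> * of_int k * z) / (\<i> * of_int k)) has_field_derivative exp (\<i> * of_int k * of_real x)) (at (of_real x))"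
        using False by (auto intro!: derivative_eq_intros)
      then show ?thesis
        using has_vector_derivative_real_field[of _ _ x "{-pi..pi}"] by (simp add: cis_conv_exp mult.assoc)
    qed
  qed simp
  have "cis (of_int k * pi) = cis (of_int k * (-pi))"
    using sin_npi_int[of k] by (simp add: complex_eq_iff mult.commute)
  then have *: "((\<lambda>x. cis (of_int k * x)) has_integral 0) {-pi..pi}" using * by simp
  have "((\<lambda>x. cis (of_int k * x)) has_integral 0) {-pi..<pi}"
  proof (rule iffD2[OF has_integral_spike_set_eq *])
    show "negligible {x \<in> {-pi..<pi} - {-pi..pi}. cis (of_int k * x) \<noteq> 0}"
      by (rule negligible_subset[of "{}"]) auto
    show "negligible {x \<in> {-pi..pi} - {-pi..<pi}. cis (of_int k * x) \<noteq> 0}"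
      by (rule negligible_subset[of "{pi}"]) auto
  qed
  moreover have "integrable (lebesgue_on {-pi..<pi}) (\<lambda>x. cis (of_int k * x))"
  proof -
    have "integrable circ (\<lambda>x. cis (of_int k * x))"
      by (rule integrable_circ_bounded[where B=1]) auto
    then have "integrable (lebesgue_on {-pi..<pi}) (\<lambda>x. (1 / (2 * pi)) *\<^sub>R cis (of_int k * x))"
      unfolding circ_def by (subst (asm) integrable_density) (auto simp: measurable_circ_iff[symmetric])
    then have "integrable (lebesgue_on {-pi..<pi}) (\<lambda>x. (2 * pi) *\<^sub>R (1 / (2 * pi)) *\<^sub>R cis (of_int k * x))"
      by (rule integrable_scaleR_right)
    then show ?thesis by simp
  qed
  ultimately show ?thesis using False
    by (simp add: integral_circ_lebesgue lebesgue_integral_eq_integral integral_unique)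
qed simp

lemma fc_cis: "fc (\<lambda>x. cis (of_int m * x)) k = (if k = m then 1 else 0)"
  using fc_shift[of m "\<lambda>_. 1" k] integral_cis[of "m - k"]
  by (simp add: fc_def algebra_simps)

lemma integrable_cis [simp]: "integrable circ (\<lambda>x. cis (c * x))"
  by (rule integrable_circ_bounded[where B=1]) auto

lemma sqint_cis [simp]: "sqint (\<lambda>x. cis (c * x))"
  by (rule sqint_bounded[where B=1]) auto

lemma fc_trig_sum:
  "finite K \<Longrightarrow> fc (\<lambda>x. \<Sum>m\<in>K. c m * cis (of_int m * x)) k = (if k \<in> K then c k else 0)"
  by (subst fc_sum) (auto simp: fc_cmult fc_cis if_distrib cong: if_cong)

subsection \<open>Real trigonometric polynomials\<close>

text \<open>Real parts of analytic monomials span the real trigonometric polynomials.  In this form the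
  harmonic extension to the disc is evident, and their closure under products makes the
  Stone-Weierstrass theorem applicable.\<close>

inductive_set rtrig :: "(real \<Rightarrow> real) set" where
  cis: "(\<lambda>x. Re (c * cis (real k * x))) \<in> rtrig"
| add: "p \<in> rtrig \<Longrightarrow> q \<in> rtrig \<Longrightarrow> (\<lambda>x. p x + q x) \<in> rtrig"

lemma rtrig_cis_int: "(\<lambda>x. Re (c * cis (of_int k * x))) \<in> rtrig"
proof (cases "k \<ge> 0")
  case True
  then show ?thesis using rtrig.cis[of c "nat k"] by simp
next
  case False
  have "(\<lambda>x. Re (c * cis (of_int k * x))) = (\<lambda>x. Re (cnj c * cis (real (nat (- k)) * x)))"
    using False by (auto simp: fun_eq_iff)
  then show ?thesis using rtrig.cis[of "cnj c" "nat (- k)"] by simp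
qed

lemma rtrig_mult_cis:
  assumes "q \<in> rtrig" shows "(\<lambda>x. Re (c * cis (real k * x)) * q x) \<in> rtrig"
  using assms
proof induction
  case (cis d m)
  have "Re (c * cis (real k * x)) * Re (d * cis (real m * x)) =
     Re (c * d / 2 * cis (of_int (int k + int m) * x)) + Re (c * cnj d / 2 * cis (of_int (int k - int m) * x))" for x
  proof -
    have re: "Re x * Re y = Re (x * y / 2) + Re (x * cnj y / 2)" for x y
      by (simp add: diff_divide_distrib add_divide_distrib)
    have e1: "cis (of_int (int k + int m) * x) = cis (real k * x) * cis (real m * x)"
      by (simp add: cis_mult distrib_right)
    have e2: "cis (of_int (int k - int m) * x) = cis (real k * x) * cnj (cis (real m * x))"
      by (simp add: cis_cnj cis_mult left_diff_distrib)
    show ?thesis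
      unfolding e1 e2 by (subst re) (simp only: complex_cnj_mult mult_ac times_divide_eq_left times_divide_eq_right)
  qed
  then show ?case by (simp only:) (intro rtrig.add rtrig_cis_int)
next
  case (add p q)
  then show ?case by (simp add: distrib_left rtrig.add)
qed

lemma rtrig_mult:
  assumes "p \<in> rtrig" "q \<in> rtrig" shows "(\<lambda>x. p x * q x) \<in> rtrig"
  using assms(1)
proof induction
  case (cis c k)
  show ?case by (rule rtrig_mult_cis[OF assms(2)])
next
  case (add p p')
  show ?case unfolding distrib_right by (rule rtrig.add[OF add.IH])
qed

lemma rtrig_real_polynomial:
  assumes "real_polynomial_function (p :: complex \<Rightarrow> real)"
  shows "(\<lambda>x. p (cis x)) \<in> rtrig"
  using assms
proof induction
  case (linear f)
  interpret bounded_linear f by fact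
  have eq: "f z = Re (Complex (f 1) (- f \<i>) * z)" for z
  proof -
    have "f z = f (Re z *\<^sub>R 1 + Im z *\<^sub>R \<i>)" by (rule arg_cong[where f=f]) (simp add: complex_eq_iff)
    also have "\<dots> = Re z * f 1 + Im z * f \<i>" by (simp only: add scaleR real_scaleR_def)
    finally show ?thesis by (simp add: algebra_simps)
  qed
  have "(\<lambda>x. f (cis x)) = (\<lambda>x. Re (Complex (f 1) (- f \<i>) * cis (real 1 * x)))"
    by (rule ext, subst eq, simp only: of_nat_1 mult_1)
  then show ?case by (simp only: rtrig.cis)
next
  case (const c)
  show ?case using rtrig.cis[of "of_real c" 0] by simp
next
  case (add f g)
  show ?case by (rule rtrig.add[OF add.IH])
next
  case (mult f g)
  show ?case by (rule rtrig_mult[OF mult.IH])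
qed

lemma rtrig_approx:
  fixes u :: "complex \<Rightarrow> real"
  assumes "continuous_on (sphere 0 1) u" "e > 0"
  obtains p where "p \<in> rtrig" "\<And>x. \<bar>u (cis x) - p x\<bar> < e"
proof -
  obtain g where "real_polynomial_function g" "\<And>x. x \<in> sphere 0 1 \<Longrightarrow> \<bar>u x - g x\<bar> < e"
    using Stone_Weierstrass_real_polynomial_function[OF compact_sphere assms] by blast
  then show ?thesis using that[OF rtrig_real_polynomial] by simp
qed

subsection \<open>Uniqueness of Fourier coefficients of integrable functions\<close>

lemma fc_zero_rtrig:
  assumes f: "integrable circ f" "\<And>k. fc f k = 0" and "p \<in> rtrig"
  shows "integrable circ (\<lambda>x. of_real (p x) * f x) \<and> (LINT x|circ. of_real (p x) * f x) = 0"
  using assms(3)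
proof induction
  case (cis c k)
  have *: "of_real (Re (c * cis (real k * x))) * f x =
      c / 2 * (cis (real k * x) * f x) + cnj c / 2 * (cis (- (real k * x)) * f x)" for x
  proof -
    have "of_real (Re x) = x / 2 + cnj x / 2" for x
      by (simp add: complex_eq_iff)
    then show ?thesis
      by (simp only: complex_cnj_mult cis_cnj distrib_right distrib_left mult_ac times_divide_eq_left times_divide_eq_right)
  qed
  have "(LINT x|circ. cis (real k * x) * f x) = 0" "(LINT x|circ. cis (- (real k * x)) * f x) = 0"
    using f(2)[of "- int k"] f(2)[of "int k"] by (simp_all add: fc_def)
  then show ?case
    unfolding * using integrable_cis_times[OF f(1), of "real k"] by simp
next
  case (add p q)
  then show ?case by (simp add: distrib_right)
qed



lemma continuous_on_cis_compose:
  assumes "continuous_on (sphere 0 1) u"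
  shows "continuous_on UNIV (\<lambda>x. u (cis x))"
  by (rule continuous_on_compose2[OF assms]) (auto intro!: continuous_intros)

lemma continuous_on_sphere_bounded:
  fixes u :: "complex \<Rightarrow> 'a::real_normed_vector"
  assumes "continuous_on (sphere 0 1) u"
  obtains B where "\<And>x. norm (u (cis x)) \<le> B"
proof -
  have "bounded (u ` sphere 0 1)"
    using assms by (intro compact_imp_bounded compact_continuous_image) auto
  then obtain B where "\<forall>x\<in>u ` sphere 0 1. norm x \<le> B" unfolding bounded_iff ..
  then show ?thesis using that[of B] by simp
qed

lemma integrable_bounded_times:
  fixes f :: "real \<Rightarrow> complex"
  assumes "integrable circ f" "q \<in> borel_measurable circ" "AE x in circ. norm (q x) \<le> B"
  shows "integrable circ (\<lambda>x. q x * f x)"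
proof (rule Bochner_Integration.integrable_bound)
  show "integrable circ (\<lambda>x. B * norm (f x))" using assms by simp
  show "(\<lambda>x. q x * f x) \<in> borel_measurable circ" using assms by auto
  show "AE x in circ. norm (q x * f x) \<le> norm (B * norm (f x))"
    using assms(3)
  proof eventually_elim
    case (elim x)
    then have "norm (q x) * norm (f x) \<le> B * norm (f x)" by (rule mult_right_mono) simp
    then show ?case by (simp add: norm_mult)
  qed
qed

lemma fc_zero_continuous:
  fixes u :: "complex \<Rightarrow> real"
  assumes f: "integrable circ f" "\<And>k. fc f k = 0" and u: "continuous_on (sphere 0 1) u"
  shows "(LINT x|circ. of_real (u (cis x)) * f x) = 0"
proof -
  have le: "norm (LINT x|circ. of_real (u (cis x)) * f x) \<le> e * (LINT x|circ. norm (f x))" if e: "e > 0" for e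
  proof -
    obtain p where p: "p \<in> rtrig" "\<And>x. \<bar>u (cis x) - p x\<bar> < e"
      using rtrig_approx[OF u e] by blast
    obtain B where B: "\<And>x. norm (u (cis x)) \<le> B" using continuous_on_sphere_bounded[OF u] by blast
    have [measurable]: "(\<lambda>x. u (cis x)) \<in> borel_measurable circ"
      by (rule borel_measurable_circ_continuous[OF continuous_on_cis_compose[OF u]])
    have iu: "integrable circ (\<lambda>x. of_real (u (cis x)) * f x)"
      by (rule integrable_bounded_times[OF f(1), where B=B]) (use B in auto)
    note pz = fc_zero_rtrig[OF f p(1)]
    have "(LINT x|circ. of_real (u (cis x)) * f x) = (LINT x|circ. of_real (u (cis x)) * f x - of_real (p x) * f x)"
      using iu pz by simp
    also have "norm \<dots> \<le> (LINT x|circ. norm (of_real (u (cis x)) * f x - of_real (p x) * f x))"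
      by (rule integral_norm_bound)
    also have "\<dots> \<le> (LINT x|circ. e * norm (f x))"
    proof (rule integral_mono)
      fix x
      have "norm (of_real (u (cis x)) * f x - of_real (p x) * f x) = \<bar>u (cis x) - p x\<bar> * norm (f x)"
        by (simp only: left_diff_distrib[symmetric] of_real_diff[symmetric] norm_mult norm_of_real)
      also have "\<dots> \<le> e * norm (f x)" using p(2)[of x] by (intro mult_right_mono) auto
      finally show "norm (of_real (u (cis x)) * f x - of_real (p x) * f x) \<le> e * norm (f x)" .
    qed (use f(1) iu pz in auto)
    finally show ?thesis by simp
  qed
  have "norm (LINT x|circ. of_real (u (cis x)) * f x) \<le> 0"
  proof (rule field_le_epsilon)
    fix e :: real assume "e > 0"
    define I where "I = (LINT x|circ. norm (f x))"
    have I: "I \<ge> 0" by (simp add: I_def)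
    have "norm (LINT x|circ. of_real (u (cis x)) * f x) \<le> e / (1 + I) * I"
      unfolding I_def by (rule le) (use I \<open>e > 0\<close> in \<open>simp add: I_def[symmetric]\<close>)
    also have "\<dots> \<le> e"
      using \<open>e > 0\<close> I by (simp add: divide_simps)
    finally show "norm (LINT x|circ. of_real (u (cis x)) * f x) \<le> 0 + e" by simp
  qed
  then show ?thesis by simp
qed

text \<open>A measurable function on the real line is almost everywhere the limit of continuous ones.  To
  turn these into functions on the circle, which is parametrised by \<^const>\<open>Arg\<close> with a jump at
  \<open>-1\<close>, they are cut off near \<open>-1\<close>; clipping to \<open>[-1, 1]\<close> makes the convergence dominated.\<close>

lemma fc_zero_bounded:
  fixes \<phi> :: "real \<Rightarrow> real"
  assumes f: "integrable circ f" "\<And>k. fc f k = 0" and \<phi>: "\<phi> \<in> borel_measurable circ" "\<And>x. \<bar>\<phi> x\<bar> \<le> 1"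
  shows "(LINT x|circ. of_real (\<phi> x) * f x) = 0"
proof -
  have "\<phi> measurable_on {-pi..<pi}"
    using \<phi>(1) by (simp add: measurable_on_iff_borel_measurable measurable_circ_iff)
  then obtain N g where N: "negligible N" and g: "\<And>n. continuous_on UNIV (g n)"
    and lim: "\<And>x. x \<notin> N \<Longrightarrow> (\<lambda>n. g n x) \<longlonglongrightarrow> (if x \<in> {-pi..<pi} then \<phi> x else 0)"
    unfolding measurable_on_def by metis
  define cut where "cut n \<zeta> = min 1 (max 0 (real n * cmod (\<zeta> + 1) - 1))" for n \<zeta>
  define clip where "clip x = max (-1) (min 1 x)" for x :: real
  define F where "F n \<zeta> = cut n \<zeta> * clip (g n (Arg \<zeta>))" for n \<zeta>
  have clip: "\<bar>clip x\<bar> \<le> 1" for x by (auto simp: clip_def)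
  have cut: "0 \<le> cut n \<zeta>" "cut n \<zeta> \<le> 1" for n \<zeta> by (auto simp: cut_def)
  have cont_cut: "isCont (cut n) \<zeta>" for n \<zeta>
    unfolding cut_def by (intro continuous_intros)
  have cont_clip: "continuous_on UNIV clip"
    unfolding clip_def by (intro continuous_intros)
  have Fle: "\<bar>F n \<zeta>\<bar> \<le> cut n \<zeta>" for n \<zeta>
    using mult_left_mono[OF clip[of "g n (Arg \<zeta>)"] cut(1)[of n \<zeta>]] cut(1)[of n \<zeta>] by (simp add: F_def abs_mult)
  have contF: "continuous_on (sphere 0 1) (F n)" for n
  proof (rule continuous_at_imp_continuous_on, rule ballI)
    fix \<zeta> :: complex assume \<zeta>: "\<zeta> \<in> sphere 0 1"
    show "isCont (F n) \<zeta>"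
    proof (cases "\<zeta> = -1")
      case True
      have "(cut n \<longlongrightarrow> cut n \<zeta>) (at \<zeta>)" using cont_cut by (simp add: isCont_def)
      then have "(cut n \<longlongrightarrow> 0) (at \<zeta>)" using True by (simp add: cut_def)
      then have "(F n \<longlongrightarrow> 0) (at \<zeta>)"
        by (rule Lim_null_comparison[rotated]) (use Fle in auto)
      then show ?thesis using True by (simp add: isCont_def F_def cut_def)
    next
      case False
      have "\<zeta> \<notin> \<real>\<^sub>\<le>\<^sub>0"
      proof
        assume *: "\<zeta> \<in> \<real>\<^sub>\<le>\<^sub>0"
        then have "\<zeta> = of_real (Re \<zeta>)" "Re \<zeta> \<le> 0" by (auto simp: complex_nonpos_Reals_iff complex_eq_iff)
        moreover from this have "\<bar>Re \<zeta>\<bar> = 1" using \<zeta> by (metis dist_0_norm mem_sphere norm_of_real)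
        ultimately have "\<zeta> = of_real (-1)" by (smt (verit))
        then show False using False by simp
      qed
      then have "isCont Arg \<zeta>" by (rule continuous_at_Arg)
      moreover have "isCont (\<lambda>x. clip (g n x)) x" for x
        using continuous_on_compose2[OF cont_clip g[of n]] by (simp add: continuous_on_eq_continuous_at)
      ultimately have "isCont (\<lambda>\<zeta>. clip (g n (Arg \<zeta>))) \<zeta>"
        by (rule isCont_o2)
      then show ?thesis unfolding F_def using cont_cut by (intro continuous_intros) auto
    qed
  qed
  have zero: "(LINT x|circ. of_real (F n (cis x)) * f x) = 0" for n
    by (rule fc_zero_continuous[OF f contF])
  have [measurable]: "(\<lambda>x. F n (cis x)) \<in> borel_measurable circ" for n
    by (rule borel_measurable_circ_continuous[OF continuous_on_cis_compose[OF contF]])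
  note [measurable] = \<phi>(1) borel_measurable_integrable[OF f(1)]
  have "(\<lambda>n. LINT x|circ. of_real (F n (cis x)) * f x) \<longlonglongrightarrow> (LINT x|circ. of_real (\<phi> x) * f x)"
  proof (rule integral_dominated_convergence[where w="\<lambda>x. norm (f x)"])
    have "AE x in lebesgue. x \<notin> insert (-pi) N"
      using N by (intro AE_not_in) (simp add: negligible_iff_null_sets[symmetric])
    then have "AE x in circ. x \<notin> insert (-pi) N"
      unfolding AE_circ_iff_lebesgue by eventually_elim auto
    with AE_space show "AE x in circ. (\<lambda>n. of_real (F n (cis x)) * f x) \<longlonglongrightarrow> of_real (\<phi> x) * f x"
    proof eventually_elim
      case (elim x)
      then have A: "Arg (cis x) = x" "x \<in> {-pi<..<pi}" by (auto intro!: Arg_cis)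
      have "(\<lambda>n. g n x) \<longlonglongrightarrow> \<phi> x" using lim[of x] elim A by simp
      then have "(\<lambda>n. clip (g n x)) \<longlonglongrightarrow> clip (\<phi> x)"
        unfolding clip_def by (intro tendsto_intros)
      moreover have "clip (\<phi> x) = \<phi> x" using \<phi>(2)[of x] by (auto simp: clip_def)
      moreover have "(\<lambda>n. cut n (cis x)) \<longlonglongrightarrow> 1"
      proof -
        have "cis x \<noteq> -1"
        proof
          assume "cis x = -1"
          moreover have "Arg (cis pi) = pi" by (rule Arg_cis) auto
          ultimately have "Arg (cis x) = pi" by simp
          then show False using A by simp
        qed
        then have "cis x + 1 \<noteq> 0" by (metis eq_neg_iff_add_eq_0)
        then have "cmod (cis x + 1) > 0" by simp
        then obtain M where M: "real M * cmod (cis x + 1) > 2" using reals_Archimedean3 by blast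
        have "\<forall>\<^sub>F n in sequentially. cut n (cis x) = 1"
          using eventually_ge_at_top[of M]
        proof eventually_elim
          case (elim n)
          then have "real M * cmod (cis x + 1) \<le> real n * cmod (cis x + 1)" by (intro mult_right_mono) auto
          then show ?case using M by (simp add: cut_def)
        qed
        then show ?thesis by (rule tendsto_eventually)
      qed
      ultimately have "(\<lambda>n. F n (cis x)) \<longlonglongrightarrow> \<phi> x"
        unfolding F_def A(1) using tendsto_mult[of "\<lambda>n. cut n (cis x)" 1 sequentially "\<lambda>n. clip (g n x)" "\<phi> x"] by simp
      then show ?case by (intro tendsto_intros)
    qed
    show "AE x in circ. norm (of_real (F n (cis x)) * f x) \<le> norm (f x)" for n
    proof (rule AE_I2)
      fix x
      have "\<bar>F n (cis x)\<bar> \<le> 1" using Fle[of n "cis x"] cut(2)[of n "cis x"] by linarith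
      then show "norm (of_real (F n (cis x)) * f x) \<le> norm (f x)"
        by (simp add: norm_mult mult_left_le_one_le)
    qed
  qed (use f in auto)
  then show ?thesis unfolding zero by (simp add: LIMSEQ_const_iff)
qed

text \<open>Testing with \<open>Re f / (1 + \<bar>f\<bar>)\<close> and \<open>Im f / (1 + \<bar>f\<bar>)\<close>, which are bounded by \<open>1\<close>, shows that
  the integral of \<open>\<bar>f\<bar>\<^sup>2 / (1 + \<bar>f\<bar>)\<close> vanishes.\<close>

theorem fc_eq_0_imp_AE_0:
  assumes f: "integrable circ f" "\<And>k. fc f k = 0"
  shows "AE x in circ. f x = 0"
proof -
  note [measurable] = borel_measurable_integrable[OF f(1)]
  have pos: "1 + cmod z > 0" for z using norm_ge_zero[of z] by linarith
  have b: "\<bar>Re z / (1 + cmod z)\<bar> \<le> 1" "\<bar>Im z / (1 + cmod z)\<bar> \<le> 1" for z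
    using pos[of z] abs_Re_le_cmod[of z] abs_Im_le_cmod[of z] by (auto simp: abs_divide divide_simps)
  let ?r = "\<lambda>x. Re (f x) / (1 + cmod (f x))" and ?i = "\<lambda>x. Im (f x) / (1 + cmod (f x))"
  have z: "(LINT x|circ. of_real (?r x) * f x) = 0" "(LINT x|circ. of_real (?i x) * f x) = 0"
    using b by (intro fc_zero_bounded[OF f]; auto)+
  have i: "integrable circ (\<lambda>x. of_real (?r x) * f x)" "integrable circ (\<lambda>x. of_real (?i x) * f x)"
    using b by (intro integrable_bounded_times[OF f(1), where B=1]; auto simp del: of_real_divide)+
  have "0 = Re (LINT x|circ. of_real (?r x) * f x) + Im (LINT x|circ. of_real (?i x) * f x)"
    unfolding z by simp
  also have "\<dots> = (LINT x|circ. Re (of_real (?r x) * f x)) + (LINT x|circ. Im (of_real (?i x) * f x))"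
    using i by (simp only: integral_Re integral_Im)
  also have "\<dots> = (LINT x|circ. Re (of_real (?r x) * f x) + Im (of_real (?i x) * f x))"
    using i by (intro Bochner_Integration.integral_add[symmetric] integrable_Re integrable_Im)
  also have "\<dots> = (LINT x|circ. (cmod (f x))\<^sup>2 / (1 + cmod (f x)))"
  proof (rule Bochner_Integration.integral_cong[OF refl])
    show "Re (of_real (?r x) * f x) + Im (of_real (?i x) * f x) = (cmod (f x))\<^sup>2 / (1 + cmod (f x))" for x
      unfolding cmod_power2 add_divide_distrib by (simp add: power2_eq_square)
  qed
  finally have I0: "(LINT x|circ. (cmod (f x))\<^sup>2 / (1 + cmod (f x))) = 0" by simp
  have "integrable circ (\<lambda>x. (cmod (f x))\<^sup>2 / (1 + cmod (f x)))"
  proof (rule Bochner_Integration.integrable_bound[OF f(1)])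
    have "x\<^sup>2 / (1 + x) \<le> x" if "x \<ge> 0" for x :: real
      using that by (simp add: divide_simps power2_eq_square algebra_simps)
    then show "AE x in circ. norm ((cmod (f x))\<^sup>2 / (1 + cmod (f x))) \<le> norm (f x)"
      using pos by (intro AE_I2) (simp add: abs_of_pos)
  qed measurable
  then have "AE x in circ. (cmod (f x))\<^sup>2 / (1 + cmod (f x)) = 0"
    using I0 pos by (subst (asm) integral_nonneg_eq_0_iff_AE) (auto intro!: divide_nonneg_pos)
  then show ?thesis
    by eventually_elim (use pos in \<open>auto simp: less_le\<close>)
qed
subsection \<open>The Riesz-Fischer theorem and Parseval's identity\<close>

lemma sqint_mult_bounded:
  fixes f :: "real \<Rightarrow> complex"
  assumes "sqint f" "q \<in> borel_measurable circ" "\<And>x. norm (q x) \<le> B"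
  shows "sqint (\<lambda>x. q x * f x)"
proof (rule sqint_le)
  show "(\<lambda>x. q x * f x) \<in> borel_measurable circ" using assms by (auto simp: sqint_def)
  show "integrable circ (\<lambda>x. B\<^sup>2 * (norm (f x))\<^sup>2)" using assms by (auto simp: sqint_def)
  have "(norm (q x))\<^sup>2 \<le> B\<^sup>2" for x by (rule power_mono) (use assms in auto)
  then show "AE x in circ. (norm (q x * f x))\<^sup>2 \<le> B\<^sup>2 * (norm (f x))\<^sup>2"
    by (auto simp: norm_mult power_mult_distrib intro!: mult_right_mono)
qed

lemma sqint_cmult: "sqint f \<Longrightarrow> sqint (\<lambda>x. c * f x :: complex)"
  using sqint_mult_bounded[of f "\<lambda>_. c" "norm c"] by auto

lemma sqint_cis_mult: "sqint f \<Longrightarrow> sqint (\<lambda>x. cis (c * x) * f x)"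
  by (rule sqint_mult_bounded[where B=1]) auto

lemma borel_measurable_cnj' [measurable (raw)]: "f \<in> borel_measurable M \<Longrightarrow> (\<lambda>x. cnj (f x)) \<in> borel_measurable M"
  by (rule borel_measurable_continuous_on) (auto intro: continuous_intros)

lemma sqint_cnj: "sqint f \<Longrightarrow> sqint (\<lambda>x. cnj (f x))"
  by (auto simp: sqint_def)

lemma sqint_trig_sum: "sqint (\<lambda>x. \<Sum>m\<in>K. c m * cis (of_int m * x))"
  by (intro sqint_sum sqint_cmult sqint_cis)

lemma fc_mult_tendsto:
  assumes "\<And>n. sqint (f n)" "sqint g" "sqint q"
    and lim: "(\<lambda>n. LINT x|circ. (cmod (f n x - g x))\<^sup>2) \<longlonglongrightarrow> 0"
  shows "(\<lambda>n. fc (\<lambda>x. q x * f n x) k) \<longlonglongrightarrow> fc (\<lambda>x. q x * g x) k"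
proof -
  let ?Q = "LINT x|circ. (cmod (q x))\<^sup>2"
  have le: "norm (fc (\<lambda>x. q x * f n x) k - fc (\<lambda>x. q x * g x) k) \<le>
    sqrt (?Q * (LINT x|circ. (cmod (f n x - g x))\<^sup>2))" for n
  proof -
    have d: "sqint (\<lambda>x. f n x - g x)" by (intro sqint_diff assms)
    have "fc (\<lambda>x. q x * f n x) k - fc (\<lambda>x. q x * g x) k = fc (\<lambda>x. q x * (f n x - g x)) k"
      by (subst fc_diff[symmetric]) (auto intro!: integrable_times_sqint assms simp: right_diff_distrib)
    also have "norm \<dots> \<le> (LINT x|circ. norm (cis (- (of_int k * x)) * (q x * (f n x - g x))))"
      unfolding fc_def by (rule integral_norm_bound)
    also have "\<dots> = (LINT x|circ. norm (q x) * norm (f n x - g x))"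
      by (simp add: norm_mult)
    also have "\<dots> \<le> sqrt (?Q * (LINT x|circ. (cmod (f n x - g x))\<^sup>2))"
      by (rule real_le_rsqrt[OF Cauchy_Schwarz_circ[OF assms(3) d]])
    finally show ?thesis .
  qed
  have "(\<lambda>n. sqrt (?Q * (LINT x|circ. (cmod (f n x - g x))\<^sup>2))) \<longlonglongrightarrow> sqrt (?Q * 0)"
    by (intro tendsto_intros lim)
  then have lim0: "(\<lambda>n. sqrt (?Q * (LINT x|circ. (cmod (f n x - g x))\<^sup>2))) \<longlonglongrightarrow> 0" by simp
  have "(\<lambda>n. fc (\<lambda>x. q x * f n x) k - fc (\<lambda>x. q x * g x) k) \<longlonglongrightarrow> 0"
    by (rule Lim_null_comparison[OF _ lim0], rule always_eventually, rule allI, rule le)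
  then show ?thesis by (rule LIM_zero_cancel)
qed

lemma sqint_one: "sqint (\<lambda>_. 1 :: complex)"
  by (rule sqint_bounded[where B=1]) auto

lemma fc_tendsto:
  assumes "\<And>n. sqint (f n)" "sqint g"
    and "(\<lambda>n. LINT x|circ. (cmod (f n x - g x))\<^sup>2) \<longlonglongrightarrow> 0"
  shows "(\<lambda>n. fc (f n) k) \<longlonglongrightarrow> fc g k"
  using fc_mult_tendsto[OF assms(1,2) sqint_one assms(3)] by simp

lemma integral_times_cnj_trig_sum:
  assumes "sqint f"
  shows "(LINT x|circ. f x * cnj (\<Sum>m\<in>K. c m * cis (of_int m * x))) = (\<Sum>m\<in>K. fc f m * cnj (c m))"
proof -
  have "(LINT x|circ. f x * cnj (\<Sum>m\<in>K. c m * cis (of_int m * x))) =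
     (LINT x|circ. (\<Sum>m\<in>K. cnj (c m) * (cis (- (of_int m * x)) * f x)))"
    by (simp add: sum_distrib_left cis_cnj mult_ac)
  also have "\<dots> = (\<Sum>m\<in>K. cnj (c m) * fc f m)"
    unfolding fc_def using integrable_sqint[OF assms]
    by (subst Bochner_Integration.integral_sum) (auto intro!: integrable_cis_times)
  finally show ?thesis by (simp add: mult.commute)
qed

lemma integral_norm_trig_sum:
  assumes "finite K"
  shows "(LINT x|circ. (cmod (\<Sum>m\<in>K. c m * cis (of_int m * x)))\<^sup>2) = (\<Sum>m\<in>K. (cmod (c m))\<^sup>2)"
proof -
  have "of_real (LINT x|circ. (cmod (\<Sum>m\<in>K. c m * cis (of_int m * x)))\<^sup>2) =
     (LINT x|circ. (\<Sum>m\<in>K. c m * cis (of_int m * x)) * cnj (\<Sum>m\<in>K. c m * cis (of_int m * x)))"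
    by (simp only: complex_norm_square[symmetric] Bochner_Integration.integral_complex_of_real)
  also have "\<dots> = (\<Sum>m\<in>K. c m * cnj (c m))"
    by (subst integral_times_cnj_trig_sum[OF sqint_trig_sum]) (simp add: fc_trig_sum assms)
  also have "\<dots> = of_real (\<Sum>m\<in>K. (cmod (c m))\<^sup>2)"
    by (simp only: complex_norm_square[symmetric] of_real_sum)
  finally show ?thesis by (simp only: of_real_eq_iff)
qed

lemma integral_cmod_diff_sq:
  assumes f: "sqint f" and g: "sqint g"
  shows "(LINT x|circ. (cmod (f x - g x))\<^sup>2) =
    (LINT x|circ. (cmod (f x))\<^sup>2) - 2 * Re (LINT x|circ. f x * cnj (g x)) + (LINT x|circ. (cmod (g x))\<^sup>2)"
proof -
  have e: "(cmod (x - y))\<^sup>2 = (cmod x)\<^sup>2 - 2 * Re (x * cnj y) + (cmod y)\<^sup>2" for x y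
    unfolding cmod_power2 by (simp add: power2_eq_square algebra_simps)
  note i = integrable_times_sqint[OF f sqint_cnj[OF g]]
  have "(LINT x|circ. (cmod (f x - g x))\<^sup>2) =
     (LINT x|circ. (cmod (f x))\<^sup>2 - 2 * Re (f x * cnj (g x))) + (LINT x|circ. (cmod (g x))\<^sup>2)"
    unfolding e using i
    by (intro Bochner_Integration.integral_add Bochner_Integration.integrable_diff sqintD integrable_mult_right integrable_Re f g)
  also have "(LINT x|circ. (cmod (f x))\<^sup>2 - 2 * Re (f x * cnj (g x))) =
     (LINT x|circ. (cmod (f x))\<^sup>2) - (LINT x|circ. 2 * Re (f x * cnj (g x)))"
    using i by (intro Bochner_Integration.integral_diff sqintD integrable_mult_right integrable_Re f g)
  also have "(LINT x|circ. 2 * Re (f x * cnj (g x))) = 2 * Re (LINT x|circ. f x * cnj (g x))"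
    by (simp only: integral_mult_right_zero integral_Re[OF i])
  finally show ?thesis .
qed

lemma Bessel_ineq:
  assumes f: "sqint f" and "finite K"
  shows "(\<Sum>m\<in>K. (cmod (fc f m))\<^sup>2) \<le> (LINT x|circ. (cmod (f x))\<^sup>2)"
proof -
  let ?S = "\<lambda>x. \<Sum>m\<in>K. fc f m * cis (of_int m * x)"
  have S: "sqint ?S" by (rule sqint_trig_sum)

  have "0 \<le> (LINT x|circ. (cmod (f x - ?S x))\<^sup>2)" by simp
  also have "\<dots> = (LINT x|circ. (cmod (f x))\<^sup>2) - 2 * Re (LINT x|circ. f x * cnj (?S x)) + (LINT x|circ. (cmod (?S x))\<^sup>2)"
    by (rule integral_cmod_diff_sq[OF f S])
  also have "\<dots> = (LINT x|circ. (cmod (f x))\<^sup>2) - (\<Sum>m\<in>K. (cmod (fc f m))\<^sup>2)"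
    unfolding integral_times_cnj_trig_sum[OF f] integral_norm_trig_sum[OF assms(2)]
    by (simp add: complex_norm_square[symmetric] del: of_real_power flip: of_real_sum)
  finally show ?thesis by simp
qed

lemma filterlim_symmetric_intervals:
  "filterlim (\<lambda>n. {- int n..int n}) (finite_subsets_at_top UNIV) sequentially"
  unfolding filterlim_finite_subsets_at_top
proof (intro allI impI)
  fix X :: "int set" assume X: "finite X \<and> X \<subseteq> UNIV"
  show "\<forall>\<^sub>F n in sequentially. finite {- int n..int n} \<and> X \<subseteq> {- int n..int n} \<and> {- int n..int n} \<subseteq> UNIV"
    using eventually_ge_at_top[of "nat (\<Sum>x\<in>X. \<bar>x\<bar>)"]
  proof eventually_elim
    case (elim n)
    have "X \<subseteq> {- int n..int n}"
    proof
      fix x assume "x \<in> X"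
      then have "\<bar>x\<bar> \<le> (\<Sum>x\<in>X. \<bar>x\<bar>)" using X by (intro member_le_sum) auto
      then have "\<bar>x\<bar> \<le> int n" using elim by linarith
      then show "x \<in> {- int n..int n}" by auto
    qed
    then show ?case by auto
  qed
qed

lemma sqint_fc_summable:
  assumes "sqint f"
  shows "(\<lambda>k. (cmod (fc f k))\<^sup>2) summable_on UNIV"
  by (rule nonneg_bdd_above_summable_on)
     (auto intro!: bdd_aboveI2[where M="LINT x|circ. (cmod (f x))\<^sup>2"] Bessel_ineq assms)

lemma Riesz_Fischer:
  fixes c :: "int \<Rightarrow> complex"
  assumes c: "(\<lambda>k. (cmod (c k))\<^sup>2) summable_on UNIV"
  obtains g where "sqint g" "\<And>k. fc g k = c k"
    "(\<lambda>n. LINT x|circ. (cmod ((\<Sum>k\<in>{- int n..int n}. c k * cis (of_int k * x)) - g x))\<^sup>2) \<longlonglongrightarrow> 0"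
proof -
  define S where "S n x = (\<Sum>k\<in>{- int n..int n}. c k * cis (of_int k * x))" for n x
  define s where "s n = (\<Sum>k\<in>{- int n..int n}. (cmod (c k))\<^sup>2)" for n
  have sqS: "sqint (S n)" for n unfolding S_def by (rule sqint_trig_sum)
  have "s \<longlonglongrightarrow> infsum (\<lambda>k. (cmod (c k))\<^sup>2) UNIV"
    unfolding s_def using infsum_tendsto[OF c] filterlim_symmetric_intervals by (rule filterlim_compose)
  then have "Cauchy s" by (rule LIMSEQ_imp_Cauchy)
  have diff: "(LINT x|circ. (cmod (S m x - S n x))\<^sup>2) = s m - s n" if "n \<le> m" for m n
  proof -
    have sub: "{- int n..int n} \<subseteq> {- int m..int m}" using that by auto
    have "S m x - S n x = (\<Sum>k\<in>{- int m..int m} - {- int n..int n}. c k * cis (of_int k * x))" for x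
      unfolding S_def by (rule sum_diff[OF _ sub, symmetric]) simp
    then have "(LINT x|circ. (cmod (S m x - S n x))\<^sup>2) = (\<Sum>k\<in>{- int m..int m} - {- int n..int n}. (cmod (c k))\<^sup>2)"
      by (simp only: integral_norm_trig_sum finite_Diff finite_atLeastAtMost_int)
    also have "\<dots> = s m - s n" unfolding s_def by (rule sum_diff[OF _ sub]) simp
    finally show ?thesis .
  qed
  have diff': "(LINT x|circ. (cmod (S m x - S n x))\<^sup>2) = \<bar>s m - s n\<bar>" for m n
  proof -
    have 0: "(LINT x|circ. (cmod (S m x - S n x))\<^sup>2) \<ge> 0" by simp
    show ?thesis
    proof (cases "n \<le> m")
      case True then show ?thesis using diff[of n m] 0 by simp
    next
      case False then show ?thesis using diff[of m n] 0 by (simp add: norm_minus_commute)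
    qed
  qed
  obtain g where g: "sqint g" "(\<lambda>n. LINT x|circ. (cmod (S n x - g x))\<^sup>2) \<longlonglongrightarrow> 0"
  proof (rule sqint_complete[OF sqS])
    fix e :: real assume "e > 0"
    then obtain M where "\<forall>m\<ge>M. \<forall>n\<ge>M. dist (s m) (s n) < e" using \<open>Cauchy s\<close> unfolding Cauchy_def by blast
    then show "\<exists>N. \<forall>m\<ge>N. \<forall>n\<ge>N. (LINT x|circ. (cmod (S m x - S n x))\<^sup>2) < e"
      unfolding diff' dist_real_def by blast
  qed blast
  have "fc g k = c k" for k
  proof (rule LIMSEQ_unique)
    show "(\<lambda>n. fc (S n) k) \<longlonglongrightarrow> fc g k" by (rule fc_tendsto[OF sqS g])
    have "\<forall>\<^sub>F n in sequentially. fc (S n) k = c k"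
      using eventually_ge_at_top[of "nat \<bar>k\<bar>"]
    proof eventually_elim
      case (elim n)
      then have "k \<in> {- int n..int n}" by auto
      then show ?case unfolding S_def by (subst fc_trig_sum) auto
    qed
    then show "(\<lambda>n. fc (S n) k) \<longlonglongrightarrow> c k" by (rule tendsto_eventually)
  qed
  then show ?thesis using that g unfolding S_def by blast
qed

lemma sqint_eq_AE:
  assumes "sqint f" "sqint g" "\<And>k. fc f k = fc g k"
  shows "AE x in circ. f x = g x"
proof -
  note i = integrable_sqint[OF assms(1)] integrable_sqint[OF assms(2)]
  have "AE x in circ. f x - g x = 0"
    by (rule fc_eq_0_imp_AE_0) (use i assms(3) in \<open>auto simp: fc_diff\<close>)
  then show ?thesis by eventually_elim simp
qed

text \<open>The partial sums converge to some function by the Riesz-Fischer theorem, and the uniqueness of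
  Fourier coefficients identifies it.\<close>

lemma fourier_partial_sums_tendsto:
  assumes "sqint f"
  shows "(\<lambda>n. LINT x|circ. (cmod ((\<Sum>k\<in>{- int n..int n}. fc f k * cis (of_int k * x)) - f x))\<^sup>2) \<longlonglongrightarrow> 0"
proof -
  obtain g where g: "sqint g" "\<And>k. fc g k = fc f k"
    and lim: "(\<lambda>n. LINT x|circ. (cmod ((\<Sum>k\<in>{- int n..int n}. fc f k * cis (of_int k * x)) - g x))\<^sup>2) \<longlonglongrightarrow> 0"
    using Riesz_Fischer[OF sqint_fc_summable[OF assms]] by blast
  have ae: "AE x in circ. g x = f x" using sqint_eq_AE[OF g(1) assms] g(2) by simp
  have "(LINT x|circ. (cmod ((\<Sum>k\<in>{- int n..int n}. fc f k * cis (of_int k * x)) - g x))\<^sup>2) =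
    (LINT x|circ. (cmod ((\<Sum>k\<in>{- int n..int n}. fc f k * cis (of_int k * x)) - f x))\<^sup>2)" for n
  proof (rule integral_cong_AE)
    show "AE x in circ. (cmod ((\<Sum>k\<in>{- int n..int n}. fc f k * cis (of_int k * x)) - g x))\<^sup>2 =
       (cmod ((\<Sum>k\<in>{- int n..int n}. fc f k * cis (of_int k * x)) - f x))\<^sup>2"
      using ae by eventually_elim simp
  qed (use sqintD(1)[OF g(1)] sqintD(1)[OF assms] in measurable)
  with lim show ?thesis by simp
qed

theorem Parseval:
  assumes f: "sqint f" and g: "sqint g"
  shows "((\<lambda>k. fc f k * cnj (fc g k)) has_sum (LINT x|circ. f x * cnj (g x))) UNIV"
proof -
  let ?t = "\<lambda>k. fc f k * cnj (fc g k)"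
  have "(\<lambda>k. (cmod (fc f k))\<^sup>2 + (cmod (fc g k))\<^sup>2) summable_on UNIV"
    by (intro summable_on_add sqint_fc_summable f g)
  then have "(\<lambda>k. norm ((cmod (fc f k))\<^sup>2 + (cmod (fc g k))\<^sup>2)) summable_on UNIV"
    by simp
  then have "(\<lambda>k. norm (?t k)) summable_on UNIV"
  proof (rule Infinite_Sum.abs_summable_on_comparison_test)
    fix k
    have "0 \<le> (cmod (fc f k) - cmod (fc g k))\<^sup>2" "0 \<le> cmod (fc f k) * cmod (fc g k)" by auto
    then have "cmod (fc f k) * cmod (fc g k) \<le> (cmod (fc f k))\<^sup>2 + (cmod (fc g k))\<^sup>2"
      unfolding power2_diff by linarith
    then show "norm (?t k) \<le> norm ((cmod (fc f k))\<^sup>2 + (cmod (fc g k))\<^sup>2)"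
      by (simp add: norm_mult)
  qed
  then have "?t summable_on UNIV" by (rule Infinite_Sum.abs_summable_summable)
  then have "(?t has_sum infsum ?t UNIV) UNIV" by (rule has_sum_infsum)
  moreover have "infsum ?t UNIV = (LINT x|circ. f x * cnj (g x))"
  proof (rule LIMSEQ_unique)
    show "(\<lambda>n. sum ?t {- int n..int n}) \<longlonglongrightarrow> infsum ?t UNIV"
      using infsum_tendsto[OF \<open>?t summable_on UNIV\<close>] filterlim_symmetric_intervals by (rule filterlim_compose)
    let ?S = "\<lambda>n x. \<Sum>k\<in>{- int n..int n}. fc f k * cis (of_int k * x)"
    have "(\<lambda>n. fc (\<lambda>x. cnj (g x) * ?S n x) 0) \<longlonglongrightarrow> fc (\<lambda>x. cnj (g x) * f x) 0"
      by (rule fc_mult_tendsto[OF sqint_trig_sum f sqint_cnj[OF g] fourier_partial_sums_tendsto[OF f]])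
    moreover have "fc (\<lambda>x. cnj (g x) * ?S n x) 0 = sum ?t {- int n..int n}" for n
    proof -
      have "fc (\<lambda>x. cnj (g x) * ?S n x) 0 = cnj (LINT x|circ. g x * cnj (?S n x))"
        unfolding fc_def by (subst Bochner_Integration.integral_cnj[symmetric]) (simp del: Bochner_Integration.integral_cnj)
      also have "\<dots> = sum ?t {- int n..int n}"
        unfolding integral_times_cnj_trig_sum[OF g] by (simp add: mult.commute)
      finally show ?thesis .
    qed
    moreover have "fc (\<lambda>x. cnj (g x) * f x) 0 = (LINT x|circ. f x * cnj (g x))"
      by (simp add: fc_def mult.commute)
    ultimately show "(\<lambda>n. sum ?t {- int n..int n}) \<longlonglongrightarrow> (LINT x|circ. f x * cnj (g x))" by (simp only:)
  qed
  ultimately show ?thesis by simp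
qed

text \<open>The convolution formula is Parseval's identity for \<open>g\<close> and \<open>e\<^bsup>ik\<theta>\<^esup>\<close> times the conjugate of \<open>f\<close>.\<close>

lemma fc_mult_has_sum:
  assumes f: "sqint f" and g: "sqint g"
  shows "((\<lambda>j. fc f (k - j) * fc g j) has_sum fc (\<lambda>x. f x * g x) k) UNIV"
proof -
  let ?h = "\<lambda>x. cis (of_int k * x) * cnj (f x)"
  have "((\<lambda>j. fc g j * cnj (fc ?h j)) has_sum (LINT x|circ. g x * cnj (?h x))) UNIV"
    by (rule Parseval[OF g sqint_cis_mult[OF sqint_cnj[OF f]]])
  moreover have "(LINT x|circ. g x * cnj (?h x)) = fc (\<lambda>x. f x * g x) k"
    by (simp add: fc_def cis_cnj mult_ac)
  moreover have "fc g j * cnj (fc ?h j) = fc f (k - j) * fc g j" for j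
    unfolding fc_shift fc_cnj by simp
  ultimately show ?thesis by (simp only:)
qed



lemma has_sum_imp_sums_range:
  fixes t :: "int \<Rightarrow> 'a::{comm_monoid_add,topological_space}" and \<phi> :: "nat \<Rightarrow> int"
  assumes "(t has_sum S) UNIV" "inj \<phi>" "\<And>k. k \<notin> range \<phi> \<Longrightarrow> t k = 0"
  shows "(\<lambda>l. t (\<phi> l)) sums S"
proof -
  have "(t has_sum S) (range \<phi>)"
    using assms(1) by (rule iffD1[OF has_sum_cong_neutral, rotated -1]) (use assms(3) in auto)
  then have "((t \<circ> \<phi>) has_sum S) UNIV"
    by (subst (asm) has_sum_reindex[OF assms(2)])
  then show ?thesis by (auto dest: has_sum_imp_sums simp: o_def)
qed

lemma not_range_int: "k \<notin> range int \<Longrightarrow> k < 0"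
  by (metis nonneg_int_cases not_le rangeI)

section \<open>Boundary values of Hardy functions\<close>

definition taylor :: "(complex \<Rightarrow> complex) \<Rightarrow> nat \<Rightarrow> complex" where
  "taylor f k = fps_nth (fps_expansion f 0) k"

lemma taylor_sums:
  assumes "f holomorphic_on ball 0 1" "z \<in> ball 0 1"
  shows "(\<lambda>k. taylor f k * z ^ k) sums f z"
  using holomorphic_power_series[OF assms] by (simp add: taylor_def fps_expansion_def)

lemma taylor_summable_norm:
  assumes "f holomorphic_on ball 0 1" "0 \<le> r" "r < 1"
  shows "summable (\<lambda>k. norm (taylor f k * of_real r ^ k))"
proof -
  obtain s where s: "r < s" "s < 1" using dense assms(3) by blast
  have "summable (\<lambda>k. taylor f k * of_real s ^ k)"
    using taylor_sums[OF assms(1), of "of_real s"] s assms(2) by (auto simp: sums_iff)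
  then show ?thesis by (rule powser_insidea) (use s assms(2) in simp)
qed

lemma fc_power_series:
  assumes abs: "summable (\<lambda>k. norm (c k))" and F: "\<And>x. (\<lambda>k. c k * cis (real k * x)) sums F x"
  shows "fc F m = (if m \<ge> 0 then c (nat m) else 0)"
proof -
  let ?t = "\<lambda>k x. cis (- (of_int m * x)) * (c k * cis (of_int (int k) * x))"
  have i: "integral\<^sup>L circ (?t k) = (if m = int k then c k else 0)" for k
  proof -
    have "integral\<^sup>L circ (?t k) = fc (\<lambda>x. c k * cis (of_int (int k) * x)) m" by (simp add: fc_def)
    then show ?thesis unfolding fc_cmult fc_cis by simp
  qed
  have "(\<lambda>k. integral\<^sup>L circ (?t k)) sums (LINT x|circ. (\<Sum>k. ?t k x))"
  proof (rule sums_integral)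
    show "integrable circ (?t k)" for k
      by (rule integrable_circ_bounded[where B="norm (c k)"]) (auto simp: norm_mult simp del: of_int_of_nat_eq)
    show "AE x in circ. summable (\<lambda>k. norm (?t k x))"
      using abs by (simp add: norm_mult)
    show "summable (\<lambda>k. LINT x|circ. norm (?t k x))"
      using abs by (simp add: norm_mult)
  qed
  also have "(LINT x|circ. (\<Sum>k. ?t k x)) = fc F m"
    unfolding fc_def using sums_mult[OF F] by (simp add: sums_iff)
  finally have 1: "(\<lambda>k. if m = int k then c k else 0) sums fc F m" unfolding i .
  have 2: "(\<lambda>k. if m = int k then c k else 0) sums (if m \<ge> 0 then c (nat m) else 0)"
  proof (cases "m \<ge> 0")
    case True
    then have "(\<lambda>k. if m = int k then c k else 0) = (\<lambda>k. if k = nat m then c k else 0)" by (auto simp: fun_eq_iff)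
    then show ?thesis using sums_single[of "nat m" c] True by simp
  next
    case False
    then have "(\<lambda>k. if m = int k then c k else 0) = (\<lambda>k. 0)" by (auto simp: fun_eq_iff)
    then show ?thesis using False by simp
  qed
  show ?thesis by (rule sums_unique2[OF 1 2])
qed

lemma continuous_dilation:
  assumes "f holomorphic_on ball 0 1" "0 \<le> r" "r < 1"
  shows "continuous_on (cball 0 1) (\<lambda>\<zeta>. f (of_real r * \<zeta>))"
proof (rule continuous_on_compose2[OF holomorphic_on_imp_continuous_on[OF assms(1)]])
  have "r * norm \<zeta> < 1" if "norm \<zeta> \<le> 1" for \<zeta> :: complex
    using mult_left_mono[OF that assms(2)] assms(3) by simp
  then show "(\<lambda>\<zeta>. of_real r * \<zeta> :: complex) ` cball 0 1 \<subseteq> ball 0 1"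
    using assms(2) by (auto simp: norm_mult dist_norm)
qed (intro continuous_intros)

lemma sqint_dilation:
  assumes "f holomorphic_on ball 0 1" "0 \<le> r" "r < 1"
  shows "sqint (\<lambda>x. f (of_real r * cis x))"
proof -
  have c: "continuous_on (sphere 0 1) (\<lambda>\<zeta>. f (of_real r * \<zeta>))"
    by (rule continuous_on_subset[OF continuous_dilation[OF assms]]) auto
  obtain B where "\<And>x. norm (f (of_real r * cis x)) \<le> B" using continuous_on_sphere_bounded[OF c] by blast
  then show ?thesis
    by (intro sqint_bounded[where B=B] borel_measurable_circ_continuous) (use continuous_on_cis_compose[OF c] in auto)
qed

lemma fc_dilation:
  assumes "f holomorphic_on ball 0 1" "0 \<le> r" "r < 1"
  shows "fc (\<lambda>x. f (of_real r * cis x)) m = (if m \<ge> 0 then taylor f (nat m) * of_real r ^ nat m else 0)"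
proof (rule fc_power_series[OF taylor_summable_norm[OF assms]])
  fix x
  have "(\<lambda>k. taylor f k * (of_real r * cis x) ^ k) sums f (of_real r * cis x)"
    by (rule taylor_sums) (use assms in \<open>auto simp: norm_mult\<close>)
  then show "(\<lambda>k. taylor f k * of_real r ^ k * cis (real k * x)) sums f (of_real r * cis x)"
    by (simp only: power_mult_distrib Complex.DeMoivre mult.assoc)
qed

text \<open>The Taylor coefficients of a Hardy function are square summable, so they are the Fourier
  coefficients of some \<open>g\<close> in \<open>L\<^sup>2\<close>; the dilations converge to \<open>g\<close> in mean square, and to the
  radial limits almost everywhere.\<close>

lemma hardy2_limit_function:
  assumes f: "hardy2 f"
  obtains g where "sqint g" "\<And>k. fc g k = (if k \<ge> 0 then taylor f (nat k) else 0)"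
    "\<forall>r. (\<forall>n. 0 \<le> r n \<and> r n < 1) \<longrightarrow> r \<longlonglongrightarrow> 1 \<longrightarrow>
      (\<lambda>n. LINT x|circ. (cmod (f (of_real (r n) * cis x) - g x))\<^sup>2) \<longlonglongrightarrow> 0"
proof -
  have hol: "f holomorphic_on ball 0 1" using f by (simp add: hardy2_def)
  obtain C where C: "\<And>r. 0 \<le> r \<Longrightarrow> r < 1 \<Longrightarrow> (LINT x|circ. (cmod (f (of_real r * cis x)))\<^sup>2) \<le> C"
    using f by (auto simp: hardy2_def)
  define c where "c k = (if k \<ge> 0 then taylor f (nat k) else 0)" for k :: int
  have fcr: "fc (\<lambda>x. f (of_real r * cis x)) m = c m * of_real r ^ nat m" if "0 \<le> r" "r < 1" for r m
    using fc_dilation[OF hol that] by (simp add: c_def)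
  have "(\<Sum>k\<in>K. (cmod (c k))\<^sup>2) \<le> C" if "finite K" for K
  proof (rule tendsto_upperbound)
    have "((\<lambda>r. \<Sum>k\<in>K. (cmod (c k * of_real r ^ nat k))\<^sup>2) \<longlongrightarrow> (\<Sum>k\<in>K. (cmod (c k * of_real 1 ^ nat k))\<^sup>2)) (at_left 1)"
      by (intro tendsto_intros)
    then show "((\<lambda>r. \<Sum>k\<in>K. (cmod (c k * of_real r ^ nat k))\<^sup>2) \<longlongrightarrow> (\<Sum>k\<in>K. (cmod (c k))\<^sup>2)) (at_left 1)"
      by simp
    show "\<forall>\<^sub>F r in at_left 1. (\<Sum>k\<in>K. (cmod (c k * of_real r ^ nat k))\<^sup>2) \<le> C"
      using eventually_at_left_real[OF zero_less_one]
    proof eventually_elim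
      case (elim r)
      then have r: "0 \<le> r" "r < 1" by auto
      show ?case using Bessel_ineq[OF sqint_dilation[OF hol r] that] C[OF r] by (simp only: fcr[OF r])
    qed
  qed simp
  then have summ: "(\<lambda>k. (cmod (c k))\<^sup>2) summable_on UNIV"
    by (intro nonneg_bdd_above_summable_on) (auto intro!: bdd_aboveI2)
  obtain g where g: "sqint g" "\<And>k. fc g k = c k" using Riesz_Fischer[OF summ] by blast
  have sm: "summable (\<lambda>k. (cmod (taylor f k))\<^sup>2)"
  proof -
    have "((\<lambda>k. (cmod (c k))\<^sup>2) has_sum infsum (\<lambda>k. (cmod (c k))\<^sup>2) UNIV) UNIV" using summ by (rule has_sum_infsum)
    then have "(\<lambda>l. (cmod (c (int l)))\<^sup>2) sums infsum (\<lambda>k. (cmod (c k))\<^sup>2) UNIV"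
      by (rule has_sum_imp_sums_range) (auto simp: c_def dest: not_range_int)
    then show ?thesis by (auto simp: c_def sums_iff)
  qed
  have lim: "(\<lambda>n. LINT x|circ. (cmod (f (of_real (r n) * cis x) - g x))\<^sup>2) \<longlonglongrightarrow> 0"
    if r: "\<And>n. 0 \<le> r n \<and> r n < 1" and r1: "r \<longlonglongrightarrow> 1" for r
  proof -
    let ?a = "\<lambda>k n. (cmod (taylor f k * of_real (r n) ^ k - taylor f k))\<^sup>2"
    have eq: "(LINT x|circ. (cmod (f (of_real (r n) * cis x) - g x))\<^sup>2) = (\<Sum>k. ?a k n)" for n
    proof -
      let ?d = "\<lambda>x. f (of_real (r n) * cis x) - g x"
      note rn = r[of n, THEN conjunct1] r[of n, THEN conjunct2]
      have sd: "sqint ?d" by (intro sqint_diff sqint_dilation[OF hol rn] g)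
      have fcd: "fc ?d k = c k * of_real (r n) ^ nat k - c k" for k
        using integrable_sqint[OF sqint_dilation[OF hol rn]] integrable_sqint[OF g(1)]
        by (simp add: fc_diff fcr[OF rn] g(2))
      have "((\<lambda>k. Re (fc ?d k * cnj (fc ?d k))) has_sum Re (LINT x|circ. ?d x * cnj (?d x))) UNIV"
        by (rule has_sum_Re[OF Parseval[OF sd sd]])
      then have "((\<lambda>k. (cmod (fc ?d k))\<^sup>2) has_sum (LINT x|circ. (cmod (?d x))\<^sup>2)) UNIV"
        by (simp only: complex_norm_square[symmetric] Re_complex_of_real Bochner_Integration.integral_complex_of_real)
      then have "(\<lambda>l. (cmod (fc ?d (int l)))\<^sup>2) sums (LINT x|circ. (cmod (?d x))\<^sup>2)"
        by (rule has_sum_imp_sums_range) (auto simp: fcd c_def dest: not_range_int)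
      then show ?thesis by (simp add: fcd c_def sums_iff)
    qed
    have "((\<lambda>n. \<Sum>k. ?a k n) \<longlongrightarrow> (\<Sum>k. (0::real))) sequentially"
    proof (rule tannerys_theorem[where M="\<lambda>k. (cmod (taylor f k))\<^sup>2", THEN conjunct2, THEN conjunct2])
      fix k
      have "(\<lambda>n. ?a k n) \<longlonglongrightarrow> (cmod (taylor f k * of_real 1 ^ k - taylor f k))\<^sup>2"
        by (intro tendsto_intros r1)
      then show "(\<lambda>n. ?a k n) \<longlonglongrightarrow> 0" by simp
    next
      have "norm (?a k n) \<le> (cmod (taylor f k))\<^sup>2" for k n
      proof -
        have p: "0 \<le> r n ^ k" "r n ^ k \<le> 1" using r[of n] by (auto intro: power_le_one)
        have "cmod (taylor f k * of_real (r n) ^ k - taylor f k) = cmod (taylor f k * of_real (r n ^ k - 1))"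
          by (simp add: right_diff_distrib)
        also have "\<dots> = cmod (taylor f k) * (1 - r n ^ k)" using p by (simp only: norm_mult norm_of_real) simp
        also have "\<dots> \<le> cmod (taylor f k)" using p by (simp add: mult_left_le)
        finally show ?thesis by (simp add: power_mono)
      qed
      then show "\<forall>\<^sub>F (k, n) in sequentially \<times>\<^sub>F sequentially. norm (?a k n) \<le> (cmod (taylor f k))\<^sup>2"
        by (auto intro!: always_eventually)
    qed (use sm in auto)
    then show ?thesis by (simp add: eq)
  qed
  show ?thesis by (rule that[OF g(1)]) (use lim in \<open>auto simp: g(2) c_def\<close>)
qed

definition radii :: "nat \<Rightarrow> real" where "radii n = 1 - 1 / (real n + 2)"

lemma radii: "0 \<le> radii n" "0 < radii n" "radii n < 1" "radii \<longlonglongrightarrow> 1"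
proof -
  show "0 \<le> radii n" "0 < radii n" "radii n < 1" by (auto simp: radii_def field_simps)
  have "(\<lambda>n. 1 / (2 + real n)) \<longlonglongrightarrow> 0"
    by (intro tendsto_divide_0[OF tendsto_const] filterlim_at_top_imp_at_infinity
        filterlim_tendsto_add_at_top[OF tendsto_const] filterlim_real_sequentially)
  then have "(\<lambda>n. 1 - 1 / (2 + real n)) \<longlonglongrightarrow> 1 - 0" by (intro tendsto_intros)
  then show "radii \<longlonglongrightarrow> 1" by (simp add: radii_def[abs_def] add.commute)
qed

lemma filterlim_radii: "filterlim radii (at_left 1) sequentially"
  using radii by (auto simp: filterlim_at less_imp_neq)

lemma hardy2_radial:
  assumes "hardy2 f"
  shows "AE x in circ. (\<lambda>n. f (of_real (radii n) * cis x)) \<longlonglongrightarrow> f (cis x)"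
proof -
  have "AE x in circ. ((\<lambda>r. f (of_real r * cis x)) \<longlongrightarrow> f (cis x)) (at_left 1)"
    using assms by (simp add: hardy2_def)
  then show ?thesis by eventually_elim (rule filterlim_compose[OF _ filterlim_radii])
qed

text \<open>Along a subsequence the dilations converge almost everywhere to the limit in mean square, so this
  limit is the function of radial limits.\<close>

theorem hardy2_boundary:
  assumes f: "hardy2 f"
  shows "sqint (\<lambda>x. f (cis x))"
    and "fc (\<lambda>x. f (cis x)) k = (if k \<ge> 0 then taylor f (nat k) else 0)"
    and "(\<lambda>n. LINT x|circ. (cmod (f (of_real (radii n) * cis x) - f (cis x)))\<^sup>2) \<longlonglongrightarrow> 0"
proof -
  obtain g where g: "sqint g" "\<And>k. fc g k = (if k \<ge> 0 then taylor f (nat k) else 0)"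
    and L: "\<forall>r. (\<forall>n. 0 \<le> r n \<and> r n < 1) \<longrightarrow> r \<longlonglongrightarrow> 1 \<longrightarrow>
      (\<lambda>n. LINT x|circ. (cmod (f (of_real (r n) * cis x) - g x))\<^sup>2) \<longlonglongrightarrow> 0"
    using hardy2_limit_function[OF f] by blast
  have lim: "(\<lambda>n. LINT x|circ. (cmod (f (of_real (radii n) * cis x) - g x))\<^sup>2) \<longlonglongrightarrow> 0"
    by (rule L[rule_format]) (simp_all add: radii)
  have hol: "f holomorphic_on ball 0 1" using f by (simp add: hardy2_def)
  have sd: "sqint (\<lambda>x. f (of_real (radii n) * cis x) - g x)" for n
    by (intro sqint_diff sqint_dilation hol g radii)
  have "\<exists>s. strict_mono s \<and> (AE x in circ. (\<lambda>n. (cmod (f (of_real (radii (s n)) * cis x) - g x))\<^sup>2) \<longlonglongrightarrow> 0)"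
    by (rule tendsto_L1_AE_subseq[of circ "\<lambda>n x. (cmod (f (of_real (radii n) * cis x) - g x))\<^sup>2"])
       (use sqintD(2)[OF sd] lim in auto)
  then obtain s :: "nat \<Rightarrow> nat" where s: "strict_mono s"
    and ae: "AE x in circ. (\<lambda>n. (cmod (f (of_real (radii (s n)) * cis x) - g x))\<^sup>2) \<longlonglongrightarrow> 0" by blast
  have eq: "AE x in circ. g x = f (cis x)"
    using ae hardy2_radial[OF f]
  proof eventually_elim
    case (elim x)
    have "(\<lambda>n. sqrt ((cmod (f (of_real (radii (s n)) * cis x) - g x))\<^sup>2)) \<longlonglongrightarrow> sqrt 0"
      using elim(1) by (rule tendsto_real_sqrt)
    then have "(\<lambda>n. f (of_real (radii (s n)) * cis x) - g x) \<longlonglongrightarrow> 0"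
      by (simp add: tendsto_norm_zero_iff)
    then have "(\<lambda>n. f (of_real (radii (s n)) * cis x)) \<longlonglongrightarrow> g x" by (rule LIM_zero_cancel)
    moreover have "(\<lambda>n. f (of_real (radii (s n)) * cis x)) \<longlonglongrightarrow> f (cis x)"
      using LIMSEQ_subseq_LIMSEQ[OF elim(2) s] by (simp add: o_def)
    ultimately show ?case by (rule LIMSEQ_unique)
  qed
  show sq: "sqint (\<lambda>x. f (cis x))" by (rule sqint_cong_AE[OF g(1) eq])
  show "fc (\<lambda>x. f (cis x)) k = (if k \<ge> 0 then taylor f (nat k) else 0)"
    using fc_cong_AE[OF sqintD(1)[OF g(1)] sqintD(1)[OF sq] eq] g(2) by simp
  have "(LINT x|circ. (cmod (f (of_real (radii n) * cis x) - g x))\<^sup>2) =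
      (LINT x|circ. (cmod (f (of_real (radii n) * cis x) - f (cis x)))\<^sup>2)" for n
  proof (rule integral_cong_AE)
    show "AE x in circ. (cmod (f (of_real (radii n) * cis x) - g x))\<^sup>2 = (cmod (f (of_real (radii n) * cis x) - f (cis x)))\<^sup>2"
      using eq by eventually_elim simp
  qed (use sqintD(1)[OF g(1)] sqintD(1)[OF sq] sqintD(1)[OF sqint_dilation[OF hol radii(1,3)]] in measurable)
  with lim show "(\<lambda>n. LINT x|circ. (cmod (f (of_real (radii n) * cis x) - f (cis x)))\<^sup>2) \<longlonglongrightarrow> 0" by simp
qed
section \<open>Poisson integrals\<close>

text \<open>The Poisson integral is handled as the real part of the Herglotz integral: this is a power series
  whose coefficients are Fourier coefficients.\<close>

definition herglotz :: "(real \<Rightarrow> real) \<Rightarrow> complex \<Rightarrow> complex" where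
  "herglotz u z = (LINT x|circ. (cis x + z) / (cis x - z) * of_real (u x))"

definition poisson :: "(real \<Rightarrow> real) \<Rightarrow> complex \<Rightarrow> real" where
  "poisson u z = Re (herglotz u z)"

definition pkernel :: "complex \<Rightarrow> real \<Rightarrow> real" where
  "pkernel z x = Re ((cis x + z) / (cis x - z))"

lemma cis_minus_ne: "cmod z < 1 \<Longrightarrow> cis x - z \<noteq> 0"
  by auto

lemma cmod_cis_minus: "1 - cmod z \<le> cmod (cis x - z)"
  using norm_triangle_ineq2[of "cis x" z] by simp

lemma kernel_bound:
  assumes "cmod z < 1" shows "cmod ((cis x + z) / (cis x - z)) \<le> 2 / (1 - cmod z)"
proof -
  have "cmod (cis x + z) \<le> 2" using norm_triangle_ineq[of "cis x" z] assms by simp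
  then show ?thesis
    unfolding norm_divide using cmod_cis_minus[of z x] assms by (intro frac_le) auto
qed

lemma kernel_continuous:
  assumes "cmod z < 1" shows "continuous_on UNIV (\<lambda>x. (cis x + z) / (cis x - z))"
  by (intro continuous_intros ballI cis_minus_ne[OF assms])

lemma kernel_measurable [measurable]:
  assumes "cmod z < 1" shows "(\<lambda>x. (cis x + z) / (cis x - z)) \<in> borel_measurable circ"
  by (rule borel_measurable_circ_continuous[OF kernel_continuous[OF assms]])

lemma pkernel_eq: "pkernel z x = (1 - (cmod z)\<^sup>2) / (cmod (cis x - z))\<^sup>2"
proof -
  have "Re ((cis x + z) * cnj (cis x - z)) = (cos x)\<^sup>2 + (sin x)\<^sup>2 - ((Re z)\<^sup>2 + (Im z)\<^sup>2)"
    by (simp add: power2_eq_square algebra_simps)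
  then have "Re ((cis x + z) * cnj (cis x - z)) = 1 - (cmod z)\<^sup>2" by (simp add: cmod_power2)
  then show ?thesis unfolding pkernel_def complex_div_cnj[of "cis x + z"]
    by (metis Re_divide_of_real of_real_power)
qed

lemma pkernel_nonneg: "cmod z < 1 \<Longrightarrow> 0 \<le> pkernel z x"
  unfolding pkernel_eq by (intro divide_nonneg_nonneg) (simp_all add: power_le_one)

lemma pkernel_le: "cmod z < 1 \<Longrightarrow> pkernel z x \<le> 2 / (1 - cmod z)"
  unfolding pkernel_def using complex_Re_le_cmod[of "(cis x + z) / (cis x - z)"] kernel_bound[of z x] by linarith

lemma herglotz_integrable:
  assumes "integrable circ u" "cmod z < 1"
  shows "integrable circ (\<lambda>x. (cis x + z) / (cis x - z) * of_real (u x))"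
  by (rule integrable_bounded_times[where B="2 / (1 - cmod z)"])
     (use assms kernel_bound kernel_measurable in auto)

lemma Re_mult_of_real: "Re (x * complex_of_real r) = Re x * r"
  by simp

lemma poisson_eq:
  assumes "integrable circ u" "cmod z < 1"
  shows "poisson u z = (LINT x|circ. pkernel z x * u x)"
  unfolding poisson_def herglotz_def pkernel_def integral_Re[OF herglotz_integrable[OF assms], symmetric]
  by (simp only: Re_mult_of_real)

lemma poisson_integrable:
  assumes "integrable circ u" "cmod z < 1"
  shows "integrable circ (\<lambda>x. pkernel z x * u x)"
  using integrable_Re[OF herglotz_integrable[OF assms]] by (simp only: pkernel_def Re_mult_of_real)

lemma pkernel_measurable [measurable]: "cmod z < 1 \<Longrightarrow> pkernel z \<in> borel_measurable circ"
  unfolding pkernel_def by measurable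

lemma herglotz_sums:
  assumes u: "integrable circ u" and z: "cmod z < 1"
  shows "(\<lambda>k. (if k = 0 then 1 else 2) * fc (\<lambda>x. of_real (u x)) (int k) * z ^ k) sums herglotz u z"
proof -
  let ?e = "\<lambda>k::nat. if k = 0 then 1 else 2 :: complex"
  let ?t = "\<lambda>k x. ?e k * z ^ k * (cis (- (of_int (int k) * x)) * of_real (u x))"
  have iu: "integrable circ (\<lambda>x. of_real (u x) :: complex)" using u by simp
  have geo: "summable (\<lambda>k. cmod z ^ k)" using z by (simp add: summable_geometric)
  have nt: "norm (?t k x) \<le> 2 * \<bar>u x\<bar> * cmod z ^ k" for k x
    by (auto simp: norm_mult norm_power simp del: of_int_of_nat_eq)
  have 1: "(\<lambda>k. integral\<^sup>L circ (?t k)) sums (LINT x|circ. (\<Sum>k. ?t k x))"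
  proof (rule sums_integral)
    show it: "integrable circ (?t k)" for k
      by (intro integrable_mult_right integrable_cis_times iu)
    show "AE x in circ. summable (\<lambda>k. norm (?t k x))"
    proof (rule AE_I2)
      fix x show "summable (\<lambda>k. norm (?t k x))"
        by (rule summable_comparison_test'[OF summable_mult[OF geo, of "2 * \<bar>u x\<bar>"]]) (use nt in auto)
    qed
    have "(LINT x|circ. norm (?t k x)) \<le> 2 * (LINT x|circ. \<bar>u x\<bar>) * cmod z ^ k" for k
    proof -
      have "(LINT x|circ. norm (?t k x)) \<le> (LINT x|circ. 2 * \<bar>u x\<bar> * cmod z ^ k)"
        by (rule integral_mono[OF integrable_norm[OF it]]) (use u nt in auto)
      then show ?thesis by simp
    qed
    then show "summable (\<lambda>k. LINT x|circ. norm (?t k x))"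
      by (intro summable_comparison_test'[OF summable_mult[OF geo, of "2 * (LINT x|circ. \<bar>u x\<bar>)"]]) auto
  qed
  \<comment> \<open>The kernel is \<open>(1 + w) / (1 - w) = 2 / (1 - w) - 1\<close> for \<open>w = z / cis x\<close>.\<close>
  have sumt: "(\<lambda>k. ?t k x) sums ((cis x + z) / (cis x - z) * of_real (u x))" for x
  proof -
    let ?w = "z * cis (- x)"
    have "(\<lambda>k. 2 * ?w ^ k) sums (2 * (1 / (1 - ?w)))"
      by (intro sums_mult geometric_sums) (use z in \<open>simp add: norm_mult\<close>)
    moreover have "(\<lambda>k. if k = 0 then -1 else 0 :: complex) sums (-1)"
      using sums_single[of 0 "\<lambda>_. - 1 :: complex"] by simp
    ultimately have "(\<lambda>k. 2 * ?w ^ k + (if k = 0 then -1 else 0)) sums (2 * (1 / (1 - ?w)) + -1)"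
      by (rule sums_add)
    moreover have "(\<lambda>k. 2 * ?w ^ k + (if k = 0 then -1 else 0)) = (\<lambda>k. ?e k * ?w ^ k)" by auto
    moreover have "2 * (1 / (1 - ?w)) + -1 = (cis x + z) / (cis x - z)"
    proof -
      have "1 - ?w = (cis x - z) * cis (- x)" by (simp add: left_diff_distrib cis_mult)
      then have "1 / (1 - ?w) = cis x / (cis x - z)" by (simp add: cis_inverse[symmetric] field_simps)
      then show ?thesis using cis_minus_ne[OF z, of x] by (simp only:) (simp add: divide_simps)
    qed
    ultimately have "(\<lambda>k. ?e k * ?w ^ k) sums ((cis x + z) / (cis x - z))" by simp
    from sums_mult2[OF this, of "of_real (u x)"] show ?thesis
      by (simp only: power_mult_distrib Complex.DeMoivre mult_minus_right of_int_of_nat_eq mult.assoc)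
  qed
  have "(\<Sum>k. ?t k x) = (cis x + z) / (cis x - z) * of_real (u x)" for x
    using sumt by (rule sums_unique[symmetric])
  with 1 have "(\<lambda>k. integral\<^sup>L circ (?t k)) sums herglotz u z" by (simp only: herglotz_def)
  moreover have "integral\<^sup>L circ (?t k) = ?e k * fc (\<lambda>x. of_real (u x)) (int k) * z ^ k" for k
    unfolding fc_def integral_mult_right_zero by (simp only: mult_ac)
  ultimately show ?thesis by (simp only:)
qed

lemma herglotz_holomorphic: "integrable circ u \<Longrightarrow> herglotz u holomorphic_on ball 0 1"
  by (rule power_series_holomorphic) (use herglotz_sums in auto)

lemma herglotz_0: "integrable circ u \<Longrightarrow> herglotz u 0 = of_real (LINT x|circ. u x)"
  unfolding herglotz_def by simp

lemma poisson_0: "integrable circ u \<Longrightarrow> poisson u 0 = (LINT x|circ. u x)"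
  by (simp add: poisson_def herglotz_0)

lemma poisson_const:
  assumes "cmod z < 1" shows "poisson (\<lambda>_. c) z = c"
proof -
  have "fc (\<lambda>x. of_real c) k = (if k = 0 then of_real c else 0)" for k
    using fc_cmult[of "of_real c" "\<lambda>x. cis (of_int 0 * x)" k] fc_cis[of 0 k] by simp
  then have "(\<lambda>k. if k = 0 then of_real c else 0) sums herglotz (\<lambda>_. c) z"
    using herglotz_sums[of "\<lambda>_. c" z] assms by (simp add: if_distrib if_distribR cong: if_cong)
  moreover have "(\<lambda>k::nat. if k = 0 then of_real c else 0) sums (of_real c :: complex)"
    using sums_single[of 0 "\<lambda>_. of_real c :: complex"] by simp
  ultimately have "herglotz (\<lambda>_. c) z = of_real c" by (metis sums_unique2)
  then show ?thesis by (simp add: poisson_def)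
qed

lemma poisson_add:
  assumes "integrable circ u" "integrable circ v" "cmod z < 1"
  shows "poisson (\<lambda>x. u x + v x) z = poisson u z + poisson v z"
  using assms by (simp add: poisson_eq distrib_left poisson_integrable)

lemma poisson_cmult:
  assumes "integrable circ u" "cmod z < 1"
  shows "poisson (\<lambda>x. c * u x) z = c * poisson u z"
  using assms by (simp add: poisson_eq mult.left_commute)

lemma poisson_mono:
  assumes "integrable circ u" "integrable circ v" "cmod z < 1" "AE x in circ. u x \<le> v x"
  shows "poisson u z \<le> poisson v z"
  unfolding poisson_eq[OF assms(1,3)] poisson_eq[OF assms(2,3)]
proof (rule integral_mono_AE)
  show "AE x in circ. pkernel z x * u x \<le> pkernel z x * v x"
    using assms(4) by eventually_elim (intro mult_left_mono pkernel_nonneg assms)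
qed (intro poisson_integrable assms)+

lemma poisson_tendsto:
  assumes z: "cmod z < 1" and "integrable circ g" "\<And>n. u n \<in> borel_measurable circ" "u' \<in> borel_measurable circ"
    and le: "\<And>n. AE x in circ. \<bar>u n x\<bar> \<le> g x"
    and lim: "AE x in circ. (\<lambda>n. u n x) \<longlonglongrightarrow> u' x"
  shows "integrable circ u'" "\<And>n. integrable circ (u n)" "(\<lambda>n. poisson (u n) z) \<longlonglongrightarrow> poisson u' z"
proof -
  show i: "integrable circ (u n)" for n
  proof (rule Bochner_Integration.integrable_bound[OF assms(2) assms(3)])
    show "AE x in circ. norm (u n x) \<le> norm (g x)"
      using le[of n] by eventually_elim simp
  qed
  show i': "integrable circ u'"
    by (rule integrable_dominated_convergence[where w=g and s=u]) (use assms in auto)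
  show "(\<lambda>n. poisson (u n) z) \<longlonglongrightarrow> poisson u' z"
    unfolding poisson_eq[OF i z] poisson_eq[OF i' z]
  proof (rule integral_dominated_convergence[where w="\<lambda>x. pkernel z x * g x"])
    show "AE x in circ. (\<lambda>n. pkernel z x * u n x) \<longlonglongrightarrow> pkernel z x * u' x"
      using lim by eventually_elim (intro tendsto_intros)
    show "AE x in circ. norm (pkernel z x * u n x) \<le> pkernel z x * g x" for n
      using le[of n] by eventually_elim
        (simp add: abs_mult pkernel_nonneg[OF z] abs_of_nonneg mult_left_mono)
  qed (use assms pkernel_measurable[OF z] poisson_integrable in auto)
qed

lemma rtrig_integrable: "p \<in> rtrig \<Longrightarrow> integrable circ p"
  by (induction rule: rtrig.induct)
     (auto intro!: integrable_Re integrable_mult_right simp del: Re_complex_div_gt_0 times_complex.sel)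

lemma poisson_rtrig:
  assumes "p \<in> rtrig"
  shows "\<exists>\<Phi>. \<Phi> holomorphic_on UNIV \<and> (\<forall>x. Re (\<Phi> (cis x)) = p x) \<and> (\<forall>z\<in>ball 0 1. poisson p z = Re (\<Phi> z))"
  using assms
proof induction
  case (cis c m)
  let ?p = "\<lambda>x. Re (c * cis (real m * x))"
  have ip: "integrable circ ?p"
    by (intro integrable_Re integrable_mult_right integrable_cis)
  have eqp: "of_real (?p x) = c / 2 * cis (of_int (int m) * x) + cnj c / 2 * cis (of_int (- int m) * x)" for x
  proof -
    have "of_real (Re x) = x / 2 + cnj x / 2" for x by (simp add: complex_eq_iff)
    from this[of "c * cis (real m * x)"] show ?thesis
      by (simp only: complex_cnj_mult cis_cnj of_int_minus of_int_of_nat_eq mult_minus_left times_divide_eq_left)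
  qed
  have fcp: "fc (\<lambda>x. of_real (?p x)) k = c / 2 * (if k = int m then 1 else 0) + cnj c / 2 * (if k = - int m then 1 else 0)" for k
    unfolding eqp by (subst fc_add) (simp_all only: fc_cmult fc_cis integrable_mult_right integrable_cis)
  have "poisson ?p z = Re (c * z ^ m)" if z: "cmod z < 1" for z
  proof (cases "m = 0")
    case True
    then show ?thesis using poisson_const[OF z, of "Re c"] by simp
  next
    case False
    have "(\<lambda>k. (if k = 0 then 1 else 2) * fc (\<lambda>x. of_real (?p x)) (int k) * z ^ k) = (\<lambda>k. if k = m then c * z ^ k else 0)"
      unfolding fcp using False by (auto simp: fun_eq_iff)
    then have "(\<lambda>k. if k = m then c * z ^ k else 0) sums herglotz ?p z" using herglotz_sums[OF ip z] by (simp only:)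
    then have "herglotz ?p z = c * z ^ m" using sums_single[of m "\<lambda>k. c * z ^ k"] by (metis sums_unique2)
    then show ?thesis by (simp add: poisson_def)
  qed
  then show ?case
    by (intro exI[of _ "\<lambda>z. c * z ^ m"]) (auto intro!: holomorphic_intros simp: Complex.DeMoivre)
next
  case (add p q)
  then obtain \<Phi> \<Psi> where "\<Phi> holomorphic_on UNIV" "\<Psi> holomorphic_on UNIV"
    and "\<forall>x. Re (\<Phi> (cis x)) = p x" "\<forall>z\<in>ball 0 1. poisson p z = Re (\<Phi> z)"
    and "\<forall>x. Re (\<Psi> (cis x)) = q x" "\<forall>z\<in>ball 0 1. poisson q z = Re (\<Psi> z)" by blast
  moreover have "integrable circ p" "integrable circ q"
    using add.hyps[THEN rtrig_integrable] by auto
  ultimately show ?case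
    by (intro exI[of _ "\<lambda>z. \<Phi> z + \<Psi> z"]) (auto intro!: holomorphic_intros simp: poisson_add)
qed

text \<open>Dividing by the exponential of an analytic function whose real part nearly equals
  \<open>ln (\<bar>q\<bar> + \<epsilon>)\<close> on the circle reduces this to the maximum principle.\<close>

lemma cmod_le_exp_poisson_disc:
  assumes cont: "continuous_on (cball 0 1) q" and hol: "q holomorphic_on ball 0 1"
    and "\<epsilon> > 0" and z: "cmod z < 1"
  shows "cmod (q z) \<le> exp (poisson (\<lambda>x. ln (cmod (q (cis x)) + \<epsilon>)) z)"
proof -
  let ?u = "\<lambda>\<zeta>. ln (cmod (q \<zeta>) + \<epsilon>)"
  have pos: "cmod x + \<epsilon> > 0" for x using \<open>\<epsilon> > 0\<close> by (simp add: add_nonneg_pos)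
  have cu: "continuous_on (sphere 0 1) ?u"
    by (intro continuous_intros continuous_on_subset[OF cont]) (use pos in \<open>auto simp: less_imp_neq[symmetric]\<close>)
  have iu: "integrable circ (\<lambda>x. ?u (cis x))"
  proof -
    obtain B where "\<And>x. norm (?u (cis x)) \<le> B" using continuous_on_sphere_bounded[OF cu] by blast
    then show ?thesis
      by (intro integrable_circ_bounded borel_measurable_circ_continuous continuous_on_cis_compose[OF cu])
  qed
  have le: "cmod (q z) \<le> exp (2 * \<delta> + poisson (\<lambda>x. ?u (cis x)) z)" if "\<delta> > 0" for \<delta>
  proof -
    obtain p where p: "p \<in> rtrig" "\<And>x. \<bar>?u (cis x) - p x\<bar> < \<delta>"
      using rtrig_approx[OF cu \<open>\<delta> > 0\<close>] by blast
    obtain \<Phi> where \<Phi>: "\<Phi> holomorphic_on UNIV" "\<And>x. Re (\<Phi> (cis x)) = p x" "\<And>z. z \<in> ball 0 1 \<Longrightarrow> poisson p z = Re (\<Phi> z)"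
      using poisson_rtrig[OF p(1)] by blast
    have "norm (q z * exp (- \<Phi> z)) \<le> exp \<delta>"
    proof (rule maximum_modulus_frontier[where f="\<lambda>z. q z * exp (- \<Phi> z)" and S="ball 0 1" and \<xi>=z])
      show "(\<lambda>z. q z * exp (- \<Phi> z)) holomorphic_on interior (ball 0 1)"
        by (auto intro!: holomorphic_intros hol holomorphic_on_subset[OF \<Phi>(1)])
      show "continuous_on (closure (ball 0 1)) (\<lambda>z. q z * exp (- \<Phi> z))"
        using holomorphic_on_imp_continuous_on[OF \<Phi>(1)]
        by (auto intro!: continuous_intros cont continuous_on_subset[of UNIV \<Phi>])
      fix \<zeta> :: complex assume "\<zeta> \<in> frontier (ball 0 1)"
      then have n1: "cmod \<zeta> = 1" by simp
      then have "\<zeta> = cis (Arg2pi \<zeta>)" unfolding cis_conv_exp using complex_norm_eq_1_exp by metis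
      then obtain x where \<zeta>: "\<zeta> = cis x" by blast
      have "norm (q \<zeta> * exp (- \<Phi> \<zeta>)) = cmod (q \<zeta>) * exp (- p x)"
        by (simp add: norm_mult \<zeta> \<Phi>(2))
      also have "\<dots> \<le> (cmod (q \<zeta>) + \<epsilon>) * exp (- p x)" using \<open>\<epsilon> > 0\<close> by simp
      also have "\<dots> = exp (?u \<zeta> - p x)" using pos by (simp add: exp_diff exp_minus divide_inverse)
      also have "\<dots> \<le> exp \<delta>" using p(2)[of x] by (simp add: \<zeta>)
      finally show "norm (q \<zeta> * exp (- \<Phi> \<zeta>)) \<le> exp \<delta>" .
    qed (use z in auto)
    then have "cmod (q z) * exp (- Re (\<Phi> z)) \<le> exp \<delta>" by (simp add: norm_mult)
    then have "cmod (q z) \<le> exp (\<delta> + Re (\<Phi> z))" by (simp add: exp_minus exp_add field_simps)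
    also have "Re (\<Phi> z) = poisson p z" using \<Phi>(3) z by simp
    also have "poisson p z \<le> poisson (\<lambda>x. ?u (cis x) + \<delta>) z"
    proof (rule poisson_mono)
      have "p x \<le> ?u (cis x) + \<delta>" for x using p(2)[of x] by linarith
      then show "AE x in circ. p x \<le> ?u (cis x) + \<delta>" by simp
    qed (use z iu rtrig_integrable[OF p(1)] in auto)
    also have "poisson (\<lambda>x. ?u (cis x) + \<delta>) z = poisson (\<lambda>x. ?u (cis x)) z + \<delta>"
      using poisson_add[OF iu _ z, of "\<lambda>_. \<delta>"] poisson_const[OF z] by simp
    finally show ?thesis by (simp add: algebra_simps)
  qed
  have "((\<lambda>\<delta>. exp (2 * \<delta> + poisson (\<lambda>x. ?u (cis x)) z)) \<longlongrightarrow> exp (2 * 0 + poisson (\<lambda>x. ?u (cis x)) z)) (at_right 0)"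
    by (intro tendsto_intros)
  then have "cmod (q z) \<le> exp (2 * 0 + poisson (\<lambda>x. ?u (cis x)) z)"
    by (rule tendsto_lowerbound) (use le in \<open>auto intro!: eventually_at_right_less[THEN eventually_mono]\<close>)
  then show ?thesis by simp
qed
section \<open>Inverses of outer matrix functions\<close>

text \<open>Although \<open>det A\<close> itself need not be integrable for square integrable entries, its logarithm is
  dominated by their sum.\<close>

lemma cmod_det_le:
  fixes A :: "complex^'n^'n"
  defines "N \<equiv> \<Sum>i\<in>UNIV. \<Sum>j\<in>UNIV. cmod (A $ i $ j)"
  shows "ln (cmod (det A) + 1) \<le> ln (fact CARD('n) + 1) + real CARD('n) * N"
proof -
  have N: "0 \<le> N" unfolding N_def by (intro sum_nonneg) auto
  have entry: "cmod (A $ i $ j) \<le> 1 + N" for i j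
  proof -
    have "cmod (A $ i $ j) \<le> (\<Sum>j\<in>UNIV. cmod (A $ i $ j))" by (rule member_le_sum) auto
    also have "\<dots> \<le> N" unfolding N_def
      by (rule member_le_sum[where f="\<lambda>i. \<Sum>j\<in>UNIV. cmod (A $ i $ j)"]) (auto intro: sum_nonneg)
    finally show ?thesis by simp
  qed
  have "cmod (det A) \<le> (\<Sum>p | p permutes (UNIV::'n set). (1 + N) ^ CARD('n))"
    unfolding det_def
  proof (rule sum_norm_le)
    fix p
    have "cmod (of_int (sign p) * (\<Prod>i\<in>UNIV. A $ i $ p i)) = (\<Prod>i\<in>UNIV. cmod (A $ i $ p i))"
      by (simp add: norm_mult prod_norm sign_def)
    also have "\<dots> \<le> (\<Prod>i\<in>(UNIV::'n set). 1 + N)" by (intro prod_mono) (use entry in auto)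
    finally show "cmod (of_int (sign p) * (\<Prod>i\<in>UNIV. A $ i $ p i)) \<le> (1 + N) ^ CARD('n)" by simp
  qed
  also have "\<dots> = fact CARD('n) * (1 + N) ^ CARD('n)"
    by (simp add: card_permutations)
  finally have "cmod (det A) + 1 \<le> fact CARD('n) * (1 + N) ^ CARD('n) + (1 + N) ^ CARD('n)"
    using N one_le_power[of "1 + N" "CARD('n)"] by linarith
  then have "cmod (det A) + 1 \<le> (fact CARD('n) + 1) * (1 + N) ^ CARD('n)" by (simp add: distrib_right)
  then have "ln (cmod (det A) + 1) \<le> ln ((fact CARD('n) + 1) * (1 + N) ^ CARD('n))"
    by (intro ln_mono) (auto simp: add_nonneg_pos)
  also have "\<dots> = ln (fact CARD('n) + 1) + real CARD('n) * ln (1 + N)"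
  proof -
    have "(0::real) < fact CARD('n) + 1" by (smt (verit) fact_ge_zero)
    then show ?thesis using N by (subst ln_mult) (auto simp: ln_realpow)
  qed
  also have "\<dots> \<le> ln (fact CARD('n) + 1) + real CARD('n) * N"
    using ln_add_one_self_le_self[OF N] by (intro add_left_mono mult_left_mono) auto
  finally show ?thesis .
qed

lemma tendsto_det_entries:
  fixes A :: "'b \<Rightarrow> complex^'n^'n"
  assumes "\<And>i j. ((\<lambda>x. A x $ i $ j) \<longlongrightarrow> B $ i $ j) F"
  shows "((\<lambda>x. det (A x)) \<longlongrightarrow> det B) F"
  unfolding det_def by (intro tendsto_intros assms)

lemma holomorphic_det:
  fixes A :: "complex \<Rightarrow> complex^'n^'n"
  assumes "\<And>i j. (\<lambda>z. A z $ i $ j) holomorphic_on S"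
  shows "(\<lambda>z. det (A z)) holomorphic_on S"
  unfolding det_def by (intro holomorphic_intros assms)

lemma measurable_det:
  fixes A :: "'b \<Rightarrow> complex^'n^'n"
  assumes [measurable]: "\<And>i j. (\<lambda>x. A x $ i $ j) \<in> borel_measurable M"
  shows "(\<lambda>x. det (A x)) \<in> borel_measurable M"
  unfolding det_def by measurable

lemma hardy2_holomorphic: "hardy2 f \<Longrightarrow> f holomorphic_on ball 0 1"
  by (simp add: hardy2_def)

lemma hardy2_const: "hardy2 (\<lambda>_. c)"
  unfolding hardy2_def by (auto intro!: exI[of _ "(cmod c)\<^sup>2"])

lemma ln_bounds:
  assumes "0 < \<epsilon>" "\<epsilon> \<le> 1" "0 \<le> (x::real)"
  shows "ln \<epsilon> \<le> ln (x + \<epsilon>)" "ln (x + \<epsilon>) \<le> ln (x + 1)"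
  using assms by (auto intro!: ln_mono)



lemma dilation_cmod: "cmod z < 1 \<Longrightarrow> cmod (of_real (radii n) * z) < 1"
  using mult_strict_mono[of "radii n" 1 "cmod z" 1] radii(1-3)[of n] by (simp add: norm_mult)

lemma dilation_tendsto:
  assumes "f holomorphic_on ball 0 1" "cmod z < 1"
  shows "(\<lambda>n. f (of_real (radii n) * z)) \<longlonglongrightarrow> f z"
proof -
  have "isCont f z" using holomorphic_on_imp_continuous_on[OF assms(1)] assms(2)
    by (auto simp: continuous_on_eq_continuous_at)
  moreover have "(\<lambda>n. of_real (radii n) * z) \<longlonglongrightarrow> of_real 1 * z" by (intro tendsto_intros radii)
  ultimately show ?thesis using isCont_tendsto_compose by fastforce
qed

text \<open>The bound on the closed disc holds for the dilations of \<open>M\<close>, and the passage to the limit is the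
  difficulty: the functions \<open>h n = ln (\<bar>det M\<bar> + \<epsilon>)\<close> on the circles of radius \<open>radii n\<close> have no evident
  common integrable majorant.  They are truncated at the majorant \<open>K + d N\<close> of their limit, which makes
  dominated convergence applicable; the excess is at most \<open>d D n\<close>, where \<open>D n\<close> tends to \<open>0\<close> in mean.\<close>

lemma cmod_det_le_exp_poisson_eps:
  fixes M :: "complex \<Rightarrow> complex^'n^'n"
  assumes M: "hardy2_mat M" and \<epsilon>: "0 < \<epsilon>" "\<epsilon> \<le> 1" and z: "cmod z < 1"
  shows "integrable circ (\<lambda>x. ln (cmod (det (M (cis x))) + \<epsilon>))"
    and "cmod (det (M z)) \<le> exp (poisson (\<lambda>x. ln (cmod (det (M (cis x))) + \<epsilon>)) z)"
proof -
  define K where "K = ln (fact CARD('n) + 1 :: real)"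
  define d where "d = real CARD('n)"
  have d: "0 \<le> d" by (simp add: d_def)
  have Mij: "hardy2 (\<lambda>z. M z $ i $ j)" for i j using M by (simp add: hardy2_mat_def)
  note hol = hardy2_holomorphic[OF Mij]
  define N where "N x = (\<Sum>i\<in>UNIV. \<Sum>j\<in>UNIV. cmod (M (cis x) $ i $ j))" for x
  define D where "D n x = (\<Sum>i\<in>UNIV. \<Sum>j\<in>UNIV. cmod (M (of_real (radii n) * cis x) $ i $ j - M (cis x) $ i $ j))" for n x
  define h where "h n x = ln (cmod (det (M (of_real (radii n) * cis x))) + \<epsilon>)" for n x
  define h0 where "h0 x = ln (cmod (det (M (cis x))) + \<epsilon>)" for x
  define g where "g n x = min (h n x) (K + d * N x)" for n x
  have pos: "cmod x + \<epsilon> > 0" for x :: complex using \<epsilon> by (simp add: add_nonneg_pos)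
  have sqM: "sqint (\<lambda>x. M (cis x) $ i $ j)" for i j by (rule hardy2_boundary[OF Mij])
  have sqMn: "sqint (\<lambda>x. M (of_real (radii n) * cis x) $ i $ j)" for n i j by (rule sqint_dilation[OF hol radii(1,3)])
  have iN: "integrable circ N"
    unfolding N_def by (intro Bochner_Integration.integrable_sum integrable_norm integrable_sqint sqM)
  have iD: "integrable circ (D n)" for n
    unfolding D_def by (intro Bochner_Integration.integrable_sum integrable_norm integrable_sqint sqint_diff sqM sqMn)
  have K: "0 \<le> K" unfolding K_def by (intro ln_ge_zero) simp
  have N0: "0 \<le> N x" for x unfolding N_def by (intro sum_nonneg) auto
  have D0: "0 \<le> D n x" for n x unfolding D_def by (intro sum_nonneg) auto
  have [measurable]: "(\<lambda>x. det (M (of_real (radii n) * cis x))) \<in> borel_measurable circ" for n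
    by (intro measurable_det sqintD(1) sqMn)
  have [measurable]: "(\<lambda>x. det (M (cis x))) \<in> borel_measurable circ"
    by (intro measurable_det sqintD(1) sqM)
  note [measurable] = borel_measurable_integrable[OF iN]
  have hm [measurable]: "h n \<in> borel_measurable circ" for n unfolding h_def by measurable
  have h0m [measurable]: "h0 \<in> borel_measurable circ" unfolding h0_def by measurable
  have gm [measurable]: "g n \<in> borel_measurable circ" for n unfolding g_def by measurable
  have low: "ln \<epsilon> \<le> h n x" for n x unfolding h_def by (rule ln_bounds[OF \<epsilon>]) simp
  have le0: "ln \<epsilon> \<le> 0" using \<epsilon> by (simp add: ln_le_zero_iff)
  have up: "h n x \<le> K + d * N x + d * D n x" for n x
  proof -
    have "h n x \<le> ln (cmod (det (M (of_real (radii n) * cis x))) + 1)" unfolding h_def by (rule ln_bounds[OF \<epsilon>]) simp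
    also have "\<dots> \<le> K + d * (\<Sum>i\<in>UNIV. \<Sum>j\<in>UNIV. cmod (M (of_real (radii n) * cis x) $ i $ j))"
      unfolding K_def d_def by (rule cmod_det_le)
    also have "\<dots> \<le> K + d * (N x + D n x)"
    proof (intro add_left_mono mult_left_mono d)
      show "(\<Sum>i\<in>UNIV. \<Sum>j\<in>UNIV. cmod (M (of_real (radii n) * cis x) $ i $ j)) \<le> N x + D n x"
        unfolding N_def D_def sum.distrib[symmetric]
        by (intro sum_mono) (metis add_diff_cancel_left' diff_add_cancel norm_triangle_ineq add.commute)
    qed
    finally show ?thesis by (simp add: distrib_left)
  qed
  have gle: "\<bar>g n x\<bar> \<le> \<bar>ln \<epsilon>\<bar> + K + d * N x" for n x
  proof -
    have "0 \<le> d * N x" using d N0 by simp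
    then show ?thesis using low[of n x] le0 K unfolding g_def by linarith
  qed
  have glim: "AE x in circ. (\<lambda>n. g n x) \<longlonglongrightarrow> h0 x"
  proof -
    have "AE x in circ. \<forall>i j. (\<lambda>n. M (of_real (radii n) * cis x) $ i $ j) \<longlonglongrightarrow> M (cis x) $ i $ j"
      using hardy2_radial[OF Mij] by (simp add: AE_all_countable)
    then show ?thesis
    proof eventually_elim
      case (elim x)
      have "(\<lambda>n. det (M (of_real (radii n) * cis x))) \<longlonglongrightarrow> det (M (cis x))"
        by (rule tendsto_det_entries) (use elim in auto)
      then have "(\<lambda>n. h n x) \<longlonglongrightarrow> h0 x"
        unfolding h_def h0_def using pos[of "det (M (cis x))"] by (intro tendsto_intros) auto
      then have "(\<lambda>n. g n x) \<longlonglongrightarrow> min (h0 x) (K + d * N x)"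
        unfolding g_def by (intro tendsto_intros)
      moreover have "h0 x \<le> K + d * N x"
      proof -
        have "h0 x \<le> ln (cmod (det (M (cis x))) + 1)" unfolding h0_def by (rule ln_bounds[OF \<epsilon>]) simp
        also have "\<dots> \<le> K + d * N x" unfolding K_def d_def N_def by (rule cmod_det_le)
        finally show ?thesis .
      qed
      ultimately show ?case by (simp add: min_def)
    qed
  qed
  have ib: "integrable circ (\<lambda>x. \<bar>ln \<epsilon>\<bar> + K + d * N x)" using iN by simp
  note pt = poisson_tendsto[OF z ib gm h0m AE_I2[OF gle] glim]
  show "integrable circ (\<lambda>x. ln (cmod (det (M (cis x))) + \<epsilon>))" using pt(1) by (simp add: h0_def[abs_def])
  have ih: "integrable circ (h n)" for n
  proof (rule Bochner_Integration.integrable_bound)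
    show "integrable circ (\<lambda>x. \<bar>ln \<epsilon>\<bar> + K + d * N x + d * D n x)" using iN iD[of n] by simp
    have "\<bar>h n x\<bar> \<le> \<bar>ln \<epsilon>\<bar> + K + d * N x + d * D n x" for x
    proof -
      have "0 \<le> d * N x" "0 \<le> d * D n x" using d N0 D0 by simp_all
      then show ?thesis using low[of n x] up[of n x] le0 K by linarith
    qed
    then show "AE x in circ. norm (h n x) \<le> norm (\<bar>ln \<epsilon>\<bar> + K + d * N x + d * D n x)"
      by (intro AE_I2) (simp add: order_trans[OF _ abs_ge_self])
  qed (rule hm)
  define b where "b = 2 / (1 - cmod z)"
  have b: "0 \<le> b" using z by (simp add: b_def)
  have step: "cmod (det (M (of_real (radii n) * z))) \<le> exp (poisson (g n) z + b * (d * (LINT x|circ. D n x)))" for n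
  proof -
    have "cmod (det (M (of_real (radii n) * z))) \<le> exp (poisson (h n) z)"
      unfolding h_def
    proof (rule cmod_le_exp_poisson_disc[where q="\<lambda>z. det (M (of_real (radii n) * z))", OF _ _ \<epsilon>(1) z])
      have hd: "(\<lambda>z. det (M z)) holomorphic_on ball 0 1" by (rule holomorphic_det[OF hol])
      show "continuous_on (cball 0 1) (\<lambda>z. det (M (of_real (radii n) * z)))"
        by (rule continuous_dilation[OF hd radii(1,3)])
      have "(\<lambda>z. det (M z)) \<circ> (\<lambda>z. of_real (radii n) * z) holomorphic_on ball 0 1"
        by (rule holomorphic_on_compose_gen[OF _ hd]) (auto intro!: holomorphic_intros dilation_cmod)
      then show "(\<lambda>z. det (M (of_real (radii n) * z))) holomorphic_on ball 0 1" by (simp add: o_def)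
    qed
    also have "poisson (h n) z \<le> poisson (\<lambda>x. g n x + d * D n x) z"
    proof (rule poisson_mono[OF ih _ z])
      have "h n x \<le> g n x + d * D n x" for x
      proof -
        have "0 \<le> d * D n x" using d D0 by simp
        then show ?thesis using up[of n x] unfolding g_def by linarith
      qed
      then show "AE x in circ. h n x \<le> g n x + d * D n x" by simp
    qed (use pt(2) iD in auto)
    also have "\<dots> = poisson (g n) z + d * poisson (D n) z"
      using poisson_add[OF pt(2) _ z, of "\<lambda>x. d * D n x"] iD poisson_cmult[OF iD z] by simp
    also have "d * poisson (D n) z \<le> b * (d * (LINT x|circ. D n x))"
    proof -
      have "poisson (D n) z \<le> (LINT x|circ. b * D n x)"
        unfolding poisson_eq[OF iD z]
      proof (rule integral_mono)
        show "pkernel z x * D n x \<le> b * D n x" for x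
          by (intro mult_right_mono D0) (use pkernel_le[OF z] in \<open>simp add: b_def\<close>)
      qed (use iD poisson_integrable[OF iD z] in auto)
      then have "poisson (D n) z \<le> b * (LINT x|circ. D n x)" by simp
      from mult_left_mono[OF this d] show ?thesis by (simp only: mult.left_commute)
    qed
    finally show ?thesis by simp
  qed
  have Dlim: "(\<lambda>n. LINT x|circ. D n x) \<longlonglongrightarrow> 0"
  proof -
    have e: "(\<lambda>n. LINT x|circ. cmod (M (of_real (radii n) * cis x) $ i $ j - M (cis x) $ i $ j)) \<longlonglongrightarrow> 0" for i j
    proof (rule tendsto_sandwich[where f="\<lambda>_. 0"])
      let ?q = "\<lambda>n x. M (of_real (radii n) * cis x) $ i $ j - M (cis x) $ i $ j"
      have "(LINT x|circ. cmod (?q n x)) \<le> sqrt (LINT x|circ. (cmod (?q n x))\<^sup>2)" for n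
        using Cauchy_Schwarz_circ[OF sqint_diff[OF sqMn[of n i j] sqM[of i j]] sqint_one]
        by (intro real_le_rsqrt) simp
      then show "\<forall>\<^sub>F n in sequentially. (LINT x|circ. cmod (?q n x)) \<le> sqrt (LINT x|circ. (cmod (?q n x))\<^sup>2)" by simp
      show "(\<lambda>n. sqrt (LINT x|circ. (cmod (?q n x))\<^sup>2)) \<longlonglongrightarrow> 0"
        using tendsto_real_sqrt[OF hardy2_boundary(3)[OF Mij[of i j]]] by simp
    qed auto
    have "(\<lambda>n. \<Sum>i\<in>UNIV. \<Sum>j\<in>UNIV. LINT x|circ. cmod (M (of_real (radii n) * cis x) $ i $ j - M (cis x) $ i $ j)) \<longlonglongrightarrow> (\<Sum>i\<in>(UNIV::'n set). \<Sum>j\<in>(UNIV::'n set). 0)"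
      by (intro tendsto_sum e)
    moreover have "(LINT x|circ. D n x) = (\<Sum>i\<in>UNIV. \<Sum>j\<in>UNIV. LINT x|circ. cmod (M (of_real (radii n) * cis x) $ i $ j - M (cis x) $ i $ j))" for n
      unfolding D_def
      by (subst Bochner_Integration.integral_sum; intro Bochner_Integration.integrable_sum integrable_norm integrable_sqint sqint_diff sqM sqMn sum.cong refl)
         (subst Bochner_Integration.integral_sum; intro Bochner_Integration.integrable_sum integrable_norm integrable_sqint sqint_diff sqM sqMn sum.cong refl)
    ultimately show ?thesis by simp
  qed
  have "(\<lambda>n. exp (poisson (g n) z + b * (d * (LINT x|circ. D n x)))) \<longlonglongrightarrow> exp (poisson h0 z + b * (d * 0))"
    by (intro tendsto_intros pt Dlim)
  moreover have "(\<lambda>n. cmod (det (M (of_real (radii n) * z)))) \<longlonglongrightarrow> cmod (det (M z))"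
    by (intro tendsto_norm dilation_tendsto[OF holomorphic_det[OF hol] z])
  ultimately have "cmod (det (M z)) \<le> exp (poisson h0 z + b * (d * 0))"
    using step by (intro LIMSEQ_le) auto
  then show "cmod (det (M z)) \<le> exp (poisson (\<lambda>x. ln (cmod (det (M (cis x))) + \<epsilon>)) z)" by (simp add: h0_def[abs_def])
qed

lemma cmod_det_le_exp_poisson:
  fixes M :: "complex \<Rightarrow> complex^'n^'n"
  assumes M: "hardy2_mat M" and u: "integrable circ u"
    and le: "AE x in circ. cmod (det (M (cis x))) \<le> exp (u x)" and z: "cmod z < 1"
  shows "cmod (det (M z)) \<le> exp (poisson u z)"
proof -
  define \<epsilon> where "\<epsilon> n = inverse (real (Suc n))" for n
  have \<epsilon>: "0 < \<epsilon> n" "\<epsilon> n \<le> 1" for n by (auto simp: \<epsilon>_def field_simps)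
  have \<epsilon>lim: "\<epsilon> \<longlonglongrightarrow> 0" unfolding \<epsilon>_def by (rule LIMSEQ_inverse_real_of_nat)
  define v where "v n x = ln (exp (u x) + \<epsilon> n)" for n x
  note [measurable] = borel_measurable_integrable[OF u]
  have [measurable]: "v n \<in> borel_measurable circ" for n unfolding v_def by measurable
  have pos: "exp x + \<epsilon> n > 0" for x n using \<epsilon>(1)[of n] by (simp add: add_pos_pos)
  have bound: "\<bar>v n x\<bar> \<le> \<bar>u x\<bar> + ln 2" for n x
  proof -
    have "u x = ln (exp (u x))" by simp
    also have "\<dots> \<le> v n x" unfolding v_def using \<epsilon>[of n] by (intro ln_mono) auto
    finally have 1: "u x \<le> v n x" .
    have "exp (u x) \<le> exp \<bar>u x\<bar>" "1 \<le> exp \<bar>u x\<bar>" by auto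
    then have "exp (u x) + \<epsilon> n \<le> exp \<bar>u x\<bar> * 2" using \<epsilon>(2)[of n] by linarith
    then have "v n x \<le> ln (exp \<bar>u x\<bar> * 2)" unfolding v_def using pos by (intro ln_mono) auto
    also have "\<dots> = \<bar>u x\<bar> + ln 2" by (simp add: ln_mult)
    finally have 2: "v n x \<le> \<bar>u x\<bar> + ln 2" .
    have "0 \<le> ln (2::real)" by simp
    then show ?thesis using 1 2 by linarith
  qed
  have lim: "(\<lambda>n. v n x) \<longlonglongrightarrow> u x" for x
  proof -
    have "(\<lambda>n. v n x) \<longlonglongrightarrow> ln (exp (u x) + 0)"
      unfolding v_def by (intro tendsto_intros \<epsilon>lim) simp
    then show ?thesis by simp
  qed
  have ib: "integrable circ (\<lambda>x. \<bar>u x\<bar> + ln 2)" using u by simp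
  have pt: "integrable circ u" "\<And>n. integrable circ (v n)" "(\<lambda>n. poisson (v n) z) \<longlonglongrightarrow> poisson u z"
    by (rule poisson_tendsto[OF z ib _ _ AE_I2[OF bound] AE_I2[OF lim]]; measurable)+
  have "cmod (det (M z)) \<le> exp (poisson (v n) z)" for n
  proof -
    note e = cmod_det_le_exp_poisson_eps[OF M \<epsilon> z]
    have "AE x in circ. ln (cmod (det (M (cis x))) + \<epsilon> n) \<le> v n x"
      using le
    proof eventually_elim
      case (elim x)
      then show ?case unfolding v_def using \<epsilon>(1)[of n] by (intro ln_mono) (auto intro: add_nonneg_pos)
    qed
    from poisson_mono[OF e(1) pt(2) z this] show ?thesis using e(2)[of n] by (meson exp_le_cancel_iff order_trans)
  qed
  moreover have "(\<lambda>n. exp (poisson (v n) z)) \<longlonglongrightarrow> exp (poisson u z)" by (intro tendsto_intros pt)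
  ultimately show ?thesis by (intro LIMSEQ_le_const) auto
qed

text \<open>Equality in \<open>ln \<bar>det h\<bar> \<le> Poisson integral of its boundary values\<close> at the origin propagates to
  the whole disc: the quotient of \<open>det h\<close> by the exponential of the Herglotz integral is bounded
  by \<open>1\<close> and attains this bound at \<open>0\<close>.\<close>

lemma cmod_det_outer:
  fixes h :: "complex \<Rightarrow> complex^'n^'n"
  assumes h: "outer_mat h" and nz: "AE x in circ. det (h (cis x)) \<noteq> 0" and z: "cmod z < 1"
  shows "cmod (det (h z)) = exp (poisson (\<lambda>x. ln (cmod (det (h (cis x))))) z)"
proof -
  let ?u = "\<lambda>x. ln (cmod (det (h (cis x))))"
  have hm: "hardy2_mat h" and h0: "det (h 0) \<noteq> 0" and u: "integrable circ ?u"
    and eq: "ln (cmod (det (h 0))) = (LINT x|circ. ?u x)"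
    using h by (auto simp: outer_mat_def outer_scalar_def)
  have le: "cmod (det (h z)) \<le> exp (poisson ?u z)" if "cmod z < 1" for z
    by (rule cmod_det_le_exp_poisson[OF hm u _ that]) (use nz in \<open>auto elim!: eventually_mono\<close>)
  let ?q = "\<lambda>z. det (h z) * exp (- herglotz ?u z)"
  have holh: "(\<lambda>z. det (h z)) holomorphic_on ball 0 1"
    by (rule holomorphic_det) (use hm in \<open>auto simp: hardy2_mat_def hardy2_def\<close>)
  have hol: "?q holomorphic_on ball 0 1"
    by (intro holomorphic_intros holh herglotz_holomorphic u)
  have nq: "cmod (?q z) = cmod (det (h z)) * exp (- poisson ?u z)" for z
    by (simp add: norm_mult poisson_def)
  have q1: "cmod (?q z) \<le> 1" if "cmod z < 1" for z
    unfolding nq using le[OF that] by (simp add: exp_minus field_simps)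
  have q0: "cmod (?q 0) = 1"
    unfolding nq poisson_0[OF u] eq[symmetric] using h0 by (simp add: exp_minus)
  have "?q constant_on ball 0 1"
    by (rule maximum_modulus_principle[where \<xi>=0 and U="ball 0 1", OF hol]) (use q1 q0 in auto)
  then have "?q z = ?q 0" using z by (force simp: constant_on_def)
  then have "cmod (?q z) = 1" using q0 by simp
  then show ?thesis unfolding nq by (simp add: exp_minus field_simps)
qed

lemma matrix_inv_mult:
  fixes A :: "complex^'n^'n"
  assumes "det A \<noteq> 0"
  shows "A ** matrix_inv A = mat 1" "matrix_inv A ** A = mat 1"
proof -
  have "\<exists>B. A ** B = mat 1 \<and> B ** A = mat 1"
    using assms by (simp add: invertible_det_nz[symmetric] invertible_def)
  then have "A ** matrix_inv A = mat 1 \<and> matrix_inv A ** A = mat 1"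
    unfolding matrix_inv_def by (rule someI_ex)
  then show "A ** matrix_inv A = mat 1" "matrix_inv A ** A = mat 1" by auto
qed

lemma matrix_inv_eq_cramer:
  fixes A :: "complex^'n^'n"
  assumes "det A \<noteq> 0"
  shows "matrix_inv A $ k $ q = det (\<chi> i j. if j = k then (if i = q then 1 else 0) else A $ i $ j) / det A"
proof -
  note inv = matrix_inv_mult(1)[OF assms]
  have "A *v (\<chi> k. matrix_inv A $ k $ q) = (\<chi> i. if i = q then 1 else 0)"
  proof (subst vec_eq_iff, rule allI)
    fix i
    have "(A *v (\<chi> k. matrix_inv A $ k $ q)) $ i = (A ** matrix_inv A) $ i $ q"
      by (simp add: matrix_vector_mult_def matrix_matrix_mult_def)
    then show "(A *v (\<chi> k. matrix_inv A $ k $ q)) $ i = (\<chi> i. if i = q then 1 else 0) $ i"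
      by (simp add: inv mat_def)
  qed
  then have "(\<chi> k. matrix_inv A $ k $ q) =
      (\<chi> k. det (\<chi> i j. if j = k then (\<chi> i. if i = q then 1 else 0) $ i else A $ i $ j) / det A)"
    using cramer[OF assms] by blast
  then show ?thesis unfolding vec_eq_iff vec_lambda_beta by blast
qed

text \<open>This is Jensen's inequality for the Poisson kernel; it follows from the tangent of \<^const>\<open>exp\<close> at
  the mean \<open>m\<close>.\<close>

lemma exp_poisson_le:
  assumes v: "integrable circ v" and e: "integrable circ (\<lambda>x. exp (v x))" and z: "cmod z < 1"
  shows "exp (poisson v z) \<le> poisson (\<lambda>x. exp (v x)) z"
proof -
  define m where "m = poisson v z"
  have "exp m * (1 + (x - m)) \<le> exp x" for x
  proof -
    have "exp m * (1 + (x - m)) \<le> exp m * exp (x - m)" by (intro mult_left_mono exp_ge_add_one_self) auto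
    then show ?thesis by (simp add: exp_add[symmetric])
  qed
  then have "poisson (\<lambda>x. exp m * (1 + (v x - m))) z \<le> poisson (\<lambda>x. exp (v x)) z"
    by (intro poisson_mono z e) (use v in auto)
  moreover have "poisson (\<lambda>x. exp m * (1 + (v x - m))) z = exp m"
  proof -
    have "poisson (\<lambda>x. exp m * (1 + (v x - m))) z = exp m * poisson (\<lambda>x. (1 - m) + v x) z"
      using poisson_cmult[OF _ z, of "\<lambda>x. (1 - m) + v x" "exp m"] v by (simp add: algebra_simps)
    also have "poisson (\<lambda>x. (1 - m) + v x) z = (1 - m) + m"
      using poisson_add[OF _ v z, of "\<lambda>_. 1 - m"] poisson_const[OF z] by (simp add: m_def)
    finally show ?thesis by simp
  qed
  ultimately show ?thesis by (simp add: m_def)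
qed

lemma mean_poisson:
  assumes G: "integrable circ G" and r: "0 \<le> r" "r < 1"
  shows "integrable circ (\<lambda>t. poisson G (of_real r * cis t))"
    and "(LINT t|circ. poisson G (of_real r * cis t)) = (LINT x|circ. G x)"
proof -
  let ?H = "\<lambda>t. herglotz G (of_real r * cis t)"
  note hol = herglotz_holomorphic[OF G]
  have i: "integrable circ ?H" by (rule integrable_sqint[OF sqint_dilation[OF hol r]])
  show "integrable circ (\<lambda>t. poisson G (of_real r * cis t))"
    unfolding poisson_def using i by (rule integrable_Re)
  have "(LINT t|circ. ?H t) = taylor (herglotz G) 0"
    using fc_dilation[OF hol r, of 0] by (simp add: fc_def)
  also have "\<dots> = herglotz G 0"
    by (simp add: taylor_def fps_expansion_def)
  finally show "(LINT t|circ. poisson G (of_real r * cis t)) = (LINT x|circ. G x)"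
    unfolding poisson_def using i by (simp add: integral_Re herglotz_0[OF G])
qed

text \<open>By Cramer's rule an entry of \<open>h\<^sup>-\<^sup>1\<close> is \<open>det M / det h\<close>, where \<open>M\<close> is again a matrix of Hardy
  functions.  The upper bound for \<open>\<bar>det M\<bar>\<close> and the exact value of \<open>\<bar>det h\<bar>\<close> show that this entry is at
  most the exponential of the Poisson integral of \<open>v = ln (\<bar>entry\<bar> + 1)\<close>; the summand \<open>1\<close> makes \<open>v\<close>
  integrable.  Jensen's inequality bounds the mean square on each circle.\<close>

theorem hardy2_mat_inverse_outer:
  fixes h :: "complex \<Rightarrow> complex^'n^'n"
  assumes h: "outer_mat h" and nz: "AE x in circ. det (h (cis x)) \<noteq> 0"
    and sq: "\<And>i j. sqint (\<lambda>x. matrix_inv (h (cis x)) $ i $ j)"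
  shows "hardy2_mat (\<lambda>z. matrix_inv (h z))" and "\<And>z. cmod z < 1 \<Longrightarrow> det (h z) \<noteq> 0"
proof -
  let ?u = "\<lambda>x. ln (cmod (det (h (cis x))))"
  have hm: "hardy2_mat h" and u: "integrable circ ?u"
    using h by (auto simp: outer_mat_def outer_scalar_def)
  note out = cmod_det_outer[OF h nz]
  show nz': "det (h z) \<noteq> 0" if "cmod z < 1" for z
    using out[OF that] by auto
  show "hardy2_mat (\<lambda>z. matrix_inv (h z))"
    unfolding hardy2_mat_def
  proof (intro allI)
    fix k q
    define M where "M z = (\<chi> i j. if j = k then (if i = q then 1 else 0) else h z $ i $ j)" for z
    have "hardy2 (\<lambda>z. if j = k then (if i = q then 1 else 0) else h z $ i $ j)" for i j
      using hm by (cases "j = k") (simp_all add: hardy2_mat_def hardy2_const)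
    then have M: "hardy2_mat M"
      unfolding hardy2_mat_def M_def vec_lambda_beta by blast
    have cram: "matrix_inv (h z) $ k $ q = det (M z) / det (h z)" if "det (h z) \<noteq> 0" for z
      using matrix_inv_eq_cramer[OF that] by (simp add: M_def)
    have hij: "hardy2 (\<lambda>z. h z $ i $ j)" "hardy2 (\<lambda>z. M z $ i $ j)" for i j
      using hm M by (auto simp: hardy2_mat_def)
    define v where "v x = ln (cmod (matrix_inv (h (cis x)) $ k $ q) + 1)" for x
    let ?g = "\<lambda>x. matrix_inv (h (cis x)) $ k $ q"
    have [measurable]: "?g \<in> borel_measurable circ" by (rule sqintD(1)[OF sq])
    have v: "integrable circ v"
    proof (rule Bochner_Integration.integrable_bound[OF integrable_norm[OF integrable_sqint[OF sq[of k q]]]])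
      show "v \<in> borel_measurable circ" unfolding v_def by measurable
      show "AE x in circ. norm (v x) \<le> norm (norm (?g x))"
      proof (rule AE_I2)
        fix x
        have "0 \<le> v x" unfolding v_def by (rule ln_ge_zero) simp
        moreover have "v x \<le> cmod (?g x)"
          unfolding v_def using ln_add_one_self_le_self[OF norm_ge_zero] by (simp add: add.commute)
        ultimately show "norm (v x) \<le> norm (norm (?g x))" by simp
      qed
    qed
    have ev: "exp (2 * v x) = (cmod (?g x) + 1)\<^sup>2" for x
    proof -
      have "exp (2 * v x) = (exp (v x))\<^sup>2" by (simp add: power2_eq_square exp_add[symmetric])
      also have "exp (v x) = cmod (?g x) + 1" unfolding v_def by (rule exp_ln) (simp add: add_nonneg_pos)
      finally show ?thesis .
    qed
    have iG: "integrable circ (\<lambda>x. exp (2 * v x))"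
    proof -
      have s: "sqint (\<lambda>x. cmod (?g x) + 1)"
        by (intro sqint_add sqint_norm sq sqint_bounded[where B=1]) auto
      have "(norm (cmod (?g x) + 1))\<^sup>2 = exp (2 * v x)" for x unfolding ev by simp
      with sqintD(2)[OF s] show ?thesis by (simp only:)
    qed
    have bound: "(cmod (matrix_inv (h z) $ k $ q))\<^sup>2 \<le> poisson (\<lambda>x. exp (2 * v x)) z" if z: "cmod z < 1" for z
    proof -
      have "cmod (det (M z)) \<le> exp (poisson (\<lambda>x. ?u x + v x) z)"
      proof (rule cmod_det_le_exp_poisson[OF M _ _ z])
        show "AE x in circ. cmod (det (M (cis x))) \<le> exp (?u x + v x)"
          using nz
        proof eventually_elim
          case (elim x)
          have "exp (?u x + v x) = cmod (det (h (cis x))) * (cmod (?g x) + 1)"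
            using elim by (simp add: exp_add v_def add_nonneg_pos)
          also have "\<dots> \<ge> cmod (det (h (cis x))) * cmod (?g x)" by (simp add: distrib_left)
          also have "cmod (det (h (cis x))) * cmod (?g x) = cmod (det (M (cis x)))"
            using elim by (simp add: cram norm_divide)
          finally show ?case .
        qed
      qed (use u v in simp)
      also have "\<dots> = cmod (det (h z)) * exp (poisson v z)"
        using poisson_add[OF u v z] by (simp add: exp_add out[OF z])
      finally have "cmod (matrix_inv (h z) $ k $ q) \<le> exp (poisson v z)"
        using nz'[OF z] by (simp add: cram norm_divide field_simps)
      then have "(cmod (matrix_inv (h z) $ k $ q))\<^sup>2 \<le> (exp (poisson v z))\<^sup>2" by (intro power_mono) auto
      also have "\<dots> = exp (2 * poisson v z)" by (simp add: power2_eq_square exp_add[symmetric])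
      also have "\<dots> = exp (poisson (\<lambda>x. 2 * v x) z)" using poisson_cmult[OF v z] by simp
      also have "\<dots> \<le> poisson (\<lambda>x. exp (2 * v x)) z" by (rule exp_poisson_le) (use v iG z in auto)
      finally show ?thesis .
    qed
    have hol: "(\<lambda>z. matrix_inv (h z) $ k $ q) holomorphic_on ball 0 1"
    proof (rule holomorphic_transform)
      show "(\<lambda>z. det (M z) / det (h z)) holomorphic_on ball 0 1"
        by (intro holomorphic_intros holomorphic_det hardy2_holomorphic hij) (use nz' in auto)
    qed (use cram nz' in auto)
    show "hardy2 (\<lambda>z. matrix_inv (h z) $ k $ q)"
      unfolding hardy2_def
    proof (intro conjI exI allI impI)
      fix r :: real assume "0 \<le> r \<and> r < 1"
      then have r: "0 \<le> r" "r < 1" by auto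
      have "(LINT t|circ. (cmod (matrix_inv (h (of_real r * cis t)) $ k $ q))\<^sup>2) \<le>
         (LINT t|circ. poisson (\<lambda>x. exp (2 * v x)) (of_real r * cis t))"
        by (intro integral_mono sqintD(2)[OF sqint_dilation[OF hol r]] mean_poisson(1)[OF iG r] bound)
           (use r in \<open>simp add: norm_mult\<close>)
      also have "\<dots> = (LINT x|circ. exp (2 * v x))" by (rule mean_poisson(2)[OF iG r])
      finally show "(LINT t|circ. (cmod (matrix_inv (h (of_real r * cis t)) $ k $ q))\<^sup>2) \<le> (LINT x|circ. exp (2 * v x))" .
    next
      have rad: "AE x in circ. \<forall>i j. ((\<lambda>r. F (of_real r * cis x) $ i $ j) \<longlongrightarrow> F (cis x) $ i $ j) (at_left 1)"
        if "hardy2_mat F" for F :: "complex \<Rightarrow> complex^'n^'n"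
        using that by (simp add: AE_all_countable hardy2_mat_def hardy2_def)
      show "AE x in circ. ((\<lambda>r. matrix_inv (h (of_real r * cis x)) $ k $ q) \<longlongrightarrow> ?g x) (at_left 1)"
        using rad[OF hm] rad[OF M] nz
      proof eventually_elim
        case (elim x)
        have "((\<lambda>r. det (M (of_real r * cis x)) / det (h (of_real r * cis x))) \<longlongrightarrow> det (M (cis x)) / det (h (cis x))) (at_left 1)"
          by (intro tendsto_divide tendsto_det_entries) (use elim in auto)
        moreover have "\<forall>\<^sub>F r in at_left 1. det (M (of_real r * cis x)) / det (h (of_real r * cis x)) = matrix_inv (h (of_real r * cis x)) $ k $ q"
          using eventually_at_left_real[OF zero_less_one]
          by eventually_elim (subst cram; use nz' in \<open>simp add: norm_mult\<close>)
        ultimately show ?case using elim(3) by (simp add: cram tendsto_cong)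
      qed
    qed (rule hol)
  qed
qed


section \<open>Matrix-valued functions on the circle\<close>

lemma adj_nth [simp]: "adj A $ i $ j = cnj (A $ j $ i)"
  by (simp add: adj_def)

lemma adj_adj [simp]: "adj (adj A) = A"
  by (simp add: vec_eq_iff)

lemma adj_mult: "adj (A ** B) = adj B ** adj A"
  by (simp add: vec_eq_iff matrix_matrix_mult_def mult.commute)

lemma adj_mat_1 [simp]: "adj (mat 1) = mat 1"
  by (simp add: vec_eq_iff mat_def)

lemma adj_add: "adj (A + B) = adj A + adj B"
  by (simp add: vec_eq_iff)

lemma adj_minus [simp]: "adj (- A) = - adj A"
  by (simp add: vec_eq_iff)

lemma adj_0 [simp]: "adj 0 = 0"
  by (simp add: vec_eq_iff)

lemma adj_sum: "adj (\<Sum>i\<in>S. f i) = (\<Sum>i\<in>S. adj (f i))"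
  by (induction S rule: infinite_finite_induct) (auto simp: adj_add)

lemma matrix_mult_minus [simp]:
  fixes A :: "complex^'m^'n" and B :: "complex^'p^'m"
  shows "(- A) ** B = - (A ** B)" "A ** (- B) = - (A ** B)"
  by (simp_all add: vec_eq_iff matrix_matrix_mult_def sum_negf)

lemma matrix_mult_zero [simp]:
  fixes A :: "complex^'m^'n" and B :: "complex^'p^'m"
  shows "(0 :: complex^'m^'n) ** B = 0" "A ** (0 :: complex^'p^'m) = 0"
  by (simp_all add: vec_eq_iff matrix_matrix_mult_def)

lemma matrix_mult_diff_right:
  fixes A :: "complex^'m^'n"
  shows "A ** (B - C) = A ** B - A ** C"
  by (simp add: vec_eq_iff matrix_matrix_mult_def right_diff_distrib sum_subtractf)

lemma matrix_mult_diff_left: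
  fixes A :: "complex^'p^'m"
  shows "(B - C) ** A = B ** A - C ** A"
  by (simp add: vec_eq_iff matrix_matrix_mult_def left_diff_distrib sum_subtractf)

lemma matrix_mult_add_right:
  fixes A :: "complex^'m^'n"
  shows "A ** (B + C) = A ** B + A ** C"
  by (simp add: vec_eq_iff matrix_matrix_mult_def distrib_left sum.distrib)

lemma matrix_mult_sum_right:
  fixes A :: "complex^'m^'n"
  shows "A ** (\<Sum>i\<in>S. f i) = (\<Sum>i\<in>S. A ** f i)"
  by (induction S rule: infinite_finite_induct) (auto simp: matrix_mult_add_right)

lemma matrix_mult_add_left:
  fixes A :: "complex^'p^'m"
  shows "(B + C) ** A = B ** A + C ** A"
  by (simp add: vec_eq_iff matrix_matrix_mult_def distrib_right sum.distrib)

lemma matrix_mult_sum_left: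
  fixes A :: "complex^'p^'m"
  shows "(\<Sum>i\<in>S. f i) ** A = (\<Sum>i\<in>S. f i ** A)"
  by (induction S rule: infinite_finite_induct) (auto simp: matrix_mult_add_left)

lemma bounded_linear_adj: "bounded_linear (adj :: complex^'d^'d \<Rightarrow> complex^'d^'d)"
  by (subst linear_conv_bounded_linear[symmetric]) (auto intro!: linearI simp: vec_eq_iff)

lemma bounded_linear_matrix_mult_left: "bounded_linear (\<lambda>X::complex^'d^'d. X ** (B :: complex^'d^'d))"
  by (subst linear_conv_bounded_linear[symmetric])
     (auto intro!: linearI simp: vec_eq_iff matrix_matrix_mult_def distrib_right sum.distrib scaleR_sum_right)

lemma inner_matrix_mult_left: "(A ** B) \<bullet> C = B \<bullet> (adj A ** C)" for A B C :: "complex^'d^'d"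
proof -
  have i: "x \<bullet> y = Re (x * cnj y)" for x y :: complex by (simp add: inner_complex_def)
  have "(A ** B) \<bullet> C = Re (\<Sum>i\<in>UNIV. \<Sum>j\<in>UNIV. \<Sum>k\<in>UNIV. A $ i $ k * B $ k $ j * cnj (C $ i $ j))"
    by (simp add: inner_vec_def i matrix_matrix_mult_def sum_distrib_right)
  also have "(\<Sum>i\<in>UNIV. \<Sum>j\<in>UNIV. \<Sum>k\<in>UNIV. A $ i $ k * B $ k $ j * cnj (C $ i $ j)) =
     (\<Sum>i\<in>UNIV. \<Sum>k\<in>UNIV. \<Sum>j\<in>UNIV. A $ i $ k * B $ k $ j * cnj (C $ i $ j))"
    by (intro sum.cong refl sum.swap)
  also have "\<dots> = (\<Sum>k\<in>UNIV. \<Sum>i\<in>UNIV. \<Sum>j\<in>UNIV. A $ i $ k * B $ k $ j * cnj (C $ i $ j))"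
    by (rule sum.swap)
  also have "\<dots> = (\<Sum>k\<in>UNIV. \<Sum>j\<in>UNIV. \<Sum>i\<in>UNIV. A $ i $ k * B $ k $ j * cnj (C $ i $ j))"
    by (intro sum.cong refl sum.swap)
  also have "Re \<dots> = B \<bullet> (adj A ** C)"
    by (simp add: inner_vec_def i matrix_matrix_mult_def sum_distrib_left mult_ac)
  finally show ?thesis .
qed

lemma norm_matrix_sq: "(norm A)\<^sup>2 = (\<Sum>i\<in>UNIV. \<Sum>j\<in>UNIV. (cmod (A $ i $ j))\<^sup>2)" for A :: "complex^'d^'d"
  by (simp add: power2_norm_eq_inner inner_vec_def)

lemma cmod_entry_le: "cmod (A $ i $ j) \<le> norm A" for A :: "complex^'d^'d"
  by (meson Finite_Cartesian_Product.norm_nth_le order_trans)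

lemma borel_measurable_matrix_iff:
  fixes F :: "'b \<Rightarrow> complex^'d^'d"
  shows "F \<in> borel_measurable M \<longleftrightarrow> (\<forall>i j. (\<lambda>x. F x $ i $ j) \<in> borel_measurable M)"
proof
  assume [measurable]: "F \<in> borel_measurable M"
  show "\<forall>i j. (\<lambda>x. F x $ i $ j) \<in> borel_measurable M"
  proof (intro allI)
    fix i j
    have "continuous_on UNIV (\<lambda>A::complex^'d^'d. A $ i $ j)" by (intro continuous_intros)
    then show "(\<lambda>x. F x $ i $ j) \<in> borel_measurable M"
      by (rule borel_measurable_continuous_on) measurable
  qed
next
  assume *: "\<forall>i j. (\<lambda>x. F x $ i $ j) \<in> borel_measurable M"
  show "F \<in> borel_measurable M"
  proof (rule borel_measurable_euclidean_space[THEN iffD2], rule ballI)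
    fix b :: "complex^'d^'d" assume "b \<in> Basis"
    have "(\<lambda>x. \<Sum>i\<in>UNIV. \<Sum>j\<in>UNIV. F x $ i $ j \<bullet> b $ i $ j) \<in> borel_measurable M"
      using * by (intro borel_measurable_sum borel_measurable_inner) auto
    then show "(\<lambda>x. F x \<bullet> b) \<in> borel_measurable M" by (simp add: inner_vec_def)
  qed
qed

lemma sqint_matrix_iff:
  fixes F :: "real \<Rightarrow> complex^'d^'d"
  shows "sqint F \<longleftrightarrow> (\<forall>i j. sqint (\<lambda>x. F x $ i $ j))"
proof
  assume F: "sqint F"
  show "\<forall>i j. sqint (\<lambda>x. F x $ i $ j)"
  proof (intro allI)
    fix i j
    show "sqint (\<lambda>x. F x $ i $ j)"
    proof (rule sqint_le)
      show "integrable circ (\<lambda>x. (norm (F x))\<^sup>2)" by (rule sqintD(2)[OF F])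
      show "(\<lambda>x. F x $ i $ j) \<in> borel_measurable circ"
        using sqintD(1)[OF F] unfolding borel_measurable_matrix_iff by blast
      show "AE x in circ. (norm (F x $ i $ j))\<^sup>2 \<le> (norm (F x))\<^sup>2"
        by (intro AE_I2 power_mono cmod_entry_le) simp
    qed
  qed
next
  assume *: "\<forall>i j. sqint (\<lambda>x. F x $ i $ j)"
  show "sqint F" unfolding sqint_def norm_matrix_sq borel_measurable_matrix_iff
    using * by (intro conjI allI Bochner_Integration.integrable_sum) (auto simp: sqint_def)
qed

lemma sqint_entry: "sqint F \<Longrightarrow> sqint (\<lambda>x. F x $ i $ j)" for F :: "real \<Rightarrow> complex^'d^'d"
  by (simp add: sqint_matrix_iff)

definition mfc :: "(real \<Rightarrow> complex^'d^'d) \<Rightarrow> int \<Rightarrow> complex^'d^'d" where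
  "mfc F k = (\<chi> i j. fc (\<lambda>x. F x $ i $ j) k)"

lemma mfc_nth [simp]: "mfc F k $ i $ j = fc (\<lambda>x. F x $ i $ j) k"
  by (simp add: mfc_def)

definition mintegrable :: "(real \<Rightarrow> complex^'d^'d) \<Rightarrow> bool" where
  "mintegrable F \<longleftrightarrow> (\<forall>i j. integrable circ (\<lambda>x. F x $ i $ j))"

lemma mintegrable_sqint: "sqint F \<Longrightarrow> mintegrable F"
  by (auto simp: mintegrable_def intro: integrable_sqint sqint_entry)

lemma mintegrable_mult: "sqint F \<Longrightarrow> sqint G \<Longrightarrow> mintegrable (\<lambda>x. F x ** G x)"
  for F G :: "real \<Rightarrow> complex^'d^'d"
  unfolding mintegrable_def matrix_matrix_mult_def vec_lambda_beta
  by (intro allI Bochner_Integration.integrable_sum integrable_times_sqint sqint_entry)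

lemma mfc_add: "mintegrable F \<Longrightarrow> mintegrable G \<Longrightarrow> mfc (\<lambda>x. F x + G x) k = mfc F k + mfc G k"
  by (simp add: vec_eq_iff fc_add mintegrable_def)

lemma mfc_diff: "mintegrable F \<Longrightarrow> mintegrable G \<Longrightarrow> mfc (\<lambda>x. F x - G x) k = mfc F k - mfc G k"
  by (simp add: vec_eq_iff fc_diff mintegrable_def)

lemma mintegrable_add: "mintegrable F \<Longrightarrow> mintegrable G \<Longrightarrow> mintegrable (\<lambda>x. F x + G x)"
  by (simp add: mintegrable_def)

lemma mintegrable_diff: "mintegrable F \<Longrightarrow> mintegrable G \<Longrightarrow> mintegrable (\<lambda>x. F x - G x)"
  by (simp add: mintegrable_def)

lemma mfc_adj: "mfc (\<lambda>x. adj (F x)) k = adj (mfc F (- k))"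
  by (simp add: vec_eq_iff fc_cnj)

lemma sqint_adj: "sqint F \<Longrightarrow> sqint (\<lambda>x. adj (F x))"
  by (simp add: sqint_matrix_iff sqint_cnj)

lemma mfc_cong_AE:
  assumes "mintegrable F" "mintegrable G" "AE x in circ. F x = G x"
  shows "mfc F k = mfc G k"
proof -
  have "fc (\<lambda>x. F x $ i $ j) k = fc (\<lambda>x. G x $ i $ j) k" for i j
    by (rule fc_cong_AE) (use assms in \<open>auto simp: mintegrable_def elim: eventually_mono intro: borel_measurable_integrable\<close>)
  then show ?thesis by (simp add: vec_eq_iff)
qed

lemma has_sum_matrixI:
  fixes f :: "'b \<Rightarrow> complex^'d^'d"
  assumes "\<And>i j. ((\<lambda>x. f x $ i $ j) has_sum S $ i $ j) X"
  shows "(f has_sum S) X"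
  unfolding has_sum_def
proof (intro vec_tendstoI)
  fix i j
  show "((\<lambda>Y. sum f Y $ i $ j) \<longlongrightarrow> S $ i $ j) (finite_subsets_at_top X)"
    using assms[of i j] by (simp add: has_sum_def)
qed

lemma has_sum_finite_sum:
  fixes f :: "'i \<Rightarrow> 'b \<Rightarrow> 'a::topological_comm_monoid_add"
  assumes "\<And>i. i \<in> I \<Longrightarrow> (f i has_sum S i) X"
  shows "((\<lambda>x. \<Sum>i\<in>I. f i x) has_sum (\<Sum>i\<in>I. S i)) X"
  using assms by (induction I rule: infinite_finite_induct) (auto intro!: has_sum_add)

lemma mfc_mult_has_sum:
  assumes F: "sqint F" and G: "sqint G"
  shows "((\<lambda>j. mfc F (k - j) ** mfc G j) has_sum mfc (\<lambda>x. F x ** G x) k) UNIV"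
proof (rule has_sum_matrixI)
  fix a b
  have "((\<lambda>j. \<Sum>c\<in>UNIV. fc (\<lambda>x. F x $ a $ c) (k - j) * fc (\<lambda>x. G x $ c $ b) j) has_sum
     (\<Sum>c\<in>UNIV. fc (\<lambda>x. F x $ a $ c * G x $ c $ b) k)) UNIV"
    by (intro has_sum_finite_sum fc_mult_has_sum sqint_entry F G)
  also have "(\<Sum>c\<in>UNIV. fc (\<lambda>x. F x $ a $ c * G x $ c $ b) k) = mfc (\<lambda>x. F x ** G x) k $ a $ b"
    unfolding mfc_nth matrix_matrix_mult_def vec_lambda_beta
    by (rule fc_sum[symmetric]) (intro integrable_times_sqint sqint_entry F G)
  finally show "((\<lambda>j. (mfc F (k - j) ** mfc G j) $ a $ b) has_sum mfc (\<lambda>x. F x ** G x) k $ a $ b) UNIV"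
    by (simp add: matrix_matrix_mult_def)
qed

lemma mfc_mult_eq_0:
  assumes "sqint F" "sqint G" "\<And>j. mfc F (k - j) = 0 \<or> mfc G j = 0"
  shows "mfc (\<lambda>x. F x ** G x) k = 0"
proof -
  have z: "mfc F (k - j) ** mfc G j = 0" for j using assms(3)[of j] by auto
  have "((\<lambda>j::int. 0) has_sum mfc (\<lambda>x. F x ** G x) k) UNIV"
    using mfc_mult_has_sum[OF assms(1,2), of k] unfolding z .
  moreover have "((\<lambda>j::int. 0) has_sum (0 :: complex^'a^'a)) UNIV" by (rule has_sum_0) simp
  ultimately show ?thesis by (rule has_sum_unique)
qed

lemma mfc_mult_sums:
  assumes F: "sqint F" and G: "sqint G" and "inj \<phi>" "\<And>j. j \<notin> range \<phi> \<Longrightarrow> mfc G j = 0"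
  shows "(\<lambda>l. mfc F (k - \<phi> l) ** mfc G (\<phi> l)) sums mfc (\<lambda>x. F x ** G x) k"
  by (rule has_sum_imp_sums_range[OF mfc_mult_has_sum[OF F G] assms(3)]) (simp add: assms(4))

definition ip :: "(real \<Rightarrow> complex^'d^'d) \<Rightarrow> (real \<Rightarrow> complex^'d^'d) \<Rightarrow> real" where
  "ip F G = (LINT x|circ. F x \<bullet> G x)"

lemma ip_integrable:
  fixes F G :: "real \<Rightarrow> complex^'d^'d"
  assumes "sqint F" "sqint G" shows "integrable circ (\<lambda>x. F x \<bullet> G x)"
proof (rule Bochner_Integration.integrable_bound[OF integrable_mult_sqint[OF assms]])
  show "(\<lambda>x. F x \<bullet> G x) \<in> borel_measurable circ"
    using sqintD(1)[OF assms(1)] sqintD(1)[OF assms(2)] by measurable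
  show "AE x in circ. norm (F x \<bullet> G x) \<le> norm (norm (F x) * norm (G x))"
    by (intro AE_I2) (simp add: Cauchy_Schwarz_ineq2)
qed

lemma ip_add_left: "sqint F \<Longrightarrow> sqint G \<Longrightarrow> sqint K \<Longrightarrow> ip (\<lambda>x. F x + G x) K = ip F K + ip G K"
  by (simp add: ip_def inner_add_left ip_integrable)

lemma ip_diff_left: "sqint F \<Longrightarrow> sqint G \<Longrightarrow> sqint K \<Longrightarrow> ip (\<lambda>x. F x - G x) K = ip F K - ip G K"
  by (simp add: ip_def inner_diff_left ip_integrable)

lemma ip_commute: "ip F G = ip G F"
  by (simp add: ip_def inner_commute)

lemma ip_nonneg: "0 \<le> ip F F"
  by (simp add: ip_def)

lemma ip_norm: "ip F F = (LINT x|circ. (norm (F x))\<^sup>2)"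
  by (simp add: ip_def power2_norm_eq_inner)

lemma ip_Parseval:
  assumes F: "sqint F" and G: "sqint G"
  shows "((\<lambda>k. mfc F k \<bullet> mfc G k) has_sum ip F G) UNIV"
proof -
  have "((\<lambda>k. \<Sum>i\<in>UNIV. \<Sum>j\<in>UNIV. Re (fc (\<lambda>x. F x $ i $ j) k * cnj (fc (\<lambda>x. G x $ i $ j) k))) has_sum
     (\<Sum>i\<in>UNIV. \<Sum>j\<in>UNIV. Re (LINT x|circ. F x $ i $ j * cnj (G x $ i $ j)))) UNIV"
    by (intro has_sum_finite_sum has_sum_Re Parseval sqint_entry F G)
  moreover have "(\<Sum>i\<in>UNIV. \<Sum>j\<in>UNIV. Re (LINT x|circ. F x $ i $ j * cnj (G x $ i $ j))) = ip F G"
  proof -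
    have ii: "integrable circ (\<lambda>x. F x $ i $ j * cnj (G x $ i $ j))" for i j
      by (intro integrable_times_sqint sqint_cnj sqint_entry F G)
    have "ip F G = (LINT x|circ. (\<Sum>i\<in>UNIV. \<Sum>j\<in>UNIV. Re (F x $ i $ j * cnj (G x $ i $ j))))"
      unfolding ip_def inner_vec_def by (simp add: inner_complex_def)
    also have "\<dots> = (\<Sum>i\<in>UNIV. \<Sum>j\<in>UNIV. LINT x|circ. Re (F x $ i $ j * cnj (G x $ i $ j)))"
      by (simp only: Bochner_Integration.integral_sum Bochner_Integration.integrable_sum integrable_Re ii)
    finally show ?thesis by (simp only: integral_Re ii)
  qed
  moreover have "(\<Sum>i\<in>UNIV. \<Sum>j\<in>UNIV. Re (fc (\<lambda>x. F x $ i $ j) k * cnj (fc (\<lambda>x. G x $ i $ j) k))) = mfc F k \<bullet> mfc G k" for k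
    by (simp add: inner_vec_def inner_complex_def)
  ultimately show ?thesis by (simp only:)
qed

text \<open>\<open>proj X F\<close> keeps the frequencies of \<open>F\<close> in \<open>X\<close>.  It is one of the functions with these Fourier
  coefficients, which agree almost everywhere.\<close>

definition proj :: "int set \<Rightarrow> (real \<Rightarrow> complex^'d^'d) \<Rightarrow> real \<Rightarrow> complex^'d^'d" where
  "proj X F = (SOME G. sqint G \<and> (\<forall>k. mfc G k = (if k \<in> X then mfc F k else 0)))"

lemma proj:
  assumes "sqint F"
  shows "sqint (proj X F)" "mfc (proj X F) k = (if k \<in> X then mfc F k else 0)"
proof -
  have "\<exists>g. sqint g \<and> (\<forall>k. fc g k = (if k \<in> X then fc (\<lambda>x. F x $ i $ j) k else 0))" for i j
  proof -
    have "(\<lambda>k. (cmod (if k \<in> X then fc (\<lambda>x. F x $ i $ j) k else 0))\<^sup>2) summable_on UNIV"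
      by (rule summable_on_comparison_test[OF sqint_fc_summable[OF sqint_entry[OF assms, of i j]]]) auto
    then obtain g where "sqint g" "\<And>k. fc g k = (if k \<in> X then fc (\<lambda>x. F x $ i $ j) k else 0)"
      by (rule Riesz_Fischer) blast
    then show ?thesis by blast
  qed
  then obtain g where g: "\<And>i j. sqint (g i j)" "\<And>i j k. fc (g i j) k = (if k \<in> X then fc (\<lambda>x. F x $ i $ j) k else 0)"
    by metis
  have "\<exists>G. sqint G \<and> (\<forall>k. mfc G k = (if k \<in> X then mfc F k else 0))"
    by (rule exI[of _ "\<lambda>x. \<chi> i j. g i j x"]) (auto simp: sqint_matrix_iff g vec_eq_iff)
  then have "sqint (proj X F) \<and> (\<forall>k. mfc (proj X F) k = (if k \<in> X then mfc F k else 0))"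
    unfolding proj_def by (rule someI_ex)
  then show "sqint (proj X F)" "mfc (proj X F) k = (if k \<in> X then mfc F k else 0)" by auto
qed

lemma ip_proj:
  assumes "sqint F" "sqint G"
  shows "ip (proj X F) G = ip (proj X F) (proj X G)"
proof -
  have "mfc (proj X F) k \<bullet> mfc G k = mfc (proj X F) k \<bullet> mfc (proj X G) k" for k
    using assms by (simp add: proj)
  then show ?thesis
    using ip_Parseval[OF proj(1)[OF assms(1)] assms(2), of X] ip_Parseval[OF proj(1)[OF assms(1)] proj(1)[OF assms(2)], of X X]
    by (metis (no_types, lifting) has_sum_cong has_sum_unique)
qed

lemma ip_eq_0:
  assumes "sqint F" "sqint G" "\<And>k. mfc F k = 0 \<or> mfc G k = 0"
  shows "ip F G = 0"
proof -
  have z: "mfc F k \<bullet> mfc G k = 0" for k using assms(3)[of k] by auto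
  have "((\<lambda>k::int. 0) has_sum ip F G) UNIV" using ip_Parseval[OF assms(1,2)] unfolding z .
  then show ?thesis using has_sum_unique[OF _ has_sum_0] by blast
qed

section \<open>Alternating projections and the inverse of a Toeplitz matrix\<close>

definition emat :: "int \<Rightarrow> real \<Rightarrow> complex^'d^'d" where
  "emat u x = (\<chi> i j. if i = j then cis (of_int u * x) else 0)"

lemma sqint_emat: "sqint (emat u)"
proof -
  have "sqint (\<lambda>x. if i = j then cis (of_int u * x) else 0)" for i j :: 'a by (cases "i = j") auto
  then show ?thesis by (simp add: sqint_matrix_iff emat_def)
qed

lemma mfc_emat: "mfc (emat u) k = (if k = u then mat 1 else 0)"
proof -
  have "fc (\<lambda>x. if i = j then cis (of_int u * x) else 0) k = (if k = u then mat 1 else 0) $ i $ j" for i j :: 'a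
    by (cases "i = j") (auto simp: fc_cis mat_def)
  then show ?thesis by (simp add: vec_eq_iff emat_def)
qed

lemma mfc_mult_emat: "mfc (\<lambda>x. F x ** emat u x) k = mfc F (k - u)"
proof -
  have "(F x ** emat u x) $ i $ j = cis (of_int u * x) * F x $ i $ j" for x i j
    by (simp add: emat_def matrix_matrix_mult_def if_distrib mult.commute cong: if_cong)
  then show ?thesis by (simp add: vec_eq_iff fc_shift)
qed

lemma mfc_mult_tendsto:
  fixes f :: "nat \<Rightarrow> real \<Rightarrow> complex^'d^'d"
  assumes f: "\<And>n. sqint (f n)" and g: "sqint g" and Q: "sqint Q"
    and lim: "(\<lambda>n. LINT x|circ. (norm (f n x - g x))\<^sup>2) \<longlonglongrightarrow> 0"
  shows "(\<lambda>n. mfc (\<lambda>x. Q x ** f n x) k) \<longlonglongrightarrow> mfc (\<lambda>x. Q x ** g x) k"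
proof (intro vec_tendstoI)
  fix a b
  have e: "(\<lambda>n. LINT x|circ. (cmod (f n x $ c $ b - g x $ c $ b))\<^sup>2) \<longlonglongrightarrow> 0" for c
  proof (rule tendsto_sandwich[OF _ _ tendsto_const lim])
    have sd: "sqint (\<lambda>x. f n x - g x)" for n by (intro sqint_diff f g)
    have "(LINT x|circ. (cmod (f n x $ c $ b - g x $ c $ b))\<^sup>2) \<le> (LINT x|circ. (norm (f n x - g x))\<^sup>2)" for n
    proof (rule integral_mono)
      show "integrable circ (\<lambda>x. (cmod (f n x $ c $ b - g x $ c $ b))\<^sup>2)"
        using sqintD(2)[OF sqint_entry[OF sd]] by simp
      show "(cmod (f n x $ c $ b - g x $ c $ b))\<^sup>2 \<le> (norm (f n x - g x))\<^sup>2" for x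
        using power_mono[OF cmod_entry_le[of "f n x - g x" c b], of 2] by simp
    qed (rule sqintD(2)[OF sd])
    then show "\<forall>\<^sub>F n in sequentially. (LINT x|circ. (cmod (f n x $ c $ b - g x $ c $ b))\<^sup>2) \<le> (LINT x|circ. (norm (f n x - g x))\<^sup>2)"
      by simp
  qed simp
  have eq: "mfc (\<lambda>x. Q x ** F x) k $ a $ b = (\<Sum>c\<in>UNIV. fc (\<lambda>x. Q x $ a $ c * F x $ c $ b) k)" if "sqint F" for F
    unfolding mfc_nth matrix_matrix_mult_def vec_lambda_beta
    by (rule fc_sum) (intro integrable_times_sqint sqint_entry that Q)
  have "(\<lambda>n. \<Sum>c\<in>UNIV. fc (\<lambda>x. Q x $ a $ c * f n x $ c $ b) k) \<longlonglongrightarrow> (\<Sum>c\<in>UNIV. fc (\<lambda>x. Q x $ a $ c * g x $ c $ b) k)"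
    by (intro tendsto_sum fc_mult_tendsto sqint_entry f g Q e)
  then show "(\<lambda>n. mfc (\<lambda>x. Q x ** f n x) k $ a $ b) \<longlonglongrightarrow> mfc (\<lambda>x. Q x ** g x) k $ a $ b"
    by (simp only: eq f g)
qed

lemma mfc_sq_le:
  assumes "sqint F" shows "(norm (mfc F k))\<^sup>2 \<le> ip F F"
proof -
  have "(norm (mfc F k))\<^sup>2 = (\<Sum>i\<in>UNIV. \<Sum>j\<in>UNIV. (cmod (fc (\<lambda>x. F x $ i $ j) k))\<^sup>2)"
    by (simp add: norm_matrix_sq)
  also have "\<dots> \<le> (\<Sum>i\<in>UNIV. \<Sum>j\<in>UNIV. LINT x|circ. (cmod (F x $ i $ j))\<^sup>2)"
    by (intro sum_mono) (use Bessel_ineq[OF sqint_entry[OF assms], of "{k}"] in simp)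
  also have "\<dots> = ip F F"
    unfolding ip_norm norm_matrix_sq using sqintD(2)[OF sqint_entry[OF assms]]
    by (simp add: Bochner_Integration.integral_sum Bochner_Integration.integrable_sum)
  finally show ?thesis .
qed

lemma AE_eq_trig_polynomial:
  assumes F: "mintegrable F" and "finite K" and supp: "\<And>k. k \<notin> K \<Longrightarrow> mfc F k = 0"
  shows "AE x in circ. F x = (\<Sum>k\<in>K. mfc F k ** emat k x)"
proof -
  have "AE x in circ. F x $ i $ j = (\<Sum>k\<in>K. mfc F k $ i $ j * cis (of_int k * x))" for i j
  proof -
    have i: "integrable circ (\<lambda>x. F x $ i $ j)" using F by (simp add: mintegrable_def)
    have t: "integrable circ (\<lambda>x. \<Sum>k\<in>K. mfc F k $ i $ j * cis (of_int k * x))"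
      by (rule integrable_sqint[OF sqint_trig_sum])
    have "AE x in circ. F x $ i $ j - (\<Sum>k\<in>K. mfc F k $ i $ j * cis (of_int k * x)) = 0"
    proof (rule fc_eq_0_imp_AE_0)
      fix k
      have "k \<notin> K \<Longrightarrow> fc (\<lambda>x. F x $ i $ j) k = 0"
        using supp[of k] by (simp add: vec_eq_iff)
      then show "fc (\<lambda>x. F x $ i $ j - (\<Sum>k\<in>K. mfc F k $ i $ j * cis (of_int k * x))) k = 0"
        unfolding fc_diff[OF i t] fc_trig_sum[OF assms(2)] by simp
    qed (use i t in simp)
    then show ?thesis by eventually_elim simp
  qed
  then have "AE x in circ. \<forall>i j. F x $ i $ j = (\<Sum>k\<in>K. mfc F k $ i $ j * cis (of_int k * x))"
    by (simp add: AE_all_countable)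
  then show ?thesis
  proof eventually_elim
    case (elim x)
    have "(mfc F k ** emat k x) $ i $ j = mfc F k $ i $ j * cis (of_int k * x)" for k i j
      by (simp add: emat_def matrix_matrix_mult_def if_distrib cong: if_cong)
    then show ?case using elim by (simp add: vec_eq_iff)
  qed
qed

lemma unitary_inner:
  fixes U A B :: "complex^'d^'d"
  assumes "adj U ** U = mat 1" shows "(U ** A) \<bullet> (U ** B) = A \<bullet> B"
  unfolding inner_matrix_mult_left matrix_mul_assoc assms by simp

lemma unitary_norm:
  fixes U A :: "complex^'d^'d"
  assumes "adj U ** U = mat 1" shows "norm (U ** A) = norm A"
  by (simp add: norm_eq_sqrt_inner unitary_inner[OF assms])

lemma measurable_matrix_mult:
  fixes F G :: "'b \<Rightarrow> complex^'d^'d"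
  assumes "F \<in> borel_measurable M" "G \<in> borel_measurable M"
  shows "(\<lambda>x. F x ** G x) \<in> borel_measurable M"
  using assms unfolding borel_measurable_matrix_iff matrix_matrix_mult_def vec_lambda_beta
  by (intro allI borel_measurable_sum borel_measurable_times) auto

lemma sqint_unitary_mult:
  fixes U F :: "real \<Rightarrow> complex^'d^'d"
  assumes "U \<in> borel_measurable circ" "\<And>x. adj (U x) ** U x = mat 1" "sqint F"
  shows "sqint (\<lambda>x. U x ** F x)"
  using assms by (auto simp: sqint_def unitary_norm intro!: measurable_matrix_mult)

lemma measurable_adj:
  fixes F :: "'b \<Rightarrow> complex^'d^'d"
  shows "F \<in> borel_measurable M \<Longrightarrow> (\<lambda>x. adj (F x)) \<in> borel_measurable M"
  by (auto simp: borel_measurable_matrix_iff intro: borel_measurable_cnj')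

text \<open>
  The locale describes the symbol \<open>w = G\<^sup>* G = H H\<^sup>*\<close>.  It covers two situations: \<open>G\<close>, \<open>H\<close> analytic,
  \<open>A = {0..}\<close>, \<open>I = {..0}\<close>, \<open>J = {n + 1..}\<close>, and \<open>G\<close>, \<open>H\<close> antianalytic, \<open>A = {..0}\<close>, \<open>I = {n + 1..}\<close>,
  \<open>J = {..0}\<close>.  The assumptions \<open>shift\<close> express that multiplication by \<open>G\<^sup>*\<close> preserves \<open>I\<close> and
  multiplication by \<open>H\<close> preserves \<open>J\<close>.  That \<open>V\<close> is unitary everywhere, and not only almost everywhere,
  can be achieved by changing it on a null set.
\<close>

locale factored_symbol =
  fixes G Gi H Hi V :: "real \<Rightarrow> complex^'d^'d" and A I J N :: "int set"
  assumes sq: "sqint G" "sqint Gi" "sqint H" "sqint Hi"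
    and V_meas: "V \<in> borel_measurable circ"
    and V_unitary: "\<And>x. adj (V x) ** V x = mat 1" "\<And>x. V x ** adj (V x) = mat 1"
    and V_eq: "AE x in circ. V x = adj (H x) ** Gi x" "AE x in circ. V x = Hi x ** adj (G x)"
    and inv: "AE x in circ. G x ** Gi x = mat 1" "AE x in circ. Gi x ** G x = mat 1"
      "AE x in circ. H x ** Hi x = mat 1"
    and supp: "\<And>k. k \<notin> A \<Longrightarrow> mfc G k = 0" "\<And>k. k \<notin> A \<Longrightarrow> mfc Gi k = 0"
      "\<And>k. k \<notin> A \<Longrightarrow> mfc H k = 0" "\<And>k. k \<notin> A \<Longrightarrow> mfc Hi k = 0"
    and shift: "\<And>i a. i \<in> I \<Longrightarrow> a \<in> A \<Longrightarrow> i - a \<in> I" "\<And>j a. j \<in> J \<Longrightarrow> a \<in> A \<Longrightarrow> j + a \<in> J"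
    and finN: "finite N" and N_iff: "\<And>k. k \<in> N \<longleftrightarrow> k \<notin> I \<and> k \<notin> J"
    and disj: "\<And>k. k \<in> I \<Longrightarrow> k \<notin> J"
begin

lemma sqint_V_mult: "sqint F \<Longrightarrow> sqint (\<lambda>x. V x ** F x)" for F :: "real \<Rightarrow> complex^'d^'d"
  by (rule sqint_unitary_mult[OF V_meas V_unitary(1)])

lemma sqint_adj_V_mult: "sqint F \<Longrightarrow> sqint (\<lambda>x. adj (V x) ** F x)" for F :: "real \<Rightarrow> complex^'d^'d"
  by (rule sqint_unitary_mult[OF measurable_adj[OF V_meas]]) (simp_all add: V_unitary)

lemmas sqV = sqint_V_mult sqint_adj_V_mult

lemma sqint_V: "sqint V"
proof -
  have "sqint (\<lambda>x. mat 1 :: complex^'d^'d)" by (rule sqint_bounded[OF _ order_refl]) simp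
  from sqV(1)[OF this] show ?thesis by simp
qed

lemma ip_V: "ip (\<lambda>x. adj (V x) ** F x) K = ip F (\<lambda>x. V x ** K x)"
  by (simp add: ip_def inner_matrix_mult_left)

text \<open>The map \<open>F \<mapsto> F - V\<^sup>* (mpart F)\<close> is the projection to the functions \<open>x\<close> such that \<open>V x\<close> has no
  frequencies in \<open>J\<close>.  If \<open>F\<close> has no frequencies in \<open>I\<close>, adding \<open>npart F\<close> removes those which this
  projection has created.\<close>

definition mpart :: "(real \<Rightarrow> complex^'d^'d) \<Rightarrow> real \<Rightarrow> complex^'d^'d" where
  "mpart F = proj J (\<lambda>x. V x ** F x)"

definition npart :: "(real \<Rightarrow> complex^'d^'d) \<Rightarrow> real \<Rightarrow> complex^'d^'d" where
  "npart F = proj I (\<lambda>x. adj (V x) ** mpart F x)"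

primrec v :: "int \<Rightarrow> nat \<Rightarrow> real \<Rightarrow> complex^'d^'d" where
  "v u 0 = emat u"
| "v u (Suc k) = (\<lambda>x. v u k x - adj (V x) ** mpart (v u k) x + npart (v u k) x)"

lemma sq_mpart: "sqint F \<Longrightarrow> sqint (mpart F)"
  unfolding mpart_def by (intro proj sqV)

lemma mfc_mpart: "sqint F \<Longrightarrow> mfc (mpart F) k = (if k \<in> J then mfc (\<lambda>x. V x ** F x) k else 0)"
  unfolding mpart_def by (intro proj sqV)

lemma sq_npart: "sqint F \<Longrightarrow> sqint (npart F)"
  unfolding npart_def by (intro proj sqV sq_mpart)

lemma mfc_npart: "sqint F \<Longrightarrow> mfc (npart F) k = (if k \<in> I then mfc (\<lambda>x. adj (V x) ** mpart F x) k else 0)"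
  unfolding npart_def by (intro proj sqV sq_mpart)

lemma sq_v: "sqint (v u k)"
  by (induction k) (auto intro!: sqint_add sqint_diff sqint_emat sq_mpart sq_npart sqV)

lemmas sq_m = sq_mpart[OF sq_v] and sq_n = sq_npart[OF sq_v]
lemmas mfc_m = mfc_mpart[OF sq_v] and mfc_n = mfc_npart[OF sq_v]

lemma mfc_v_Suc: "mfc (v u (Suc k)) j = mfc (v u k) j - mfc (\<lambda>x. adj (V x) ** mpart (v u k) x) j + mfc (npart (v u k)) j"
  by (simp add: mfc_add mfc_diff mintegrable_diff mintegrable_sqint sq_v sq_n sqV sq_m)

lemma supp_v: "u \<notin> I \<Longrightarrow> i \<in> I \<Longrightarrow> mfc (v u k) i = 0"
proof (induction k)
  case 0 then show ?case by (auto simp: mfc_emat)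
next
  case (Suc k) then show ?case unfolding mfc_v_Suc by (simp add: mfc_n)
qed

subsection \<open>Convergence of the alternating projections\<close>

context
  fixes u assumes u: "u \<in> N"
begin

lemma uI: "u \<notin> I" using u N_iff by simp

lemma ip_n_v: "ip (npart (v u i)) (v u j) = 0"
  by (rule ip_eq_0[OF sq_n sq_v]) (use supp_v[OF uI] in \<open>auto simp: mfc_n\<close>)

lemma ip_Vm_v: "ip (\<lambda>x. adj (V x) ** mpart (v u i) x) (v u j) = ip (mpart (v u i)) (mpart (v u j))"
  unfolding ip_V by (subst (1 2 3) mpart_def, rule ip_proj) (intro sqV sq_v)+

lemma ip_Suc_left: "ip (v u (Suc i)) (v u j) = ip (v u i) (v u j) - ip (mpart (v u i)) (mpart (v u j))"
  by (simp add: ip_add_left ip_diff_left sqint_diff sq_v sqV sq_m sq_n ip_n_v ip_Vm_v)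

text \<open>The operator that maps \<open>v k\<close> to \<open>v (k + 1)\<close> is self-adjoint on the functions without frequencies
  in \<open>I\<close>, so the inner products of the iterates depend only on the sum of the indices.  It has the form
  \<open>P R P\<close> with projections \<open>P\<close> and \<open>R\<close>, so these inner products decrease with the sum; hence they
  converge, and the iterates form a Cauchy sequence.\<close>

definition gram where "gram n = ip (v u n) (v u 0)"

lemma ip_v: "ip (v u i) (v u j) = gram (i + j)"
proof (induction j arbitrary: i)
  case (Suc j)
  have "ip (v u i) (v u (Suc j)) = ip (v u (Suc j)) (v u i)" by (rule ip_commute)
  also have "\<dots> = ip (v u (Suc i)) (v u j)" unfolding ip_Suc_left by (simp add: ip_commute)
  also have "\<dots> = gram (Suc i + j)" by (rule Suc)
  finally show ?case by simp
qed (simp add: gram_def)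

lemma gram_odd: "gram (Suc (2 * k)) = gram (2 * k) - ip (mpart (v u k)) (mpart (v u k))"
  using ip_Suc_left[of k k] ip_v[of "Suc k" k] ip_v[of k k] by (simp add: mult_2)

lemma gram_even: "gram (Suc (Suc (2 * k))) = gram (Suc (2 * k)) - ip (npart (v u k)) (npart (v u k))"
proof -
  let ?Vm = "\<lambda>x. adj (V x) ** mpart (v u k) x" and ?n = "npart (v u k)"
  have n_Vm: "ip ?Vm ?n = ip ?n ?n"
  proof -
    have "ip ?n ?Vm = ip ?n ?n"
      unfolding npart_def by (rule ip_proj) (intro sqV sq_m)+
    then show ?thesis by (simp add: ip_commute)
  qed
  have "gram (Suc (Suc (2 * k))) = ip (v u (Suc k)) (v u (Suc k))"
    by (simp only: ip_v) (simp add: mult_2)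
  also have "\<dots> = ip (v u k) (v u (Suc k)) - ip ?Vm (v u (Suc k)) + ip ?n (v u (Suc k))"
    by (subst v.simps(2), subst ip_add_left, (intro sqint_diff sq_v sqV sq_m sq_n)+,
        subst ip_diff_left, (intro sqint_diff sq_v sqV sq_m sq_n)+, rule refl)
  also have "ip ?n (v u (Suc k)) = 0" by (rule ip_n_v)
  also have "ip (v u k) (v u (Suc k)) = gram (Suc (2 * k))" by (simp only: ip_v) (simp add: mult_2)
  also have "ip ?Vm (v u (Suc k)) = ip ?n ?n"
  proof -
    have "ip ?Vm (v u (Suc k)) = ip (v u (Suc k)) ?Vm" by (rule ip_commute)
    also have "\<dots> = ip (v u k) ?Vm - ip ?Vm ?Vm + ip ?n ?Vm"
      by (subst v.simps(2), subst ip_add_left, (intro sqint_diff sq_v sqV sq_m sq_n)+,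
          subst ip_diff_left, (intro sqint_diff sq_v sqV sq_m sq_n)+, rule refl)
    also have "ip (v u k) ?Vm = ip (mpart (v u k)) (mpart (v u k))" unfolding ip_Vm_v[symmetric] by (rule ip_commute)
    also have "ip ?Vm ?Vm = ip (mpart (v u k)) (mpart (v u k))"
      unfolding ip_V by (simp add: matrix_mul_assoc V_unitary)
    also have "ip ?n ?Vm = ip ?n ?n" using n_Vm by (simp add: ip_commute)
    finally show ?thesis by simp
  qed
  finally show ?thesis by simp
qed

lemma gram_decseq: "decseq gram"
proof (rule decseq_SucI)
  fix n
  show "gram (Suc n) \<le> gram n"
  proof (cases "even n")
    case True
    then obtain k where "n = 2 * k" by (rule evenE)
    then show ?thesis using gram_odd[of k] ip_nonneg[of "mpart (v u k)"] by simp
  next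
    case False
    then obtain k where "n = Suc (2 * k)" by (metis oddE Suc_eq_plus1)
    then show ?thesis using gram_even[of k] ip_nonneg[of "npart (v u k)"] by simp
  qed
qed

lemma gram_nonneg: "0 \<le> gram n"
proof -
  have "0 \<le> ip (v u n) (v u n)" by (rule ip_nonneg)
  also have "\<dots> \<le> gram n" unfolding ip_v using gram_decseq by (auto simp: decseq_def)
  finally show ?thesis .
qed

lemma gram_convergent: "\<exists>l. gram \<longlonglongrightarrow> l"
  using decseq_convergent[OF gram_decseq, of 0] gram_nonneg by blast

lemma m_norm_tendsto: "(\<lambda>k. ip (mpart (v u k)) (mpart (v u k))) \<longlonglongrightarrow> 0"
proof -
  obtain l where l: "gram \<longlonglongrightarrow> l" using gram_convergent by blast
  have "(\<lambda>k. gram (2 * k) - gram (Suc (2 * k))) \<longlonglongrightarrow> l - l"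
    by (intro tendsto_diff LIMSEQ_subseq_LIMSEQ[OF l, unfolded o_def]) (auto simp: strict_mono_def)
  then show ?thesis by (simp add: gram_odd)
qed

lemma limit_exists:
  "\<exists>z. sqint z \<and> (\<lambda>n. LINT x|circ. (norm (v u n x - z x))\<^sup>2) \<longlonglongrightarrow> 0"
proof -
  obtain l where l: "gram \<longlonglongrightarrow> l" using gram_convergent by blast
  have d: "(LINT x|circ. (norm (v u m x - v u n x))\<^sup>2) = gram (2 * m) - 2 * gram (m + n) + gram (2 * n)" for m n
  proof -
    have sd: "sqint (\<lambda>x. v u m x - v u n x)" by (intro sqint_diff sq_v)
    have e: "ip (v u k) (\<lambda>x. v u m x - v u n x) = gram (k + m) - gram (k + n)" for k
      by (subst ip_commute) (simp add: ip_diff_left sq_v ip_v add.commute)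
    have "(LINT x|circ. (norm (v u m x - v u n x))\<^sup>2) = ip (\<lambda>x. v u m x - v u n x) (\<lambda>x. v u m x - v u n x)"
      by (rule ip_norm[symmetric])
    also have "\<dots> = ip (v u m) (\<lambda>x. v u m x - v u n x) - ip (v u n) (\<lambda>x. v u m x - v u n x)"
      by (intro ip_diff_left sq_v sd)
    finally have "(LINT x|circ. (norm (v u m x - v u n x))\<^sup>2) =
        gram (m + m) - gram (m + n) - (gram (n + m) - gram (n + n))" unfolding e .
    then show ?thesis unfolding mult_2[of m] mult_2[of n] add.commute[of n m] by linarith
  qed
  obtain z where "sqint z" "(\<lambda>n. LINT x|circ. (norm (v u n x - z x))\<^sup>2) \<longlonglongrightarrow> 0"
  proof (rule sqint_complete[OF sq_v])
    fix e :: real assume "e > 0"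
    then have "e / 4 > 0" by simp
    from LIMSEQ_D[OF l this] obtain K where "\<forall>n\<ge>K. norm (gram n - l) < e / 4" ..
    then have K: "\<bar>gram n - l\<bar> < e / 4" if "n \<ge> K" for n using that by simp
    have "(LINT x|circ. (norm (v u m x - v u n x))\<^sup>2) < e" if "m \<ge> K" "n \<ge> K" for m n
    proof -
      have "\<bar>gram (2 * m) - l\<bar> < e / 4" "\<bar>gram (m + n) - l\<bar> < e / 4" "\<bar>gram (2 * n) - l\<bar> < e / 4"
        by (rule K; use that in linarith)+
      then show ?thesis unfolding d by linarith
    qed
    then show "\<exists>N. \<forall>m\<ge>N. \<forall>n\<ge>N. (LINT x|circ. (norm (v u m x - v u n x))\<^sup>2) < e" by blast
  qed blast
  then show ?thesis by blast
qed

definition z where "z = (SOME z. sqint z \<and> (\<lambda>n. LINT x|circ. (norm (v u n x - z x))\<^sup>2) \<longlonglongrightarrow> 0)"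

lemma z: "sqint z" "(\<lambda>n. LINT x|circ. (norm (v u n x - z x))\<^sup>2) \<longlonglongrightarrow> 0"
  using someI_ex[OF limit_exists] by (auto simp: z_def)

lemma mfc_v_tendsto: "sqint Q \<Longrightarrow> (\<lambda>n. mfc (\<lambda>x. Q x ** v u n x) k) \<longlonglongrightarrow> mfc (\<lambda>x. Q x ** z x) k"
  by (rule mfc_mult_tendsto[OF sq_v z(1) _ z(2)])

lemma z_supp: "i \<in> I \<Longrightarrow> mfc z i = 0"
proof -
  assume i: "i \<in> I"
  have "sqint (\<lambda>x. mat 1 :: complex^'d^'d)" by (rule sqint_bounded[OF _ order_refl]) simp
  from mfc_v_tendsto[OF this, of i] have "(\<lambda>n. 0) \<longlonglongrightarrow> mfc z i" by (simp add: supp_v[OF uI i])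
  then show ?thesis by (simp add: LIMSEQ_const_iff)
qed

lemma Vz_supp: "j \<in> J \<Longrightarrow> mfc (\<lambda>x. V x ** z x) j = 0"
proof -
  assume j: "j \<in> J"
  have "(\<lambda>n. norm (mfc (\<lambda>x. V x ** v u n x) j)) \<longlonglongrightarrow> 0"
  proof (rule tendsto_sandwich[OF _ _ tendsto_const])
    have "norm (mfc (\<lambda>x. V x ** v u n x) j) \<le> sqrt (ip (mpart (v u n)) (mpart (v u n)))" for n
      using mfc_sq_le[OF sq_m, of u n j] j by (intro real_le_rsqrt) (simp add: mfc_m)
    then show "\<forall>\<^sub>F n in sequentially. norm (mfc (\<lambda>x. V x ** v u n x) j) \<le> sqrt (ip (mpart (v u n)) (mpart (v u n)))" by simp
    show "(\<lambda>n. sqrt (ip (mpart (v u n)) (mpart (v u n)))) \<longlonglongrightarrow> 0"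
      using tendsto_real_sqrt[OF m_norm_tendsto] by simp
  qed simp
  then have "(\<lambda>n. mfc (\<lambda>x. V x ** v u n x) j) \<longlonglongrightarrow> 0" by (rule tendsto_norm_zero_cancel)
  with mfc_v_tendsto[OF sqint_V, of j] show ?thesis by (rule LIMSEQ_unique)
qed
end

subsection \<open>The limit is the solution of the Toeplitz system\<close>

lemma sq_adj: "sqint (\<lambda>x. adj (G x))" "sqint (\<lambda>x. adj (Hi x))"
  by (intro sqint_adj sq)+

lemma supp_adj_G: assumes F: "sqint F" "\<And>k. k \<notin> I \<Longrightarrow> mfc F k = 0" "s \<notin> I"
  shows "mfc (\<lambda>x. adj (G x) ** F x) s = 0"
proof (rule mfc_mult_eq_0[OF sq_adj(1) F(1)])
  fix j
  show "mfc (\<lambda>x. adj (G x)) (s - j) = 0 \<or> mfc F j = 0"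
  proof (rule ccontr)
    assume *: "\<not> (mfc (\<lambda>x. adj (G x)) (s - j) = 0 \<or> mfc F j = 0)"
    then have "mfc G (j - s) \<noteq> 0" unfolding mfc_adj by auto
    then have "j - s \<in> A" "j \<in> I" using supp F(2) * by blast+
    then have "j - (j - s) \<in> I" by (intro shift)
    then show False using F(3) by simp
  qed
qed

lemma supp_H: assumes F: "sqint F" "\<And>k. k \<notin> J \<Longrightarrow> mfc F k = 0" "s \<notin> J"
  shows "mfc (\<lambda>x. H x ** F x) s = 0"
proof (rule mfc_mult_eq_0[OF sq(3) F(1)])
  fix j
  show "mfc H (s - j) = 0 \<or> mfc F j = 0"
  proof (rule ccontr)
    assume *: "\<not> (mfc H (s - j) = 0 \<or> mfc F j = 0)"
    then have "s - j \<in> A" "j \<in> J" using supp F(2) by blast+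
    then have "j + (s - j) \<in> J" by (intro shift)
    then show False using F(3) by simp
  qed
qed

lemma supp_Gi: assumes F: "sqint F" "\<And>k. k \<in> I \<Longrightarrow> mfc F k = 0" "s \<in> I"
  shows "mfc (\<lambda>x. Gi x ** F x) s = 0"
proof (rule mfc_mult_eq_0[OF sq(2) F(1)])
  fix j
  show "mfc Gi (s - j) = 0 \<or> mfc F j = 0"
  proof (rule ccontr)
    assume *: "\<not> (mfc Gi (s - j) = 0 \<or> mfc F j = 0)"
    then have "s - j \<in> A" "j \<notin> I" using supp F(2) by blast+
    moreover have "s - (s - j) \<in> I" using F(3) \<open>s - j \<in> A\<close> by (intro shift)
    ultimately show False by simp
  qed
qed

lemma supp_adj_Hi: assumes F: "sqint F" "\<And>k. k \<in> J \<Longrightarrow> mfc F k = 0" "s \<in> J"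
  shows "mfc (\<lambda>x. adj (Hi x) ** F x) s = 0"
proof (rule mfc_mult_eq_0[OF sq_adj(2) F(1)])
  fix j
  show "mfc (\<lambda>x. adj (Hi x)) (s - j) = 0 \<or> mfc F j = 0"
  proof (rule ccontr)
    assume *: "\<not> (mfc (\<lambda>x. adj (Hi x)) (s - j) = 0 \<or> mfc F j = 0)"
    then have "mfc Hi (j - s) \<noteq> 0" unfolding mfc_adj by auto
    then have "j - s \<in> A" "j \<notin> J" using supp F(2) * by blast+
    moreover have "s + (j - s) \<in> J" using F(3) \<open>j - s \<in> A\<close> by (intro shift)
    ultimately show False by simp
  qed
qed

lemma adj_G_adj_V: "AE x in circ. adj (G x) ** adj (V x) = H x"
  using V_eq(1) inv(2)
proof eventually_elim
  case (elim x)
  have "adj (G x) ** adj (V x) = adj (adj (H x) ** (Gi x ** G x))"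
    by (simp add: adj_mult[symmetric] elim(1) matrix_mul_assoc)
  then show ?case by (simp add: elim(2))
qed

lemma Gi_adj_V: "AE x in circ. Gi x ** adj (V x) = adj (Hi x)"
  using V_eq(2) inv(2)
proof eventually_elim
  case (elim x)
  have "Gi x ** adj (V x) = (Gi x ** G x) ** adj (Hi x)"
    by (simp add: elim(1) adj_mult matrix_mul_assoc)
  then show ?case by (simp add: elim(2))
qed

lemma adj_Hi_V: "AE x in circ. adj (Hi x) ** V x = Gi x"
  using V_eq(1) inv(3)
proof eventually_elim
  case (elim x)
  have "adj (Hi x) ** V x = adj (H x ** Hi x) ** Gi x"
    by (simp add: elim(1) adj_mult matrix_mul_assoc)
  then show ?case by (simp add: elim(2))
qed

lemma mfc_mult_adj_V:
  fixes X Y F :: "real \<Rightarrow> complex^'d^'d"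
  assumes "AE x in circ. X x ** adj (V x) = Y x" "sqint X" "sqint Y" "sqint F"
  shows "mfc (\<lambda>x. X x ** (adj (V x) ** F x)) k = mfc (\<lambda>x. Y x ** F x) k"
proof (rule mfc_cong_AE)
  show "AE x in circ. X x ** (adj (V x) ** F x) = Y x ** F x"
    using assms(1) by eventually_elim (simp add: matrix_mul_assoc)
qed (intro mintegrable_mult sqV assms)+

lemma mfc_mult_v_Suc:
  fixes X Y :: "real \<Rightarrow> complex^'d^'d"
  assumes "AE x in circ. X x ** adj (V x) = Y x" "sqint X" "sqint Y"
  shows "mfc (\<lambda>x. X x ** v u (Suc k) x) s =
    mfc (\<lambda>x. X x ** v u k x) s - mfc (\<lambda>x. Y x ** mpart (v u k) x) s + mfc (\<lambda>x. X x ** npart (v u k) x) s"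
proof -
  have "mfc (\<lambda>x. X x ** v u (Suc k) x) s =
     mfc (\<lambda>x. X x ** v u k x - X x ** (adj (V x) ** mpart (v u k) x) + X x ** npart (v u k) x) s"
    by (simp add: matrix_mult_add_right matrix_mult_diff_right)
  also have "\<dots> = mfc (\<lambda>x. X x ** v u k x) s - mfc (\<lambda>x. X x ** (adj (V x) ** mpart (v u k) x)) s + mfc (\<lambda>x. X x ** npart (v u k) x) s"
    by (subst mfc_add, (intro mintegrable_diff mintegrable_mult sqV sq_v sq_m sq_n assms)+,
        subst mfc_diff, (intro mintegrable_diff mintegrable_mult sqV sq_v sq_m sq_n assms)+, rule refl)
  finally show ?thesis by (simp only: mfc_mult_adj_V[OF assms sq_m])
qed

text \<open>The Fourier coefficients of \<open>G\<^sup>-\<^sup>1 z\<close>, which turns out to be a trigonometric polynomial.\<close>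

definition psol :: "int \<Rightarrow> int \<Rightarrow> complex^'d^'d" where
  "psol u s = mfc (\<lambda>x. Gi x ** z u x) s"

text \<open>\<open>G\<^sup>-\<^sup>1 z = (H\<^sup>*)\<^sup>-\<^sup>1 (V z)\<close> has no frequencies in \<open>I\<close> by its first form and none in \<open>J\<close> by its second.
  It is only integrable, which suffices to conclude that it is a trigonometric polynomial.\<close>

lemma psol_trig:
  assumes u: "u \<in> N"
  shows "AE x in circ. z u x = G x ** (\<Sum>r\<in>N. psol u r ** emat r x)"
proof -
  have "mfc (\<lambda>x. Gi x ** z u x) k = 0" if "k \<notin> N" for k
  proof (cases "k \<in> I")
    case True
    then show ?thesis by (intro supp_Gi z[OF u] z_supp[OF u])
  next
    case False
    then have k: "k \<in> J" using that N_iff by blast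
    have "mfc (\<lambda>x. Gi x ** z u x) k = mfc (\<lambda>x. adj (Hi x) ** (V x ** z u x)) k"
    proof (rule mfc_cong_AE)
      show "AE x in circ. Gi x ** z u x = adj (Hi x) ** (V x ** z u x)"
        using adj_Hi_V by eventually_elim (simp add: matrix_mul_assoc)
    qed (intro mintegrable_mult sqV sq sq_adj z[OF u])+
    also have "\<dots> = 0" by (intro supp_adj_Hi sqV z[OF u] Vz_supp[OF u] k)
    finally show ?thesis .
  qed
  then have "AE x in circ. Gi x ** z u x = (\<Sum>k\<in>N. psol u k ** emat k x)"
    unfolding psol_def by (intro AE_eq_trig_polynomial mintegrable_mult sq z[OF u] finN)
  with inv(1) show ?thesis
  proof eventually_elim
    case (elim x)
    have "z u x = (G x ** Gi x) ** z u x" by (simp add: elim(1))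
    also have "\<dots> = G x ** (\<Sum>r\<in>N. psol u r ** emat r x)"
      unfolding elim(2)[symmetric] by (simp add: matrix_mul_assoc)
    finally show ?case .
  qed
qed

text \<open>Along the iteration the Fourier coefficients of \<open>G\<^sup>* v\<close> in \<open>N\<close> do not change, because
  \<open>G\<^sup>* V\<^sup>* m = H m\<close> has its frequencies in \<open>J\<close> and \<open>G\<^sup>* n\<close> in \<open>I\<close>.  So \<open>G\<^sup>* z = w (G\<^sup>-\<^sup>1 z)\<close> has the
  same coefficients in \<open>N\<close> as \<open>G\<^sup>*\<close> times the initial exponential.\<close>

lemma psol_toeplitz:
  assumes u: "u \<in> N" and s: "s \<in> N"
  shows "(\<Sum>r\<in>N. mfc (\<lambda>x. adj (G x) ** G x) (s - r) ** psol u r) = adj (mfc G (u - s))"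
proof -
  have sI: "s \<notin> I" "s \<notin> J" using s N_iff by auto
  have const: "mfc (\<lambda>x. adj (G x) ** v u k x) s = adj (mfc G (u - s))" for k
  proof (induction k)
    case 0
    show ?case by (simp add: mfc_mult_emat mfc_adj)
  next
    case (Suc k)
    have "mfc (\<lambda>x. H x ** mpart (v u k) x) s = 0" by (rule supp_H[OF sq_m _ sI(2)]) (simp add: mfc_m)
    moreover have "mfc (\<lambda>x. adj (G x) ** npart (v u k) x) s = 0" by (rule supp_adj_G[OF sq_n _ sI(1)]) (simp add: mfc_n)
    ultimately show ?case
      unfolding mfc_mult_v_Suc[OF adj_G_adj_V sq_adj(1) sq(3)] Suc by simp
  qed
  have lim: "mfc (\<lambda>x. adj (G x) ** z u x) s = adj (mfc G (u - s))"
    using mfc_v_tendsto[OF u sq_adj(1), of s] unfolding const by (simp add: LIMSEQ_const_iff)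
  let ?W = "\<lambda>x. adj (G x) ** G x"
  have W: "mintegrable ?W" by (intro mintegrable_mult sq sq_adj)
  have part: "(?W x ** (psol u r ** emat r x)) $ i $ j = (\<Sum>c\<in>UNIV. psol u r $ c $ j * (cis (of_int r * x) * ?W x $ i $ c))" for x r i j
  proof -
    have "(psol u r ** emat r x) $ c $ j = psol u r $ c $ j * cis (of_int r * x)" for c
      by (simp add: emat_def matrix_matrix_mult_def if_distrib cong: if_cong)
    then show ?thesis
      unfolding matrix_matrix_mult_def[of "?W x"] by (simp add: mult_ac)
  qed
  have ipart: "mintegrable (\<lambda>x. ?W x ** (psol u r ** emat r x))" for r
    unfolding mintegrable_def part using W
    by (intro allI Bochner_Integration.integrable_sum integrable_mult_right integrable_cis_times) (auto simp: mintegrable_def)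
  have mpart: "mfc (\<lambda>x. ?W x ** (psol u r ** emat r x)) s = mfc ?W (s - r) ** psol u r" for r
  proof -
    have "mfc (\<lambda>x. ?W x ** (psol u r ** emat r x)) s $ i $ j = (mfc ?W (s - r) ** psol u r) $ i $ j" for i j
    proof -
      have "mfc (\<lambda>x. ?W x ** (psol u r ** emat r x)) s $ i $ j =
          (\<Sum>c\<in>UNIV. fc (\<lambda>x. psol u r $ c $ j * (cis (of_int r * x) * ?W x $ i $ c)) s)"
        unfolding mfc_nth part
        by (rule fc_sum) (use W in \<open>auto simp: mintegrable_def intro!: integrable_mult_right integrable_cis_times\<close>)
      also have "\<dots> = (\<Sum>c\<in>UNIV. psol u r $ c $ j * mfc ?W (s - r) $ i $ c)"
        unfolding fc_cmult fc_shift mfc_nth ..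
      also have "\<dots> = (mfc ?W (s - r) ** psol u r) $ i $ j"
        unfolding matrix_matrix_mult_def[of "mfc ?W (s - r)"] by (simp only: vec_lambda_beta mult.commute)
      finally show ?thesis .
    qed
    then show ?thesis unfolding vec_eq_iff by blast
  qed
  have sumW: "mintegrable (\<lambda>x. \<Sum>r\<in>R. ?W x ** (psol u r ** emat r x))
     \<and> mfc (\<lambda>x. \<Sum>r\<in>R. ?W x ** (psol u r ** emat r x)) s = (\<Sum>r\<in>R. mfc ?W (s - r) ** psol u r)" if "finite R" for R
    using that
  proof (induction R)
    case empty
    show ?case by (simp add: mintegrable_def vec_eq_iff)
  next
    case (insert r R)
    then show ?case by (simp add: mfc_add mintegrable_add ipart mpart)
  qed
  have "mfc (\<lambda>x. adj (G x) ** z u x) s = mfc (\<lambda>x. \<Sum>r\<in>N. ?W x ** (psol u r ** emat r x)) s"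
  proof (rule mfc_cong_AE)
    show "AE x in circ. adj (G x) ** z u x = (\<Sum>r\<in>N. ?W x ** (psol u r ** emat r x))"
      using psol_trig[OF u]
      by eventually_elim (simp add: matrix_mul_assoc matrix_mult_sum_right)
    show "mintegrable (\<lambda>x. adj (G x) ** z u x)" by (intro mintegrable_mult sq_adj z[OF u])
  qed (use sumW[OF finN] in blast)
  then show ?thesis using lim sumW[OF finN] by simp
qed

text \<open>The series telescopes, since \<open>G\<^sup>-\<^sup>1 V\<^sup>* = (H\<^sup>*)\<^sup>-\<^sup>1\<close>.\<close>

lemma psol_sums:
  assumes u: "u \<in> N"
  shows "(\<lambda>k. mfc (\<lambda>x. adj (Hi x) ** mpart (v u k) x) s - mfc (\<lambda>x. Gi x ** npart (v u k) x) s)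
    sums (mfc Gi (s - u) - psol u s)"
proof -
  have "(\<lambda>k. mfc (\<lambda>x. Gi x ** v u k x) s) \<longlonglongrightarrow> psol u s"
    unfolding psol_def by (rule mfc_v_tendsto[OF u sq(2)])
  from telescope_sums'[OF this] show ?thesis
    unfolding mfc_mult_v_Suc[OF Gi_adj_V sq(2) sq_adj(2)]
    by (simp add: mfc_mult_emat algebra_simps)
qed

subsection \<open>The recursion for the Fourier coefficients of the iterates\<close>

definition \<alpha> :: "int \<Rightarrow> complex^'d^'d" where "\<alpha> k = - adj (mfc Gi k)"

definition \<eta> :: "int \<Rightarrow> complex^'d^'d" where "\<eta> k = - mfc Hi k"

context
  fixes \<phi> \<psi> :: "nat \<Rightarrow> int"
  assumes \<phi>: "inj \<phi>" "range \<phi> = I" and \<psi>: "inj \<psi>" "range \<psi> = J"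
begin

lemma mfc_m_0: "j \<in> J \<Longrightarrow> mfc (mpart (v u 0)) j = mfc V (j - u)"
  by (simp only: mfc_m) (simp add: mfc_mult_emat)

lemma mfc_m_Suc:
  assumes j: "j \<in> J"
  shows "(\<lambda>p. mfc V (j - \<phi> p) ** mfc (npart (v u k)) (\<phi> p)) sums mfc (mpart (v u (Suc k))) j"
proof -
  have one: "sqint (\<lambda>x. mat 1 :: complex^'d^'d)" by (rule sqint_bounded[OF _ order_refl]) simp
  have "mfc (mpart (v u (Suc k))) j = mfc (\<lambda>x. V x ** v u (Suc k) x) j" using j by (simp only: mfc_m if_True)
  also have "\<dots> = mfc (\<lambda>x. V x ** v u k x) j - mfc (\<lambda>x. mat 1 ** mpart (v u k) x) j + mfc (\<lambda>x. V x ** npart (v u k) x) j"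
    by (rule mfc_mult_v_Suc[OF _ sqint_V one]) (simp add: V_unitary)
  also have "mfc (\<lambda>x. mat 1 ** mpart (v u k) x) j = mfc (\<lambda>x. V x ** v u k x) j"
    using j by (simp add: mfc_m)
  finally have "mfc (mpart (v u (Suc k))) j = mfc (\<lambda>x. V x ** npart (v u k) x) j" by simp
  then show ?thesis
    using mfc_mult_sums[OF sqint_V sq_n \<phi>(1), of u k j] \<phi>(2) by (simp add: mfc_n)
qed

lemma mfc_n_sums:
  assumes i: "i \<in> I"
  shows "(\<lambda>l. adj (mfc V (\<psi> l - i)) ** mfc (mpart (v u k)) (\<psi> l)) sums mfc (npart (v u k)) i"
proof -
  have "(\<lambda>l. mfc (\<lambda>x. adj (V x)) (i - \<psi> l) ** mfc (mpart (v u k)) (\<psi> l)) sums mfc (\<lambda>x. adj (V x) ** mpart (v u k) x) i"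
    by (rule mfc_mult_sums[OF sqint_adj[OF sqint_V] sq_m \<psi>(1)]) (simp add: mfc_m \<psi>(2))
  then show ?thesis using i by (simp add: mfc_adj mfc_n)
qed

context
  fixes \<beta> :: "int \<Rightarrow> complex^'d^'d" and n u' :: nat and u :: int
  assumes V_\<beta>: "\<And>l p. mfc V (\<psi> l - \<phi> p) = - \<beta> (int (n + 1 + l + p))"
    and V_\<beta>_u: "\<And>l. mfc V (\<psi> l - u) = - \<beta> (int (n + 1 - u' + l))"
begin

text \<open>The coefficients of \<open>npart\<close> come from those of \<open>mpart\<close> by one step of the recursion, and the
  next ones of \<open>mpart\<close> from them by the following step.\<close>

lemma bt_seq_even_sums:
  assumes "\<And>l. mfc (mpart (v u k)) (\<psi> l) = - adj (bt_seq \<beta> n u' (Suc (2 * k)) l)"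
  shows "mfc (npart (v u k)) (\<phi> p) = adj (bt_seq \<beta> n u' (Suc (Suc (2 * k))) p)"
proof -
  have "adj (mfc V (\<psi> l - \<phi> p)) ** mfc (mpart (v u k)) (\<psi> l) =
      adj (bt_seq \<beta> n u' (Suc (2 * k)) l ** \<beta> (int (n + 1 + l + p)))" for l
    unfolding assms V_\<beta> by (simp add: adj_mult)
  with mfc_n_sums[of "\<phi> p" u k] have "(\<lambda>l. adj (bt_seq \<beta> n u' (Suc (2 * k)) l ** \<beta> (int (n + 1 + l + p)))) sums mfc (npart (v u k)) (\<phi> p)"
    using \<phi>(2) by auto
  from bounded_linear.sums[OF bounded_linear_adj this]
  have "bt_seq \<beta> n u' (Suc (Suc (2 * k))) p = adj (mfc (npart (v u k)) (\<phi> p))"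
    by (simp add: sums_iff)
  then show ?thesis by simp
qed

lemma bt_seq_odd:
  "mfc (mpart (v u k)) (\<psi> l) = - adj (bt_seq \<beta> n u' (Suc (2 * k)) l)"
proof (induction k arbitrary: l)
  case 0
  have "\<psi> l \<in> J" using \<psi>(2) by auto
  then show ?case by (simp only: mfc_m_0 V_\<beta>_u) simp
next
  case (Suc k)
  note e = bt_seq_even_sums[OF Suc]
  have J: "\<psi> l \<in> J" using \<psi>(2) by auto
  have "mfc V (\<psi> l - \<phi> p) ** mfc (npart (v u k)) (\<phi> p) =
      - adj (bt_seq \<beta> n u' (Suc (Suc (2 * k))) p ** adj (\<beta> (int (n + 1 + p + l))))" for p
    unfolding e V_\<beta> adj_mult adj_adj matrix_mult_minus by (simp only: ac_simps)
  with mfc_m_Suc[OF J, of u k]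
  have "(\<lambda>p. - adj (bt_seq \<beta> n u' (Suc (Suc (2 * k))) p ** adj (\<beta> (int (n + 1 + p + l))))) sums mfc (mpart (v u (Suc k))) (\<psi> l)"
    by (simp only:)
  from sums_minus[OF bounded_linear.sums[OF bounded_linear_adj this]]
  have "(\<lambda>p. bt_seq \<beta> n u' (Suc (Suc (2 * k))) p ** adj (\<beta> (int (n + 1 + p + l)))) sums - adj (mfc (mpart (v u (Suc k))) (\<psi> l))"
    by (simp only: adj_minus adj_adj minus_minus)
  then have "bt_seq \<beta> n u' (Suc (2 * Suc k)) l = - adj (mfc (mpart (v u (Suc k))) (\<psi> l))"
    by (simp add: sums_iff)
  then show ?case by simp
qed

lemmas bt_seq_even = bt_seq_even_sums[OF bt_seq_odd]

lemma odd_sums: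
  "(\<lambda>l. bt_seq \<beta> n u' (Suc (2 * k)) l ** \<eta> (\<psi> l - s)) sums adj (mfc (\<lambda>x. adj (Hi x) ** mpart (v u k) x) s)"
proof -
  have "(\<lambda>l. mfc (\<lambda>x. adj (Hi x)) (s - \<psi> l) ** mfc (mpart (v u k)) (\<psi> l)) sums mfc (\<lambda>x. adj (Hi x) ** mpart (v u k) x) s"
    by (rule mfc_mult_sums[OF sq_adj(2) sq_m \<psi>(1)]) (simp add: mfc_m \<psi>(2))
  moreover have "mfc (\<lambda>x. adj (Hi x)) (s - \<psi> l) ** mfc (mpart (v u k)) (\<psi> l) =
      adj (bt_seq \<beta> n u' (Suc (2 * k)) l ** \<eta> (\<psi> l - s))" for l
    unfolding bt_seq_odd mfc_adj \<eta>_def adj_mult adj_minus matrix_mult_minus by (simp only: minus_diff_eq)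
  ultimately have "(\<lambda>l. adj (bt_seq \<beta> n u' (Suc (2 * k)) l ** \<eta> (\<psi> l - s))) sums mfc (\<lambda>x. adj (Hi x) ** mpart (v u k) x) s"
    by (simp only:)
  from bounded_linear.sums[OF bounded_linear_adj this] show ?thesis by (simp only: adj_adj)
qed

lemma even_sums:
  "(\<lambda>p. bt_seq \<beta> n u' (Suc (Suc (2 * k))) p ** \<alpha> (s - \<phi> p)) sums - adj (mfc (\<lambda>x. Gi x ** npart (v u k) x) s)"
proof -
  have "(\<lambda>p. mfc Gi (s - \<phi> p) ** mfc (npart (v u k)) (\<phi> p)) sums mfc (\<lambda>x. Gi x ** npart (v u k) x) s"
    by (rule mfc_mult_sums[OF sq(2) sq_n \<phi>(1)]) (simp add: mfc_n \<phi>(2))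
  moreover have "mfc Gi (s - \<phi> p) ** mfc (npart (v u k)) (\<phi> p) =
      - adj (bt_seq \<beta> n u' (Suc (Suc (2 * k))) p ** \<alpha> (s - \<phi> p))" for p
    unfolding bt_seq_even \<alpha>_def adj_mult adj_minus matrix_mult_minus adj_adj by simp
  ultimately have "(\<lambda>p. - adj (bt_seq \<beta> n u' (Suc (Suc (2 * k))) p ** \<alpha> (s - \<phi> p))) sums mfc (\<lambda>x. Gi x ** npart (v u k) x) s"
    by (simp only:)
  from sums_minus[OF bounded_linear.sums[OF bounded_linear_adj this]] show ?thesis
    by (simp only: adj_adj adj_minus minus_minus)
qed

lemma series_sums:
  assumes "u \<in> N"
  shows "(\<lambda>k. adj ((\<Sum>l. bt_seq \<beta> n u' (Suc (2 * k)) l ** \<eta> (\<psi> l - s)) + (\<Sum>p. bt_seq \<beta> n u' (Suc (Suc (2 * k))) p ** \<alpha> (s - \<phi> p))))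
    sums (mfc Gi (s - u) - psol u s)"
  using psol_sums[OF assms, of s]
  unfolding sums_unique[OF odd_sums, symmetric] sums_unique[OF even_sums, symmetric] adj_add adj_minus adj_adj
  by simp

end
end

subsection \<open>The inverse\<close>

lemma sum_G_Gi:
  assumes s: "s \<in> N" and t: "t \<in> N"
  shows "(\<Sum>u\<in>N. mfc Gi (t - u) ** mfc G (u - s)) = (if s = t then mat 1 else 0)"
proof -
  have sqe: "sqint (\<lambda>x. G x ** emat s x)"
  proof -
    have "(G x ** emat s x) $ i $ j = cis (of_int s * x) * G x $ i $ j" for x i j
      by (simp add: emat_def matrix_matrix_mult_def if_distrib mult.commute cong: if_cong)
    then show ?thesis unfolding sqint_matrix_iff by (auto intro!: sqint_cis_mult sqint_entry sq)
  qed
  have h1: "((\<lambda>u. mfc Gi (t - u) ** mfc G (u - s)) has_sum mfc (\<lambda>x. Gi x ** (G x ** emat s x)) t) UNIV"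
    using mfc_mult_has_sum[OF sq(2) sqe, of t] by (simp only: mfc_mult_emat)
  have h2: "mfc (\<lambda>x. Gi x ** (G x ** emat s x)) t = mfc (emat s) t"
  proof (rule mfc_cong_AE)
    show "AE x in circ. Gi x ** (G x ** emat s x) = emat s x"
      using inv(2) by eventually_elim (simp add: matrix_mul_assoc)
  qed (intro mintegrable_mult mintegrable_sqint sq sqe sqint_emat)+
  have h3: "((\<lambda>u. mfc Gi (t - u) ** mfc G (u - s)) has_sum (\<Sum>u\<in>N. mfc Gi (t - u) ** mfc G (u - s))) UNIV"
  proof (rule has_sum_finite_neutralI[OF finN])
    fix u assume "u \<in> UNIV - N"
    then consider "u \<in> I" | "u \<in> J" using N_iff by blast
    then show "mfc Gi (t - u) ** mfc G (u - s) = 0"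
    proof cases
      case 1
      have "u - s \<notin> A" using shift(1)[OF 1, of "u - s"] s N_iff by auto
      then show ?thesis by (simp add: supp)
    next
      case 2
      have "t - u \<notin> A" using shift(2)[OF 2, of "t - u"] t N_iff by auto
      then show ?thesis by (simp add: supp)
    qed
  qed auto
  show ?thesis unfolding has_sum_unique[OF h3 h1] h2 mfc_emat by auto
qed

text \<open>Both sums are combined in \<open>toeplitz_rinv\<close>: \<open>adj (\<alpha> (s - u)) = - mfc Gi (s - u)\<close> cancels the
  coefficient of \<open>Gi\<close>, and \<open>-psol u s ** \<alpha> (t - u)\<close> remains.\<close>

definition rinv :: "int \<Rightarrow> int \<Rightarrow> complex^'d^'d" where
  "rinv s t = (\<Sum>u\<in>N. adj (\<alpha> (s - u)) ** \<alpha> (t - u)) + (\<Sum>u\<in>N. (mfc Gi (s - u) - psol u s) ** \<alpha> (t - u))"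

lemma toeplitz_rinv:
  assumes s: "s \<in> N" and t: "t \<in> N"
  shows "(\<Sum>r\<in>N. mfc (\<lambda>x. adj (G x) ** G x) (s - r) ** rinv r t) = (if s = t then mat 1 else 0)"
proof -
  let ?W = "\<lambda>k. mfc (\<lambda>x. adj (G x) ** G x) k"
  have R: "rinv r t = (\<Sum>u\<in>N. psol u r ** adj (mfc Gi (t - u)))" for r
    unfolding rinv_def sum.distrib[symmetric] \<alpha>_def
    by (simp add: matrix_mult_diff_left)
  have "(\<Sum>r\<in>N. ?W (s - r) ** rinv r t) = (\<Sum>u\<in>N. (\<Sum>r\<in>N. ?W (s - r) ** psol u r) ** adj (mfc Gi (t - u)))"
    unfolding R matrix_mult_sum_right matrix_mult_sum_left matrix_mul_assoc by (rule sum.swap)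
  also have "\<dots> = (\<Sum>u\<in>N. adj (mfc Gi (t - u) ** mfc G (u - s)))"
    by (intro sum.cong refl) (simp add: psol_toeplitz s adj_mult)
  also have "\<dots> = adj (\<Sum>u\<in>N. mfc Gi (t - u) ** mfc G (u - s))" by (rule adj_sum[symmetric])
  finally show ?thesis by (simp add: sum_G_Gi[OF s t])
qed

end

section \<open>Both expansions of the inverse\<close>

text \<open>Replacing \<open>\<beta>\<close> by its adjoint and \<open>u\<close> by \<open>n + 1 - u\<close> exchanges the two recursions, so the recursion
  for the iterates has to be solved for \<^const>\<open>bt_seq\<close> only.\<close>

lemma b_seq_eq_bt_seq:
  assumes "u \<le> n"
  shows "b_seq \<beta> n u k l = bt_seq (\<lambda>k. adj (\<beta> k)) n (n + 1 - u) k l"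
proof (induction k arbitrary: l rule: less_induct)
  case (less k)
  consider "k = 0" | "k = Suc 0" | k' where "k = Suc (Suc k')" by (metis not0_implies_Suc)
  then show ?case
  proof cases
    case 2
    have "n + 1 - (n + 1 - u) = u" using assms by simp
    then show ?thesis using 2 by simp
  next
    case 3
    then have "b_seq \<beta> n u (Suc k') m = bt_seq (\<lambda>k. adj (\<beta> k)) n (n + 1 - u) (Suc k') m" for m
      by (intro less) simp
    then show ?thesis using 3 by (simp cong: if_cong)
  qed simp
qed

lemma range_shifted_int: "range (\<lambda>l. int n + 1 + int l) = {int n + 1..}"
proof (intro equalityI subsetI)
  fix x assume "x \<in> {int n + 1..}"
  then have "x = int n + 1 + int (nat (x - (int n + 1)))" by simp
  then show "x \<in> range (\<lambda>l. int n + 1 + int l)" by (rule range_eqI)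
qed auto

locale boundary_factors =
  fixes h hi g gi V :: "real \<Rightarrow> complex^'d^'d"
  assumes sq: "sqint h" "sqint hi" "sqint g" "sqint gi"
    and V_meas: "V \<in> borel_measurable circ"
    and V_unitary: "\<And>x. adj (V x) ** V x = mat 1" "\<And>x. V x ** adj (V x) = mat 1"
    and V_eq: "AE x in circ. V x = adj (h x) ** gi x" "AE x in circ. V x = hi x ** adj (g x)"
    and w_eq: "AE x in circ. h x ** adj (h x) = adj (g x) ** g x"
    and inv: "AE x in circ. h x ** hi x = mat 1" "AE x in circ. hi x ** h x = mat 1"
      "AE x in circ. g x ** gi x = mat 1" "AE x in circ. gi x ** g x = mat 1"
    and supp: "\<And>k. k < 0 \<Longrightarrow> mfc h k = 0" "\<And>k. k < 0 \<Longrightarrow> mfc hi k = 0"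
      "\<And>k. k < 0 \<Longrightarrow> mfc g k = 0" "\<And>k. k < 0 \<Longrightarrow> mfc gi k = 0"
begin

definition W :: "int \<Rightarrow> complex^'d^'d" where "W k = mfc (\<lambda>x. adj (g x) ** g x) k"

definition a :: "nat \<Rightarrow> complex^'d^'d" where "a k = - mfc hi (int k)"

definition a' :: "nat \<Rightarrow> complex^'d^'d" where "a' k = - adj (mfc gi (int k))"

definition \<beta> :: "int \<Rightarrow> complex^'d^'d" where "\<beta> k = - mfc V k"

text \<open>The analytic factors \<open>g\<close>, \<open>h\<close> lead to the first expansion and the antianalytic factors \<open>h\<^sup>*\<close>, \<open>g\<^sup>*\<close>
  to the second one.\<close>

lemma left: "factored_symbol g gi h hi V {0..} {..0} {int n + 1..} (int ` {1..n})"
proof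
  show "k \<in> int ` {1..n} \<longleftrightarrow> k \<notin> {..0} \<and> k \<notin> {int n + 1..}" for k
    by (auto simp: image_iff intro!: bexI[of _ "nat k"])
qed (use sq V_meas V_unitary V_eq inv supp in auto)

lemma right: "factored_symbol (\<lambda>x. adj (h x)) (\<lambda>x. adj (hi x)) (\<lambda>x. adj (g x)) (\<lambda>x. adj (gi x)) (\<lambda>x. adj (V x))
  {..0} {int n + 1..} {..0} (int ` {1..n})"
proof
  show "k \<in> int ` {1..n} \<longleftrightarrow> k \<notin> {int n + 1..} \<and> k \<notin> {..0}" for k
    by (auto simp: image_iff intro!: bexI[of _ "nat k"])
  show "AE x in circ. adj (V x) = adj (adj (g x)) ** adj (hi x)"
    using V_eq(2) by eventually_elim (simp add: adj_mult)
  show "AE x in circ. adj (V x) = adj (gi x) ** adj (adj (h x))"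
    using V_eq(1) by eventually_elim (simp add: adj_mult)
  show "AE x in circ. adj (h x) ** adj (hi x) = mat 1"
    using inv(2) by eventually_elim (simp add: adj_mult[symmetric])
  show "AE x in circ. adj (hi x) ** adj (h x) = mat 1"
    using inv(1) by eventually_elim (simp add: adj_mult[symmetric])
  show "AE x in circ. adj (g x) ** adj (gi x) = mat 1"
    using inv(4) by eventually_elim (simp add: adj_mult[symmetric])
qed (use sq V_meas V_unitary supp in \<open>auto intro!: sqint_adj measurable_adj simp: mfc_adj\<close>)

abbreviation "left_inv n \<equiv> factored_symbol.rinv gi V {..0} {int n + 1..} (int ` {1..n})"

abbreviation "right_inv n \<equiv> factored_symbol.rinv (\<lambda>x. adj (hi x)) (\<lambda>x. adj (V x)) {int n + 1..} {..0} (int ` {1..n})"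

lemma sqint_V: "sqint V"
proof -
  interpret L: factored_symbol g gi h hi V "{0..}" "{..0}" "{int 0 + 1..}" "int ` {1..0}" by (rule left)
  show ?thesis by (rule L.sqint_V)
qed

lemma inj_on_int: "inj_on int X" by (simp add: inj_on_def)

lemma W_adj: "adj (W k) = W (- k)"
proof -
  have "mfc (\<lambda>x. adj (adj (g x) ** g x)) (- k) = adj (mfc (\<lambda>x. adj (g x) ** g x) (- (- k)))" by (rule mfc_adj)
  then show ?thesis by (simp add: W_def adj_mult)
qed

lemma W_h: "mfc (\<lambda>x. adj (adj (h x)) ** adj (h x)) k = W k"
  unfolding W_def
  by (rule mfc_cong_AE) (use w_eq in \<open>auto intro!: mintegrable_mult sqint_adj sq\<close>)

definition term1 where
  "term1 n s u j = adj ((\<Sum>l. bt_seq \<beta> n u (Suc (2 * j)) l ** a (n + 1 - s + l)) + (\<Sum>l. bt_seq \<beta> n u (Suc (Suc (2 * j))) l ** a' (s + l)))"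

definition term2 where
  "term2 n s u j = adj ((\<Sum>l. b_seq \<beta> n u (Suc (2 * j)) l ** a' (s + l)) + (\<Sum>l. b_seq \<beta> n u (Suc (Suc (2 * j))) l ** a (n + 1 - s + l)))"

lemma first_expansion:
  assumes s: "s \<in> {1..n}" and t: "t \<in> {1..n}"
  shows "u \<in> {1..n} \<Longrightarrow> summable (\<lambda>l. bt_seq \<beta> n u (Suc (2 * j)) l ** a (n + 1 - s + l))"
    and "u \<in> {1..n} \<Longrightarrow> summable (\<lambda>l. bt_seq \<beta> n u (Suc (Suc (2 * j))) l ** a' (s + l))"
    and "u \<in> {1..n} \<Longrightarrow> summable (term1 n s u)"
    and "left_inv n (int s) (int t) =
      (\<Sum>l=1..min s t. adj (a' (s - l)) ** a' (t - l)) + (\<Sum>u=1..t. (\<Sum>j. term1 n s u j) ** a' (t - u))"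
proof -
  interpret L: factored_symbol g gi h hi V "{0..}" "{..0}" "{int n + 1..}" "int ` {1..n}" by (rule left)
  let ?\<phi> = "\<lambda>p. - int p" and ?\<psi> = "\<lambda>l. int n + 1 + int l"
  have \<phi>: "inj ?\<phi>" "range ?\<phi> = {..0}"
    by (auto simp: inj_def image_iff intro!: exI[of _ "nat (- _)"])
  have \<psi>: "inj ?\<psi>" "range ?\<psi> = {int n + 1..}"
    by (simp_all add: inj_def range_shifted_int)
  have V1: "mfc V (?\<psi> l - ?\<phi> p) = - \<beta> (int (n + 1 + l + p))" for l p
    by (simp add: \<beta>_def algebra_simps)
  have V2: "mfc V (?\<psi> l - int u) = - \<beta> (int (n + 1 - u + l))" if "u \<in> {1..n}" for l u
    using that by (simp add: \<beta>_def of_nat_diff algebra_simps)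
  have \<eta>: "L.\<eta> (?\<psi> l - int s) = a (n + 1 - s + l)" for l
    using s by (simp add: L.\<eta>_def a_def of_nat_diff algebra_simps)
  have \<alpha>: "L.\<alpha> (int s - ?\<phi> p) = a' (s + p)" for p
    by (simp add: L.\<alpha>_def a'_def)
  have \<alpha>t: "L.\<alpha> (int t - int u) = (if u \<le> t then a' (t - u) else 0)" for t u
    by (auto simp: L.\<alpha>_def a'_def of_nat_diff supp)
  note os = L.odd_sums[OF \<phi> \<psi> V1 V2, where s="int s", unfolded \<eta>]
  note es = L.even_sums[OF \<phi> \<psi> V1 V2, where s="int s", unfolded \<alpha>]
  note ss = L.series_sums[OF \<phi> \<psi> V1 V2, where s="int s", unfolded \<eta> \<alpha>, folded term1_def]
  show "summable (\<lambda>l. bt_seq \<beta> n u (Suc (2 * j)) l ** a (n + 1 - s + l))" if "u \<in> {1..n}"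
    using os[OF that] by (rule sums_summable)
  show "summable (\<lambda>l. bt_seq \<beta> n u (Suc (Suc (2 * j))) l ** a' (s + l))" if "u \<in> {1..n}"
    using es[OF that] by (rule sums_summable)
  have ts: "term1 n s u sums (mfc gi (int s - int u) - L.psol (int u) (int s))" if "u \<in> {1..n}" for u
    using ss[OF that] that by simp
  show "summable (term1 n s u)" if "u \<in> {1..n}" for u using ts[OF that] by (rule sums_summable)
  have "L.rinv (int s) (int t) =
     (\<Sum>u\<in>{1..n}. adj (L.\<alpha> (int s - int u)) ** L.\<alpha> (int t - int u)) +
     (\<Sum>u\<in>{1..n}. (mfc gi (int s - int u) - L.psol (int u) (int s)) ** L.\<alpha> (int t - int u))"
    unfolding L.rinv_def sum.reindex[OF inj_on_int] o_def ..
  also have "(\<Sum>u\<in>{1..n}. adj (L.\<alpha> (int s - int u)) ** L.\<alpha> (int t - int u)) = (\<Sum>l=1..min s t. adj (a' (s - l)) ** a' (t - l))"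
    using s t by (intro sum.mono_neutral_cong_right) (auto simp: \<alpha>t)
  also have "(\<Sum>u\<in>{1..n}. (mfc gi (int s - int u) - L.psol (int u) (int s)) ** L.\<alpha> (int t - int u)) =
      (\<Sum>u=1..t. (\<Sum>j. term1 n s u j) ** a' (t - u))"
    using t by (intro sum.mono_neutral_cong_right) (auto simp: \<alpha>t sums_unique[OF ts])
  finally show "L.rinv (int s) (int t) =
      (\<Sum>l=1..min s t. adj (a' (s - l)) ** a' (t - l)) + (\<Sum>u=1..t. (\<Sum>j. term1 n s u j) ** a' (t - u))" .
qed

lemma second_expansion:
  assumes s: "s \<in> {1..n}" and t: "t \<in> {1..n}"
  shows "u \<in> {1..n} \<Longrightarrow> summable (\<lambda>l. b_seq \<beta> n u (Suc (2 * j)) l ** a' (s + l))"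
    and "u \<in> {1..n} \<Longrightarrow> summable (\<lambda>l. b_seq \<beta> n u (Suc (Suc (2 * j))) l ** a (n + 1 - s + l))"
    and "u \<in> {1..n} \<Longrightarrow> summable (term2 n s u)"
    and "right_inv n (int s) (int t) =
      (\<Sum>l=max s t..n. adj (a (l - s)) ** a (l - t)) + (\<Sum>u=t..n. (\<Sum>j. term2 n s u j) ** a (u - t))"
proof -
  interpret R: factored_symbol "\<lambda>x. adj (h x)" "\<lambda>x. adj (hi x)" "\<lambda>x. adj (g x)" "\<lambda>x. adj (gi x)" "\<lambda>x. adj (V x)"
    "{..0}" "{int n + 1..}" "{..0}" "int ` {1..n}" by (rule right)
  let ?\<psi> = "\<lambda>p. - int p" and ?\<phi> = "\<lambda>l. int n + 1 + int l" and ?\<beta> = "\<lambda>k. adj (\<beta> k)"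
  have \<psi>: "inj ?\<psi>" "range ?\<psi> = {..0}"
    by (auto simp: inj_def image_iff intro!: exI[of _ "nat (- _)"])
  have \<phi>: "inj ?\<phi>" "range ?\<phi> = {int n + 1..}"
    by (simp_all add: inj_def range_shifted_int)
  have V1: "mfc (\<lambda>x. adj (V x)) (?\<psi> l - ?\<phi> p) = - ?\<beta> (int (n + 1 + l + p))" for l p
    by (simp add: \<beta>_def mfc_adj algebra_simps)
  have V2: "mfc (\<lambda>x. adj (V x)) (?\<psi> l - int u) = - ?\<beta> (int (n + 1 - (n + 1 - u) + l))" if "u \<in> {1..n}" for l u
    using that by (simp add: \<beta>_def mfc_adj of_nat_diff algebra_simps)
  have \<eta>: "R.\<eta> (?\<psi> l - int s) = a' (s + l)" for l
    by (simp add: R.\<eta>_def a'_def mfc_adj algebra_simps)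
  have \<alpha>: "R.\<alpha> (int s - ?\<phi> p) = a (n + 1 - s + p)" for p
    using s by (simp add: R.\<alpha>_def a_def mfc_adj of_nat_diff algebra_simps)
  have \<alpha>t: "R.\<alpha> (int t - int u) = (if t \<le> u then a (u - t) else 0)" for t u
    by (auto simp: R.\<alpha>_def a_def mfc_adj of_nat_diff supp)
  have b: "bt_seq ?\<beta> n (n + 1 - u) k l = b_seq \<beta> n u k l" if "u \<in> {1..n}" for u k l
    using b_seq_eq_bt_seq[of u n \<beta> k l] that by simp
  note os = R.odd_sums[OF \<phi> \<psi> V1 V2, where s="int s", unfolded \<eta>]
  note es = R.even_sums[OF \<phi> \<psi> V1 V2, where s="int s", unfolded \<alpha>]
  note ss = R.series_sums[OF \<phi> \<psi> V1 V2, where s="int s", unfolded \<eta> \<alpha>]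
  show "summable (\<lambda>l. b_seq \<beta> n u (Suc (2 * j)) l ** a' (s + l))" if u: "u \<in> {1..n}"
    using os[OF u] unfolding b[OF u] by (rule sums_summable)
  show "summable (\<lambda>l. b_seq \<beta> n u (Suc (Suc (2 * j))) l ** a (n + 1 - s + l))" if u: "u \<in> {1..n}"
    using es[OF u] unfolding b[OF u] by (rule sums_summable)
  have ts: "term2 n s u sums (mfc (\<lambda>x. adj (hi x)) (int s - int u) - R.psol (int u) (int s))" if u: "u \<in> {1..n}" for u
    using ss[OF u] u unfolding b[OF u] term2_def[symmetric] by simp
  show "summable (term2 n s u)" if "u \<in> {1..n}" for u using ts[OF that] by (rule sums_summable)
  have "R.rinv (int s) (int t) =
     (\<Sum>u\<in>{1..n}. adj (R.\<alpha> (int s - int u)) ** R.\<alpha> (int t - int u)) +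
     (\<Sum>u\<in>{1..n}. (mfc (\<lambda>x. adj (hi x)) (int s - int u) - R.psol (int u) (int s)) ** R.\<alpha> (int t - int u))"
    unfolding R.rinv_def sum.reindex[OF inj_on_int] o_def ..
  also have "(\<Sum>u\<in>{1..n}. adj (R.\<alpha> (int s - int u)) ** R.\<alpha> (int t - int u)) = (\<Sum>l=max s t..n. adj (a (l - s)) ** a (l - t))"
    using s t by (intro sum.mono_neutral_cong_right) (auto simp: \<alpha>t)
  also have "(\<Sum>u\<in>{1..n}. (mfc (\<lambda>x. adj (hi x)) (int s - int u) - R.psol (int u) (int s)) ** R.\<alpha> (int t - int u)) =
      (\<Sum>u=t..n. (\<Sum>j. term2 n s u j) ** a (u - t))"
    using t by (intro sum.mono_neutral_cong_right) (auto simp: \<alpha>t sums_unique[OF ts])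
  finally show "R.rinv (int s) (int t) =
      (\<Sum>l=max s t..n. adj (a (l - s)) ** a (l - t)) + (\<Sum>u=t..n. (\<Sum>j. term2 n s u j) ** a (u - t))" .
qed

lemma right_inverses:
  assumes s: "s \<in> {1..n}" and t: "t \<in> {1..n}"
  shows "(\<Sum>r=1..n. W (int s - int r) ** left_inv n (int r) (int t)) = (if s = t then mat 1 else 0)"
    and "(\<Sum>r=1..n. W (int s - int r) ** right_inv n (int r) (int t)) = (if s = t then mat 1 else 0)"
proof -
  interpret L: factored_symbol g gi h hi V "{0..}" "{..0}" "{int n + 1..}" "int ` {1..n}" by (rule left)
  interpret R: factored_symbol "\<lambda>x. adj (h x)" "\<lambda>x. adj (hi x)" "\<lambda>x. adj (g x)" "\<lambda>x. adj (gi x)" "\<lambda>x. adj (V x)"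
    "{..0}" "{int n + 1..}" "{..0}" "int ` {1..n}" by (rule right)
  have m: "int s \<in> int ` {1..n}" "int t \<in> int ` {1..n}" using s t by auto
  show "(\<Sum>r=1..n. W (int s - int r) ** L.rinv (int r) (int t)) = (if s = t then mat 1 else 0)"
    using L.toeplitz_rinv[OF m] unfolding sum.reindex[OF inj_on_int] o_def W_def[symmetric] by simp
  show "(\<Sum>r=1..n. W (int s - int r) ** R.rinv (int r) (int t)) = (if s = t then mat 1 else 0)"
    using R.toeplitz_rinv[OF m] unfolding sum.reindex[OF inj_on_int] o_def W_h by simp
qed

end

lemma block_inverse_unique:
  assumes B: "is_block_inverse n T B" and C: "is_block_inverse n T C" and s: "s \<in> {1..n}" and t: "t \<in> {1..n}"
  shows "B s t = C s t"
proof -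
  have "B s t = (\<Sum>q=1..n. B s q ** (if q = t then mat 1 else 0))"
    using t by (simp add: if_distrib cong: if_cong)
  also have "\<dots> = (\<Sum>q=1..n. B s q ** (\<Sum>r=1..n. T q r ** C r t))"
    using C t by (intro sum.cong refl) (simp add: is_block_inverse_def)
  also have "\<dots> = (\<Sum>r=1..n. (\<Sum>q=1..n. B s q ** T q r) ** C r t)"
    unfolding matrix_mult_sum_right matrix_mult_sum_left matrix_mul_assoc by (rule sum.swap)
  also have "\<dots> = (\<Sum>r=1..n. (if s = r then mat 1 else 0) ** C r t)"
    using B s by (intro sum.cong refl) (simp add: is_block_inverse_def)
  also have "\<dots> = C s t"
    using s by (simp add: if_distrib[of "\<lambda>X. X ** _"] cong: if_cong)
  finally show ?thesis .
qed

text \<open>For a Hermitian matrix the adjoint of a right inverse is a left inverse, and then both agree.\<close>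

lemma hermitian_right_inverse:
  fixes T B :: "'d::finite blocks"
  assumes herm: "\<And>s t. adj (T s t) = T t s"
    and B: "\<And>s t. s \<in> {1..n} \<Longrightarrow> t \<in> {1..n} \<Longrightarrow> (\<Sum>r=1..n. T s r ** B r t) = (if s = t then mat 1 else 0)"
  shows "is_block_inverse n T B"
proof -
  have C: "(\<Sum>r=1..n. adj (B r s) ** T r t) = (if s = t then mat 1 else 0)" if "s \<in> {1..n}" "t \<in> {1..n}" for s t
  proof -
    have "(\<Sum>r=1..n. adj (B r s) ** T r t) = adj (\<Sum>r=1..n. T t r ** B r s)"
      unfolding adj_sum adj_mult herm ..
    then show ?thesis using B[OF that(2,1)] by auto
  qed
  have "adj (B t s) = B s t" if s: "s \<in> {1..n}" and t: "t \<in> {1..n}" for s t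
  proof -
    have "adj (B t s) = (\<Sum>q=1..n. adj (B q s) ** (if q = t then mat 1 else 0))"
      using t by (simp add: if_distrib cong: if_cong)
    also have "\<dots> = (\<Sum>q=1..n. adj (B q s) ** (\<Sum>r=1..n. T q r ** B r t))"
      using B t by (intro sum.cong refl) simp
    also have "\<dots> = (\<Sum>r=1..n. (\<Sum>q=1..n. adj (B q s) ** T q r) ** B r t)"
      unfolding matrix_mult_sum_right matrix_mult_sum_left matrix_mul_assoc by (rule sum.swap)
    also have "\<dots> = (\<Sum>r=1..n. (if s = r then mat 1 else 0) ** B r t)"
      using C s by (intro sum.cong refl) simp
    also have "\<dots> = B s t"
      using s by (simp add: if_distrib[of "\<lambda>X. X ** _"] cong: if_cong)
    finally show ?thesis .
  qed
  then have "(\<Sum>r=1..n. B s r ** T r t) = (if s = t then mat 1 else 0)" if "s \<in> {1..n}" "t \<in> {1..n}" for s t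
    using C[OF that] that by simp
  then show ?thesis using B by (simp add: is_block_inverse_def)
qed
section \<open>The boundary data of the outer factors\<close>

lemma taylor_unique:
  assumes F: "\<And>z. z \<in> ball 0 1 \<Longrightarrow> (\<lambda>k. c k * z ^ k) sums F z"
  shows "taylor F k = c k"
proof -
  have hol: "F holomorphic_on ball 0 1"
    by (rule power_series_holomorphic[of 0 1 c]) (use F in simp)
  \<comment> \<open>Both sequences give the Fourier coefficients of \<open>F\<close> on the circle of radius \<open>1/2\<close>; convergence
    at \<open>3/4\<close> makes the series converge absolutely there.\<close>
  have "summable (\<lambda>k. c k * of_real (3/4) ^ k)"
    using F[of "of_real (3/4)"] by (auto simp: sums_iff)
  then have abs: "summable (\<lambda>k. norm (c k * of_real (1/2) ^ k))"
    by (rule powser_insidea) simp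
  have "fc (\<lambda>x. F (of_real (1/2) * cis x)) (int k) = c k * of_real (1/2) ^ k"
  proof -
    have "(\<lambda>k. c k * of_real (1/2) ^ k * cis (real k * x)) sums F (of_real (1/2) * cis x)" for x
      using F[of "of_real (1/2) * cis x"]
      by (simp only: power_mult_distrib Complex.DeMoivre mult.assoc) (simp add: norm_mult)
    from fc_power_series[OF abs this, of "int k"] show ?thesis by simp
  qed
  moreover have "fc (\<lambda>x. F (of_real (1/2) * cis x)) (int k) = taylor F k * of_real (1/2) ^ k"
    using fc_dilation[OF hol, of "1/2" "int k"] by simp
  ultimately show ?thesis by simp
qed

lemma pos_hermitian_det_ne_0:
  fixes A :: "complex^'d^'d"
  assumes "pos_hermitian A" shows "det A \<noteq> 0"
proof -
  have "x = 0" if "A *v x = 0" for x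
  proof (rule ccontr)
    assume "x \<noteq> 0"
    then have "Re (\<Sum>i\<in>UNIV. \<Sum>j\<in>UNIV. cnj (x $ i) * A $ i $ j * x $ j) > 0"
      using assms by (simp add: pos_hermitian_def)
    moreover have "(\<Sum>i\<in>UNIV. \<Sum>j\<in>UNIV. cnj (x $ i) * A $ i $ j * x $ j) = (\<Sum>i\<in>UNIV. cnj (x $ i) * (A *v x) $ i)"
      by (simp add: matrix_vector_mult_def sum_distrib_left mult.assoc)
    ultimately show False using that by simp
  qed
  then have "\<exists>B. B ** A = mat 1" by (simp add: matrix_left_invertible_ker)
  then show ?thesis by (simp add: invertible_det_nz[symmetric] invertible_left_inverse)
qed

lemma matrix_inv_eqI:
  fixes A B :: "complex^'d^'d"
  assumes "A ** B = mat 1" shows "det A \<noteq> 0" "matrix_inv A = B"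
proof -
  have "invertible A" using assms invertible_right_inverse by blast
  then show nz: "det A \<noteq> 0" by (simp add: invertible_det_nz)
  have "matrix_inv A = matrix_inv A ** (A ** B)" by (simp add: assms)
  also have "\<dots> = B" by (simp add: matrix_mul_assoc matrix_inv_mult[OF nz])
  finally show "matrix_inv A = B" .
qed

lemma matrix_inv_adj:
  fixes A :: "complex^'d^'d"
  assumes "det A \<noteq> 0" shows "matrix_inv (adj A) = adj (matrix_inv A)"
  by (rule matrix_inv_eqI(2)) (simp add: adj_mult[symmetric] matrix_inv_mult[OF assms])

lemma hardy2_mat_boundary:
  assumes F: "hardy2_mat F"
  shows "sqint (\<lambda>x. F (cis x))" "k < 0 \<Longrightarrow> mfc (\<lambda>x. F (cis x)) k = 0"
    "mfc (\<lambda>x. F (cis x)) (int m) $ i $ j = taylor (\<lambda>z. F z $ i $ j) m"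
proof -
  have h: "hardy2 (\<lambda>z. F z $ i $ j)" for i j using F by (simp add: hardy2_mat_def)
  note b = hardy2_boundary[OF h]
  show "sqint (\<lambda>x. F (cis x))" unfolding sqint_matrix_iff using b(1) by blast
  show "k < 0 \<Longrightarrow> mfc (\<lambda>x. F (cis x)) k = 0" by (simp add: vec_eq_iff b(2))
  show "mfc (\<lambda>x. F (cis x)) (int m) $ i $ j = taylor (\<lambda>z. F z $ i $ j) m" by (simp add: b(2))
qed

lemma a_seq_eq:
  fixes h :: "complex \<Rightarrow> complex^'d^'d"
  assumes "hardy2_mat (\<lambda>z. matrix_inv (h z))"
  shows "a_seq h k = - mfc (\<lambda>x. matrix_inv (h (cis x))) (int k)"
proof -
  have "taylor (\<lambda>z. (- matrix_inv (h z)) $ i $ j) k = - taylor (\<lambda>z. matrix_inv (h z) $ i $ j) k" for i j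
  proof (rule taylor_unique)
    fix z :: complex assume z: "z \<in> ball 0 1"
    have "(\<lambda>z. matrix_inv (h z) $ i $ j) holomorphic_on ball 0 1"
      using assms by (simp add: hardy2_mat_def hardy2_def)
    from sums_minus[OF taylor_sums[OF this z]]
    show "(\<lambda>k. - taylor (\<lambda>z. matrix_inv (h z) $ i $ j) k * z ^ k) sums (- matrix_inv (h z)) $ i $ j" by simp
  qed
  then show ?thesis
    by (simp add: vec_eq_iff a_seq_def neg_inv_coeff_def taylor_def[symmetric]
        hardy2_mat_boundary(3)[OF assms, unfolded mfc_nth])
qed

lemma at_seq_eq:
  fixes g :: "complex \<Rightarrow> complex^'d^'d"
  assumes "hardy2_mat (\<lambda>z. matrix_inv (g z))" and nz: "\<And>z. cmod z < 1 \<Longrightarrow> det (g z) \<noteq> 0"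
  shows "at_seq g k = - adj (mfc (\<lambda>x. matrix_inv (g (cis x))) (int k))"
proof -
  have "taylor (\<lambda>z. (- matrix_inv (tilde g z)) $ i $ j) k = - cnj (taylor (\<lambda>z. matrix_inv (g z) $ j $ i) k)" for i j
  proof (rule taylor_unique)
    fix z :: complex assume z: "z \<in> ball 0 1"
    have hol: "(\<lambda>z. matrix_inv (g z) $ j $ i) holomorphic_on ball 0 1"
      using assms by (simp add: hardy2_mat_def hardy2_def)
    have "cnj z \<in> ball 0 1" using z by simp
    from sums_minus[OF bounded_linear.sums[OF bounded_linear_cnj taylor_sums[OF hol this]]]
    have "(\<lambda>k. - cnj (taylor (\<lambda>z. matrix_inv (g z) $ j $ i) k) * z ^ k) sums - cnj (matrix_inv (g (cnj z)) $ j $ i)" by simp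
    also have "- cnj (matrix_inv (g (cnj z)) $ j $ i) = (- matrix_inv (tilde g z)) $ i $ j"
      unfolding tilde_def using matrix_inv_adj[OF nz[of "cnj z"]] z by simp
    finally show "(\<lambda>k. - cnj (taylor (\<lambda>z. matrix_inv (g z) $ j $ i) k) * z ^ k) sums (- matrix_inv (tilde g z)) $ i $ j" .
  qed
  then show ?thesis
    by (simp add: vec_eq_iff at_seq_def neg_inv_coeff_def taylor_def[symmetric]
        hardy2_mat_boundary(3)[OF assms(1), unfolded mfc_nth])
qed

text \<open>Measurability of the inverse comes from Cramer's rule, which holds almost everywhere.\<close>

lemma sqint_matrix_inv:
  fixes h :: "complex \<Rightarrow> complex^'d^'d"
  assumes h: "hardy2_mat h" and nz: "AE x in circ. det (h (cis x)) \<noteq> 0"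
    and q: "integrable circ q" "AE x in circ. \<forall>i j. (cmod (matrix_inv (h (cis x)) $ i $ j))\<^sup>2 \<le> q x"
  shows "sqint (\<lambda>x. matrix_inv (h (cis x)) $ i $ j)"
proof (rule sqint_le[OF _ q(1)])
  let ?M = "\<lambda>x. \<chi> k l. if l = i then (if k = j then 1 else 0) else h (cis x) $ k $ l"
  have [measurable]: "(\<lambda>x. h (cis x) $ k $ l) \<in> borel_measurable circ" for k l
    using hardy2_mat_boundary(1)[OF h] by (auto simp: sqint_matrix_iff sqint_def)
  have m: "(\<lambda>x. ?M x $ k $ l) \<in> borel_measurable circ" for k l
    by (cases "l = i") simp_all
  have "(\<lambda>x. det (?M x) / det (h (cis x))) \<in> borel_measurable circ"
    by (intro borel_measurable_divide measurable_det m) measurable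
  then show "(\<lambda>x. matrix_inv (h (cis x)) $ i $ j) \<in> borel_measurable circ"
    by (rule borel_measurable_circ_AE_cong)
       (use nz in \<open>eventually_elim, simp add: matrix_inv_eq_cramer\<close>)
  show "AE x in circ. (norm (matrix_inv (h (cis x)) $ i $ j))\<^sup>2 \<le> q x"
    using q(2) by eventually_elim simp
qed

lemma Re_adj_mult_self: "Re ((adj B ** B) $ j $ j) = (\<Sum>i\<in>UNIV. (cmod (B $ i $ j))\<^sup>2)" for B :: "complex^'d^'d"
proof -
  have "cnj x * x = of_real ((cmod x)\<^sup>2)" for x by (simp only: complex_norm_square mult.commute)
  then show ?thesis by (simp add: matrix_matrix_mult_def del: of_real_power)
qed

lemma entry_sq_le_trace:
  fixes B :: "complex^'d^'d"
  shows "(cmod (B $ i $ j))\<^sup>2 \<le> (\<Sum>k\<in>UNIV. Re ((adj B ** B) $ k $ k))"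
proof -
  have "(cmod (B $ i $ j))\<^sup>2 \<le> (\<Sum>i\<in>UNIV. (cmod (B $ i $ j))\<^sup>2)" by (rule member_le_sum) auto
  also have "\<dots> \<le> (\<Sum>k\<in>UNIV. \<Sum>i\<in>UNIV. (cmod (B $ i $ k))\<^sup>2)"
    by (rule member_le_sum[where f="\<lambda>k. \<Sum>i\<in>UNIV. (cmod (B $ i $ k))\<^sup>2"]) (auto intro: sum_nonneg)
  finally show ?thesis by (simp only: Re_adj_mult_self)
qed

text \<open>The entries of \<open>h\<^sup>-\<^sup>1\<close> and \<open>g\<^sup>-\<^sup>1\<close> are square integrable because the trace of \<open>w\<^sup>-\<^sup>1\<close> is integrable:
  it is the sum of the squared moduli of the entries for either inverse.  On the null set where \<open>V0\<close> is
  not unitary it is replaced by the identity.\<close>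

lemma outer_factors_boundary:
  fixes w h g :: "complex \<Rightarrow> complex^'d^'d"
  assumes w_pos: "AE x in circ. pos_hermitian (w (cis x))"
    and w_inv_L1: "L1_mat (\<lambda>z. matrix_inv (w z))"
    and factors: "outer_factors w h g"
  defines "V0 \<equiv> \<lambda>x. adj (h (cis x)) ** matrix_inv (g (cis x))"
  defines "V \<equiv> \<lambda>x. if adj (V0 x) ** V0 x = mat 1 then V0 x else mat 1"
  shows "boundary_factors (\<lambda>x. h (cis x)) (\<lambda>x. matrix_inv (h (cis x))) (\<lambda>x. g (cis x)) (\<lambda>x. matrix_inv (g (cis x))) V"
    and "AE x in circ. w (cis x) = adj (g (cis x)) ** g (cis x)"
    and "AE x in circ. V x = V0 x" "mintegrable V0"
    and "hardy2_mat (\<lambda>z. matrix_inv (h z))" "hardy2_mat (\<lambda>z. matrix_inv (g z))"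
    and "\<And>z. cmod z < 1 \<Longrightarrow> det (g z) \<noteq> 0"
proof -
  have oh: "outer_mat h" and og: "outer_mat g"
    and wh: "AE x in circ. w (cis x) = h (cis x) ** adj (h (cis x))"
    and wg: "AE x in circ. w (cis x) = adj (g (cis x)) ** g (cis x)"
    using factors by (auto simp: outer_factors_def)
  have mh: "hardy2_mat h" and mg: "hardy2_mat g" using oh og by (auto simp: outer_mat_def)
  have nh: "AE x in circ. det (h (cis x)) \<noteq> 0"
    using w_pos wh by eventually_elim (metis pos_hermitian_det_ne_0 det_mul mult_zero_left)
  have ng: "AE x in circ. det (g (cis x)) \<noteq> 0"
    using w_pos wg by eventually_elim (metis pos_hermitian_det_ne_0 det_mul mult_zero_right)
  define q where "q x = (\<Sum>k\<in>UNIV. Re (matrix_inv (w (cis x)) $ k $ k))" for x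
  have q: "integrable circ q"
    unfolding q_def using w_inv_L1 by (intro Bochner_Integration.integrable_sum integrable_Re) (simp add: L1_mat_def)
  have qh: "AE x in circ. \<forall>i j. (cmod (matrix_inv (h (cis x)) $ i $ j))\<^sup>2 \<le> q x"
    using wh nh
  proof eventually_elim
    case (elim x)
    let ?B = "matrix_inv (h (cis x))"
    have "w (cis x) ** (adj ?B ** ?B) = h (cis x) ** adj (?B ** h (cis x)) ** ?B"
      by (simp add: elim(1) adj_mult matrix_mul_assoc)
    then have "w (cis x) ** (adj ?B ** ?B) = mat 1" by (simp add: matrix_inv_mult[OF elim(2)])
    from matrix_inv_eqI(2)[OF this] show ?case
      unfolding q_def using entry_sq_le_trace[of ?B] by simp
  qed
  have qg: "AE x in circ. \<forall>i j. (cmod (matrix_inv (g (cis x)) $ i $ j))\<^sup>2 \<le> q x"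
    using wg ng
  proof eventually_elim
    case (elim x)
    let ?B = "matrix_inv (g (cis x))"
    have "w (cis x) ** (?B ** adj ?B) = adj (g (cis x)) ** (g (cis x) ** ?B) ** adj ?B"
      by (simp add: elim(1) matrix_mul_assoc)
    then have "w (cis x) ** (?B ** adj ?B) = mat 1"
      by (simp add: matrix_inv_mult[OF elim(2)] adj_mult[symmetric])
    from matrix_inv_eqI(2)[OF this] show ?case
      unfolding q_def using entry_sq_le_trace[of "adj ?B"] by (simp add: complex_mod_cnj)
  qed
  note sh = sqint_matrix_inv[OF mh nh q qh] and sg = sqint_matrix_inv[OF mg ng q qg]
  note ih = hardy2_mat_inverse_outer[OF oh nh sh] and ig = hardy2_mat_inverse_outer[OF og ng sg]
  show "hardy2_mat (\<lambda>z. matrix_inv (h z))" "hardy2_mat (\<lambda>z. matrix_inv (g z))" by (rule ih(1), rule ig(1))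
  show "\<And>z. cmod z < 1 \<Longrightarrow> det (g z) \<noteq> 0" by (rule ig(2))
  show "AE x in circ. w (cis x) = adj (g (cis x)) ** g (cis x)" by (rule wg)
  note bh = hardy2_mat_boundary[OF mh] and bg = hardy2_mat_boundary[OF mg]
    and bhi = hardy2_mat_boundary[OF ih(1)] and bgi = hardy2_mat_boundary[OF ig(1)]
  have weq: "AE x in circ. h (cis x) ** adj (h (cis x)) = adj (g (cis x)) ** g (cis x)"
    using wh wg by eventually_elim simp
  show mV0: "mintegrable V0"
    unfolding V0_def by (intro mintegrable_mult sqint_adj bh bgi)
  have V0_unitary: "AE x in circ. adj (V0 x) ** V0 x = mat 1"
    using weq nh ng
  proof eventually_elim
    case (elim x)
    let ?h = "h (cis x)" and ?g = "g (cis x)" and ?B = "matrix_inv (g (cis x))"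
    have "adj (V0 x) ** V0 x = adj ?B ** (?h ** adj ?h) ** ?B"
      by (simp add: V0_def adj_mult matrix_mul_assoc)
    also have "\<dots> = adj (?g ** ?B) ** (?g ** ?B)"
      unfolding elim(1) by (simp add: adj_mult matrix_mul_assoc)
    finally show ?case by (simp add: matrix_inv_mult[OF elim(3)])
  qed
  show V_V0: "AE x in circ. V x = V0 x"
    using V0_unitary by eventually_elim (simp add: V_def)
  have V1: "adj (V x) ** V x = mat 1" for x by (simp add: V_def)
  show "boundary_factors (\<lambda>x. h (cis x)) (\<lambda>x. matrix_inv (h (cis x))) (\<lambda>x. g (cis x)) (\<lambda>x. matrix_inv (g (cis x))) V"
  proof
    have "V0 \<in> borel_measurable circ"
      using mV0 by (auto simp: borel_measurable_matrix_iff mintegrable_def intro: borel_measurable_integrable)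
    then show "V \<in> borel_measurable circ"
      by (rule borel_measurable_circ_AE_cong) (use V_V0 in \<open>auto elim: eventually_mono\<close>)
    show "adj (V x) ** V x = mat 1" "V x ** adj (V x) = mat 1" for x
      using V1[of x] matrix_left_right_inverse[of "V x" "adj (V x)"] by auto
    show "AE x in circ. V x = adj (h (cis x)) ** matrix_inv (g (cis x))"
      using V_V0 by (simp add: V0_def)
    show "AE x in circ. V x = matrix_inv (h (cis x)) ** adj (g (cis x))"
      using V_V0 weq nh ng
    proof eventually_elim
      case (elim x)
      let ?h = "h (cis x)" and ?g = "g (cis x)"
      have "V x = (matrix_inv ?h ** ?h) ** adj ?h ** matrix_inv ?g"
        by (simp add: elim(1) V0_def matrix_inv_mult[OF elim(3)])
      also have "\<dots> = matrix_inv ?h ** (?h ** adj ?h) ** matrix_inv ?g" by (simp only: matrix_mul_assoc)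
      also have "\<dots> = matrix_inv ?h ** adj ?g ** (?g ** matrix_inv ?g)"
        unfolding elim(2) by (simp only: matrix_mul_assoc)
      finally show ?case by (simp add: matrix_inv_mult[OF elim(4)])
    qed
    show "AE x in circ. h (cis x) ** matrix_inv (h (cis x)) = mat 1" "AE x in circ. matrix_inv (h (cis x)) ** h (cis x) = mat 1"
      using nh by (eventually_elim, simp add: matrix_inv_mult)+
    show "AE x in circ. g (cis x) ** matrix_inv (g (cis x)) = mat 1" "AE x in circ. matrix_inv (g (cis x)) ** g (cis x) = mat 1"
      using ng by (eventually_elim, simp add: matrix_inv_mult)+
  qed (use bh bg bhi bgi weq in auto)
qed

lemma fourier_coeff_eq_mfc: "fourier_coeff F k = mfc (\<lambda>x. F (cis x)) k"
  by (simp add: vec_eq_iff fourier_coeff_def fc_def)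

theorem theorem2p1:
  fixes w h hs :: "complex \<Rightarrow> complex^'d^'d"
    and a a' :: "nat \<Rightarrow> complex^'d^'d"
    and b b' :: "nat \<Rightarrow> nat \<Rightarrow> nat \<Rightarrow> nat \<Rightarrow> complex^'d^'d"
  assumes w_L1: "L1_mat w"
    and w_pos: "AE \<theta> in circ. pos_hermitian (w (cis \<theta>))"
    and w_inv_L1: "L1_mat (\<lambda>z. matrix_inv (w z))"
    and factors: "outer_factors w h hs"
    and a: "a = a_seq h"
    and a': "a' = at_seq hs"
    and b: "b = b_seq (beta h hs)"
    and b': "b' = bt_seq (beta h hs)"
  shows
    "(\<forall>n\<ge>1. block_invertible n (toeplitz w)) \<and>
     (\<forall>n. \<forall>s\<in>{1..n}. \<forall>t\<in>{1..n}.
        (\<forall>u\<in>{1..t}.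
           (\<forall>k\<ge>1. summable (\<lambda>l. b' n u (2*k-1) l ** a (n+1-s+l)) \<and>
                   summable (\<lambda>l. b' n u (2*k) l ** a' (s+l))) \<and>
           summable (\<lambda>j. let k = Suc j in
             adj ((\<Sum>l. b' n u (2*k-1) l ** a (n+1-s+l)) +
                  (\<Sum>l. b' n u (2*k) l ** a' (s+l))) ** a' (t-u))) \<and>
        block_inv n (toeplitz w) s t =
          (\<Sum>l=1..min s t. adj (a' (s-l)) ** a' (t-l)) +
          (\<Sum>u=1..t. \<Sum>j. let k = Suc j in
             adj ((\<Sum>l. b' n u (2*k-1) l ** a (n+1-s+l)) +
                  (\<Sum>l. b' n u (2*k) l ** a' (s+l))) ** a' (t-u))) \<and>
     (\<forall>n. \<forall>s\<in>{1..n}. \<forall>t\<in>{1..n}.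
        (\<forall>u\<in>{t..n}.
           (\<forall>k\<ge>1. summable (\<lambda>l. b n u (2*k-1) l ** a' (s+l)) \<and>
                   summable (\<lambda>l. b n u (2*k) l ** a (n+1-s+l))) \<and>
           summable (\<lambda>j. let k = Suc j in
             adj ((\<Sum>l. b n u (2*k-1) l ** a' (s+l)) +
                  (\<Sum>l. b n u (2*k) l ** a (n+1-s+l))) ** a (u-t))) \<and>
        block_inv n (toeplitz w) s t =
          (\<Sum>l=max s t..n. adj (a (l-s)) ** a (l-t)) +
          (\<Sum>u=t..n. \<Sum>j. let k = Suc j in
             adj ((\<Sum>l. b n u (2*k-1) l ** a' (s+l)) +
                  (\<Sum>l. b n u (2*k) l ** a (n+1-s+l))) ** a (u-t)))"
proof -
  define V0 where "V0 \<theta> = adj (h (cis \<theta>)) ** matrix_inv (hs (cis \<theta>))" for \<theta>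
  define V where "V \<theta> = (if adj (V0 \<theta>) ** V0 \<theta> = mat 1 then V0 \<theta> else mat 1)" for \<theta>
  note bd = outer_factors_boundary[OF w_pos w_inv_L1 factors, folded V0_def, folded V_def]
  interpret boundary_factors "\<lambda>\<theta>. h (cis \<theta>)" "\<lambda>\<theta>. matrix_inv (h (cis \<theta>))"
      "\<lambda>\<theta>. hs (cis \<theta>)" "\<lambda>\<theta>. matrix_inv (hs (cis \<theta>))" V
    by (rule bd(1))
  have a_eq: "local.a = a"
    by (simp add: fun_eq_iff a_def assms(5) a_seq_eq[OF bd(5)])
  have a'_eq: "local.a' = a'"
    by (simp add: fun_eq_iff a'_def assms(6) at_seq_eq[OF bd(6,7)])
  have \<beta>_eq: "\<beta> = beta h hs"
  proof
    fix k
    have "mfc V k = mfc V0 k"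
      by (rule mfc_cong_AE[OF mintegrable_sqint[OF sqint_V] bd(4,3)])
    then show "\<beta> k = beta h hs k"
      by (simp add: \<beta>_def beta_def fourier_coeff_eq_mfc V0_def[abs_def])
  qed
  have b'_eq: "bt_seq \<beta> = b'" and b_eq: "b_seq \<beta> = b" by (simp_all add: \<beta>_eq b b')
  have T: "toeplitz w s t = W (int s - int t)" for s t
    unfolding toeplitz_def fourier_coeff_eq_mfc W_def
    by (rule mfc_cong_AE[OF _ mintegrable_mult[OF sqint_adj[OF sq(3)] sq(3)] bd(2)])
       (use w_L1 in \<open>simp add: L1_mat_def mintegrable_def\<close>)
  have herm: "adj (toeplitz w s t) = toeplitz w t s" for s t
    by (simp add: T W_adj)
  have inv1: "is_block_inverse n (toeplitz w) (\<lambda>s t. left_inv n (int s) (int t))"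
    and inv2: "is_block_inverse n (toeplitz w) (\<lambda>s t. right_inv n (int s) (int t))" for n
    using right_inverses[of _ n] by (intro hermitian_right_inverse[OF herm]; simp add: T)+
  have block: "is_block_inverse n (toeplitz w) (block_inv n (toeplitz w))" for n
    unfolding block_inv_def by (rule someI[of "is_block_inverse n (toeplitz w)", OF inv1])
  have e1: "block_inv n (toeplitz w) s t = left_inv n (int s) (int t)"
    and e2: "block_inv n (toeplitz w) s t = right_inv n (int s) (int t)" if "s \<in> {1..n}" "t \<in> {1..n}" for n s t
    using block_inverse_unique[OF block inv1 that] block_inverse_unique[OF block inv2 that] by auto
  note first = first_expansion[unfolded a_eq a'_eq term1_def b'_eq]
  note second = second_expansion[unfolded a_eq a'_eq term2_def b_eq]
  have sm: "summable (\<lambda>j. X j ** B)" and si: "(\<Sum>j. X j) ** B = (\<Sum>j. X j ** B)"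
    if "summable X" for X :: "nat \<Rightarrow> complex^'d^'d" and B :: "complex^'d^'d"
    using bounded_linear.summable[OF bounded_linear_matrix_mult_left that]
      bounded_linear.suminf[OF bounded_linear_matrix_mult_left that] by auto
  have idx: "Suc (Suc (2 * j)) - 1 = Suc (2 * j)" "2 * Suc j = Suc (Suc (2 * j))" for j by auto
  show ?thesis
  proof (intro conjI allI impI ballI)
    show "block_invertible n (toeplitz w)" for n
      unfolding block_invertible_def using inv1 by blast
  next
    fix n s t u k :: nat assume st: "s \<in> {1..n}" "t \<in> {1..n}" and u: "u \<in> {1..t}" and k: "1 \<le> k"
    obtain j where k: "k = Suc j" using k by (cases k) auto
    have u: "u \<in> {1..n}" using u st by auto
    show "summable (\<lambda>l. b' n u (2 * k - 1) l ** a (n + 1 - s + l))" "summable (\<lambda>l. b' n u (2 * k) l ** a' (s + l))"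
      unfolding k idx by (rule first(1)[OF st u], rule first(2)[OF st u])
  next
    fix n s t u k :: nat assume st: "s \<in> {1..n}" "t \<in> {1..n}" and u: "u \<in> {t..n}" and k: "1 \<le> k"
    obtain j where k: "k = Suc j" using k by (cases k) auto
    have u: "u \<in> {1..n}" using u st by auto
    show "summable (\<lambda>l. b n u (2 * k - 1) l ** a' (s + l))" "summable (\<lambda>l. b n u (2 * k) l ** a (n + 1 - s + l))"
      unfolding k idx by (rule second(1)[OF st u], rule second(2)[OF st u])
  next
    fix n s t u :: nat assume st: "s \<in> {1..n}" "t \<in> {1..n}" and u: "u \<in> {1..t}"
    have u: "u \<in> {1..n}" using u st by auto
    show "summable (\<lambda>j. let k = Suc j in adj ((\<Sum>l. b' n u (2*k-1) l ** a (n+1-s+l)) + (\<Sum>l. b' n u (2*k) l ** a' (s+l))) ** a' (t-u))"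
      unfolding Let_def idx by (rule sm[OF first(3)[OF st u]])
  next
    fix n s t u :: nat assume st: "s \<in> {1..n}" "t \<in> {1..n}" and u: "u \<in> {t..n}"
    have u: "u \<in> {1..n}" using u st by auto
    show "summable (\<lambda>j. let k = Suc j in adj ((\<Sum>l. b n u (2*k-1) l ** a' (s+l)) + (\<Sum>l. b n u (2*k) l ** a (n+1-s+l))) ** a (u-t))"
      unfolding Let_def idx by (rule sm[OF second(3)[OF st u]])
  next
    fix n s t :: nat assume st: "s \<in> {1..n}" "t \<in> {1..n}"
    show "block_inv n (toeplitz w) s t =
        (\<Sum>l=1..min s t. adj (a' (s-l)) ** a' (t-l)) +
        (\<Sum>u=1..t. \<Sum>j. let k = Suc j in adj ((\<Sum>l. b' n u (2*k-1) l ** a (n+1-s+l)) + (\<Sum>l. b' n u (2*k) l ** a' (s+l))) ** a' (t-u))"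
      unfolding e1[OF st] first(4)[OF st] Let_def idx
      by (intro arg_cong2[where f="(+)"] refl sum.cong si first(3)[OF st]) (use st in auto)
    show "block_inv n (toeplitz w) s t =
        (\<Sum>l=max s t..n. adj (a (l-s)) ** a (l-t)) +
        (\<Sum>u=t..n. \<Sum>j. let k = Suc j in adj ((\<Sum>l. b n u (2*k-1) l ** a' (s+l)) + (\<Sum>l. b n u (2*k) l ** a (n+1-s+l))) ** a (u-t))"
      unfolding e2[OF st] second(4)[OF st] Let_def idx
      by (intro arg_cong2[where f="(+)"] refl sum.cong si second(3)[OF st]) (use st in auto)
  qed
qed

end
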